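(* Let $X$ be an irreducible shift of finite type and let $Y$ be a factor of $X$ by a $1$-block code $\pi:X\to Y$. Then there exists a Walters-type compensation function $f\in C(X)$ for $(X,Y,\pi)$ which is $p$-Dini for all $p>1$.
   Context: All shifts are two-sided subshifts over finite alphabets with the shift map. A $1$-block code is a map $\pi$ given by $\pi(x)_i=\Pi(x_i)$ for a map $\Pi$ between alphabets; a factor map is a surjective continuous shift-commuting map. $C(X)$ is the set of continuous real-valued functions on $X$; $\mathcal{M}(X)$ is the set of shift-invariant Borel probability measures on $X$ (similarly $\mathcal{M}(Y)$); $h(\cdot)$ is measure-theoretic (Kolmogorov–Sinai) entropy with respect to the shift; $\mathcal{P}_X,\mathcal{P}_Y$ denote topological pressure. The metric on $X$ is the usual one, $d(x,y)=2^{-\min\{|i|: x_i\neq y_i\}}$ for $x\ne y$. For $f\in C(X)$, $\mathrm{var}_n(f)=\max_{d(x,y)\le 2^{-n}}|f(x)-f(y)|$. The function $f$ is $p$-Dini if $\sum_n(\mathrm{var}_n(f))^p<\infty$. For $\nu\in\mathcal{M}(Y)$, a measure $\mu\in\mathcal{M}(X)$ with $\mu\circ\pi^{-1}=\nu$ is a relative equilibrium state of $f$ over $\nu$ if it attains the supremum $$\sup\Big\{h(\mu')-h(\nu)+\int f\,d\mu' \;:\; \mu'\in\mathcal{M}(X),\ \mu'\circ\pi^{-1}=\nu\Big\}.$$ A compensation function for $(X,Y,\pi)$ is $f\in C(X)$ such that $\mathcal{P}_X(f+\phi\circ\pi)=\mathcal{P}_Y(\phi)$ for all $\phi\in C(Y)$.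 A compensation function $f$ is Walters-type if there exists a subshift $X_0\subset X$ with $\pi|_{X_0}:X_0\to Y$ surjective and finite-to-one such that the relative equilibrium states of $f$ (over every $\nu\in\mathcal{M}(Y)$) are supported on $X_0$. *)

theory Defs
  imports "HOL-Probability.Probability_Measure"
begin

text \<open>
  The alphabet is a type \<open>'a\<close> of sort \<open>{finite, discrete_topology}\<close>, so that the topology and
  the Borel sigma-algebra on \<open>int \<Rightarrow> 'a\<close> are the product ones. A shift need not use every symbol.
  A function in \<open>C(X)\<close> is a total function that is continuous on \<open>X\<close>; its values outside
  \<open>X\<close> never matter.
\<close>

subsection \<open>Subshifts\<close>

definition shift :: "(int \<Rightarrow> 'a) \<Rightarrow> int \<Rightarrow> 'a"
  where "shift x = (\<lambda>i. x (i + 1))"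

definition subshift :: "(int \<Rightarrow> 'a::{finite,discrete_topology}) set \<Rightarrow> bool"
  where "subshift X \<longleftrightarrow> X \<noteq> {} \<and> closed X \<and> shift ` X = X"

definition occurs_in :: "'a list \<Rightarrow> (int \<Rightarrow> 'a) \<Rightarrow> bool"
  where "occurs_in w x \<longleftrightarrow> (\<exists>i. \<forall>k<length w. x (i + int k) = w ! k)"

definition language :: "(int \<Rightarrow> 'a) set \<Rightarrow> 'a list set"
  where "language X = {w. \<exists>x\<in>X. occurs_in w x}"

definition finite_type :: "(int \<Rightarrow> 'a::{finite,discrete_topology}) set \<Rightarrow> bool"
  where "finite_type X \<longleftrightarrow>
    subshift X \<and> (\<exists>F. finite F \<and> X = {x. \<forall>w\<in>F. \<not> occurs_in w x})"

definition irreducible_shift :: "(int \<Rightarrow> 'a) set \<Rightarrow> bool"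
  where "irreducible_shift X \<longleftrightarrow>
    (\<forall>u\<in>language X. \<forall>v\<in>language X. \<exists>w. u @ w @ v \<in> language X)"

definition block_code :: "('a \<Rightarrow> 'b) \<Rightarrow> (int \<Rightarrow> 'a) \<Rightarrow> int \<Rightarrow> 'b"
  where "block_code \<Phi> x = (\<lambda>i. \<Phi> (x i))"

definition factor_map ::
  "(int \<Rightarrow> 'a::{finite,discrete_topology}) set \<Rightarrow> (int \<Rightarrow> 'b::{finite,discrete_topology}) set
    \<Rightarrow> ((int \<Rightarrow> 'a) \<Rightarrow> int \<Rightarrow> 'b) \<Rightarrow> bool"
  where "factor_map X Y \<pi> \<longleftrightarrow>
    continuous_on X \<pi> \<and> \<pi> ` X = Y \<and> (\<forall>x\<in>X. \<pi> (shift x) = shift (\<pi> x))"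


subsection \<open>Variations and Dini conditions\<close>

definition shift_dist :: "(int \<Rightarrow> 'a) \<Rightarrow> (int \<Rightarrow> 'a) \<Rightarrow> real"
  where "shift_dist x y =
    (if x = y then 0 else 1 / 2 ^ (LEAST n. \<exists>i. n = nat \<bar>i\<bar> \<and> x i \<noteq> y i))"

definition var :: "(int \<Rightarrow> 'a) set \<Rightarrow> ((int \<Rightarrow> 'a) \<Rightarrow> real) \<Rightarrow> nat \<Rightarrow> real"
  where "var X f n = Sup {\<bar>f x - f y\<bar> | x y. x \<in> X \<and> y \<in> X \<and> shift_dist x y \<le> 1 / 2 ^ n}"

definition p_Dini :: "(int \<Rightarrow> 'a) set \<Rightarrow> real \<Rightarrow> ((int \<Rightarrow> 'a) \<Rightarrow> real) \<Rightarrow> bool"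
  where "p_Dini X p f \<longleftrightarrow> summable (\<lambda>n. var X f n powr p)"


subsection \<open>Topological pressure\<close>

definition cylinder :: "(int \<Rightarrow> 'a) set \<Rightarrow> 'a list \<Rightarrow> (int \<Rightarrow> 'a) set"
  where "cylinder X w = {x \<in> X. \<forall>k<length w. x (int k) = w ! k}"

text \<open>
  The usual definition for subshifts (R. Bowen, Equilibrium States and the Ergodic Theory of Anosov
  Diffeomorphisms): \<open>P(\<phi>) = lim (1/n) log (\<Sum> exp (sup S\<^sub>n \<phi>))\<close>, with the sum over the words
  \<open>w\<close> of length \<open>n\<close> in the language and the supremum over the cylinder of \<open>w\<close>. For continuous
  \<open>\<phi>\<close> the limit exists by subadditivity.
\<close>
definition pressure :: "(int \<Rightarrow> 'a) set \<Rightarrow> ((int \<Rightarrow> 'a) \<Rightarrow> real) \<Rightarrow> real"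
  where "pressure X \<phi> =
    lim (\<lambda>n. ln (\<Sum>w\<in>{w \<in> language X. length w = n}.
                   exp (SUP x\<in>cylinder X w. \<Sum>k<n. \<phi> ((shift ^^ k) x))) / real n)"


subsection \<open>Invariant measures and Kolmogorov--Sinai entropy\<close>

definition invariant_measures ::
  "(int \<Rightarrow> 'a::{finite,discrete_topology}) set \<Rightarrow> (int \<Rightarrow> 'a) measure set"
  where "invariant_measures X =
    {\<mu>. prob_space \<mu> \<and> sets \<mu> = sets (restrict_space borel X) \<and> distr \<mu> \<mu> shift = \<mu>}"

definition measurable_partitions :: "'x measure \<Rightarrow> 'x set set set"
  where "measurable_partitions M = {P. finite P \<and> P \<subseteq> sets M \<and> partition_on (space M) P}"

text \<open>
  The common refinement of \<open>T\<^sup>-\<^sup>i P\<close> for \<open>i < n\<close>. It may also contain the empty set, which does not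
  contribute to the entropy of the partition.
\<close>
definition iterated_join :: "'x measure \<Rightarrow> ('x \<Rightarrow> 'x) \<Rightarrow> 'x set set \<Rightarrow> nat \<Rightarrow> 'x set set"
  where "iterated_join M T P n =
    (\<lambda>s. {x \<in> space M. \<forall>i<n. (T ^^ i) x \<in> s i}) ` ({..<n} \<rightarrow>\<^sub>E P)"

definition partition_entropy :: "'x measure \<Rightarrow> 'x set set \<Rightarrow> real"
  where "partition_entropy M P = - (\<Sum>A\<in>P. measure M A * ln (measure M A))"

definition ks_entropy :: "'x measure \<Rightarrow> ('x \<Rightarrow> 'x) \<Rightarrow> ereal"
  where "ks_entropy M T =
    (SUP P\<in>measurable_partitions M.
      ereal (lim (\<lambda>n. partition_entropy M (iterated_join M T P n) / real n)))"


subsection \<open>Relative equilibrium states and compensation functions\<close>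

definition measures_over ::
  "(int \<Rightarrow> 'a::{finite,discrete_topology}) set \<Rightarrow> ((int \<Rightarrow> 'a) \<Rightarrow> int \<Rightarrow> 'b)
    \<Rightarrow> (int \<Rightarrow> 'b::{finite,discrete_topology}) measure \<Rightarrow> (int \<Rightarrow> 'a) measure set"
  where "measures_over X \<pi> \<nu> = {\<mu> \<in> invariant_measures X. distr \<mu> \<nu> \<pi> = \<nu>}"

definition relative_equilibrium_state ::
  "(int \<Rightarrow> 'a::{finite,discrete_topology}) set
    \<Rightarrow> ((int \<Rightarrow> 'a) \<Rightarrow> int \<Rightarrow> 'b::{finite,discrete_topology})
    \<Rightarrow> ((int \<Rightarrow> 'a) \<Rightarrow> real) \<Rightarrow> (int \<Rightarrow> 'b) measure \<Rightarrow> (int \<Rightarrow> 'a) measure \<Rightarrow> bool"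
  where "relative_equilibrium_state X \<pi> f \<nu> \<mu> \<longleftrightarrow>
    \<mu> \<in> measures_over X \<pi> \<nu> \<and>
    ks_entropy \<mu> shift - ks_entropy \<nu> shift + ereal (\<integral>x. f x \<partial>\<mu>) =
      (SUP \<mu>'\<in>measures_over X \<pi> \<nu>.
        ks_entropy \<mu>' shift - ks_entropy \<nu> shift + ereal (\<integral>x. f x \<partial>\<mu>'))"

definition compensation_function ::
  "(int \<Rightarrow> 'a::{finite,discrete_topology}) set \<Rightarrow> (int \<Rightarrow> 'b::{finite,discrete_topology}) set
    \<Rightarrow> ((int \<Rightarrow> 'a) \<Rightarrow> int \<Rightarrow> 'b) \<Rightarrow> ((int \<Rightarrow> 'a) \<Rightarrow> real) \<Rightarrow> bool"
  where "compensation_function X Y \<pi> f \<longleftrightarrow>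
    continuous_on X f \<and>
    (\<forall>\<phi>. continuous_on Y \<phi> \<longrightarrow> pressure X (\<lambda>x. f x + \<phi> (\<pi> x)) = pressure Y \<phi>)"

definition Walters_type ::
  "(int \<Rightarrow> 'a::{finite,discrete_topology}) set \<Rightarrow> (int \<Rightarrow> 'b::{finite,discrete_topology}) set
    \<Rightarrow> ((int \<Rightarrow> 'a) \<Rightarrow> int \<Rightarrow> 'b) \<Rightarrow> ((int \<Rightarrow> 'a) \<Rightarrow> real) \<Rightarrow> bool"
  where "Walters_type X Y \<pi> f \<longleftrightarrow>
    (\<exists>X\<^sub>0. subshift X\<^sub>0 \<and> X\<^sub>0 \<subseteq> X \<and> \<pi> ` X\<^sub>0 = Y \<and> (\<forall>y\<in>Y. finite {x \<in> X\<^sub>0. \<pi> x = y}) \<and>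
      (\<forall>\<nu>\<in>invariant_measures Y. \<forall>\<mu>.
        relative_equilibrium_state X \<pi> f \<nu> \<mu> \<longrightarrow> measure \<mu> X\<^sub>0 = 1))"

end

theory Submission
  imports "HOL-Probability.Probability" Defs
begin

text \<open>
  The proof builds a subshift \<open>X\<^sub>0\<close> of lexicographically minimal points of \<open>X\<close> and a function that
  punishes a point for being far from minimal at a small scale.

  A shift of finite type has a splicing property: two points that agree on a block of length \<open>m\<close>
  can be cut and glued there. Fix a linear order on the alphabet. A window of a point is
  reducible if its inside, away from margins of width \<open>m\<close>, can be changed to something
  lexicographically smaller without leaving \<open>X\<close> and without changing the image under the block code.
  Two points with the same image that agree on the margins of a window irreducible for both agree on the
  whole window (\<open>irreducible_unique\<close>), since otherwise the smaller one could be spliced into the larger.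
  So over a word of any length there is a bounded number of irreducible words
  (\<open>irreducible_family\<close>). The points without reducible windows form a subshift \<open>X\<^sub>0\<close>
  (\<open>normal_points\<close>) with finite fibres, and by minimisation and compactness it maps onto \<open>Y\<close>.

  Let \<open>N\<close> be the least radius of a reducible window centred at the origin and
  \<open>g = - \<psi>(N + 1)\<close> with \<open>\<psi>(t) = (L + 2 ln t) / t\<close>, and \<open>g = 0\<close> on \<open>X\<^sub>0\<close>. As \<open>g\<close> at a point is known
  up to \<open>\<psi>(n + 1)\<close> from the coordinates in \<open>[-n, n]\<close>, the variations are of order \<open>ln n / n\<close>, which
  is summable to every power \<open>p > 1\<close>. On the other hand the sum of \<open>g\<close> along a reducible window of length \<open>l\<close> is
  at most \<open>- l \<psi>(l) = - (L + 2 ln l)\<close>. Cutting a word after its shortest reducible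
  prefix, of which there are boundedly many for each length \<open>l\<close>, and using that
  \<open>\<Sum> exp (- L) / l\<^sup>2\<close> is as small as desired, one gets by induction a bound \<open>D\<close>, independent
  of \<open>w\<close>, for the sum of \<open>exp (sup S\<^sub>n g)\<close> over the words above a word \<open>w\<close>
  (\<open>fibre_partition_sum_le\<close>).

  This bound has two consequences. The partition functions of \<open>g + \<phi> \<circ> \<pi>\<close> on \<open>X\<close> and of \<open>\<phi>\<close> on \<open>Y\<close>
  differ by a factor between \<open>1\<close> and \<open>D\<close>; the lower bound holds because \<open>X\<^sub>0\<close> maps onto
  \<open>Y\<close> and \<open>g\<close> vanishes there. So \<open>g\<close> is a compensation function, and so is \<open>2 g\<close>, which also lies
  below \<open>g\<close> and vanishes on \<open>X\<^sub>0\<close> (\<open>compensation_functionI\<close>). Moreover, by the Gibbs inequality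
  on each fibre, \<open>h(\<mu>) + \<integral> g d\<mu> \<le> h(\<nu>)\<close> for every \<open>\<mu>\<close> above \<open>\<nu>\<close>
  (\<open>relative_entropy_penalty_le\<close>). Averaging uniformly over the finite fibres of \<open>X\<^sub>0\<close> lifts \<open>\<nu>\<close> to a measure on
  \<open>X\<^sub>0\<close>, whose entropy is at least \<open>h(\<nu>)\<close> (\<open>lift_to_normal_points\<close>, \<open>ks_entropy_factor_le\<close>).
  Hence a relative equilibrium state \<open>\<mu>\<close> of \<open>2 g\<close> satisfies
  \<open>0 \<le> h(\<mu>) - h(\<nu>) + 2 \<integral> g d\<mu> \<le> \<integral> g d\<mu> \<le> 0\<close>, so that \<open>g = 0\<close> almost everywhere; and \<open>g < 0\<close> off \<open>X\<^sub>0\<close>.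

  To compare these entropies with those of words of length \<open>n\<close>, the Kolmogorov--Sinai generator
  theorem is proved for subshifts (\<open>ks_entropy_subshift\<close>), with partitions replaced by finite-valued maps.
\<close>

section \<open>Points, windows and translations\<close>

definition agree_on :: "int set \<Rightarrow> (int \<Rightarrow> 'a) \<Rightarrow> (int \<Rightarrow> 'a) \<Rightarrow> bool"
  where "agree_on I x z \<longleftrightarrow> (\<forall>i\<in>I. z i = x i)"

definition translate :: "int \<Rightarrow> (int \<Rightarrow> 'a) \<Rightarrow> int \<Rightarrow> 'a"
  where "translate a x = (\<lambda>i. x (i + a))"

lemma translate_apply: "translate a x i = x (i + a)"
  by (simp add: translate_def)

lemma translate_translate: "translate a (translate b x) = translate (a + b) x"
  by (simp add: translate_def algebra_simps)

lemma translate_0 [simp]: "translate 0 x = x"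
  by (simp add: translate_def)

lemma shift_eq_translate: "shift = translate 1"
  by (auto simp: shift_def translate_def)

lemma funpow_shift: "(shift ^^ k) x = translate (int k) x"
proof (induction k)
  case (Suc k)
  then have "(shift ^^ Suc k) x = translate 1 (translate (int k) x)"
    by (simp add: shift_eq_translate)
  then show ?case by (simp add: translate_translate add.commute)
qed simp

lemma agree_on_refl [simp]: "agree_on I x x"
  by (simp add: agree_on_def)

lemma agree_on_sym: "agree_on I x z \<Longrightarrow> agree_on I z x"
  by (simp add: agree_on_def)

lemma agree_on_trans: "agree_on I x y \<Longrightarrow> agree_on I y z \<Longrightarrow> agree_on I x z"
  by (simp add: agree_on_def)

lemma agree_on_mono: "agree_on I x z \<Longrightarrow> J \<subseteq> I \<Longrightarrow> agree_on J x z"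
  by (auto simp: agree_on_def)

lemma translate_mem:
  assumes "subshift X" "x \<in> X"
  shows "translate a x \<in> X"
proof -
  have X: "shift ` X = X"
    using assms(1) by (simp add: subshift_def)
  have pos: "translate (int k) z \<in> X" if "z \<in> X" for k z
    using that
  proof (induction k arbitrary: z)
    case (Suc k)
    have "translate 1 z \<in> X"
      using Suc.prems X unfolding shift_eq_translate by blast
    from Suc.IH[OF this] show ?case
      by (simp add: translate_translate add.commute)
  qed simp
  have neg: "translate (- int k) z \<in> X" if "z \<in> X" for k z
    using that
  proof (induction k arbitrary: z)
    case (Suc k)
    obtain z' where z': "z' \<in> X" "z = translate 1 z'"
      using Suc.prems X unfolding shift_eq_translate by (metis imageE)
    have "translate (- int k) z' \<in> X"
      using Suc.IH[OF z'(1)] .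
    then show ?case
      by (simp add: z'(2) translate_translate)
  qed simp
  show ?thesis
    using pos[OF assms(2), of "nat a"] neg[OF assms(2), of "nat (- a)"]
    by (cases "a \<ge> 0") auto
qed

lemma inj_shift: "inj (shift :: (int \<Rightarrow> 'a) \<Rightarrow> _)"
  by (rule inj_on_inverseI[of _ "translate (- 1)"]) (simp add: shift_eq_translate translate_translate)

lemma finite_set_separated_by_window:
  fixes F :: "(int \<Rightarrow> 'a) set"
  assumes "finite F"
  obtains K where "\<And>x z. x \<in> F \<Longrightarrow> z \<in> F \<Longrightarrow> agree_on {- int K..int K} x z \<Longrightarrow> x = z"
proof
  define d where "d x z = (SOME j. x j \<noteq> z j)" for x z :: "int \<Rightarrow> 'a"
  have d: "x (d x z) \<noteq> z (d x z)" if "x \<noteq> z" for x z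
    unfolding d_def by (rule someI_ex) (use that in \<open>auto simp: fun_eq_iff\<close>)
  define K where "K = Max (insert 0 ((\<lambda>(x, z). nat \<bar>d x z\<bar>) ` (F \<times> F)))"
  fix x z assume x: "x \<in> F" "z \<in> F" and ag: "agree_on {- int K..int K} x z"
  have "nat \<bar>d x z\<bar> \<le> K"
    unfolding K_def by (rule Max_ge) (use x assms in auto)
  then have "d x z \<in> {- int K..int K}" by auto
  then show "x = z" using d[of x z] ag by (auto simp: agree_on_def)
qed

section \<open>Local sets: topology and Borel structure of the full shift\<close>

text \<open>
  The sets determined by the coordinates in \<open>[-k, k]\<close>. They are clopen, form an algebra and generate
  both the topology and the Borel sets, so questions of topology and of measurability reduce to
  them.
\<close>
definition local_set :: "nat \<Rightarrow> (int \<Rightarrow> 'a) set \<Rightarrow> bool"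
  where "local_set k A \<longleftrightarrow> (\<forall>x z. agree_on {- int k..int k} x z \<longrightarrow> (x \<in> A \<longleftrightarrow> z \<in> A))"

lemma open_agree_set:
  fixes x :: "int \<Rightarrow> 'a::{finite,discrete_topology}"
  assumes "finite I"
  shows "open {z. agree_on I x z}"
proof -
  have "{z. agree_on I x z} = {z. \<forall>i\<in>I. z i \<in> {x i}}"
    by (auto simp: agree_on_def)
  moreover have "open {z. \<forall>i\<in>I. z i \<in> {x i}}"
    by (rule product_topology_basis'[OF assms, of "\<lambda>i. {x i}" "\<lambda>i. i"]) (rule discrete_topology_class.open_discrete)
  ultimately show ?thesis by simp
qed

lemma local_set_Compl: "local_set k A \<Longrightarrow> local_set k (- A)"
  by (auto simp: local_set_def)

lemma local_set_mono: "local_set k A \<Longrightarrow> k \<le> l \<Longrightarrow> local_set l A"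
proof -
  assume A: "local_set k A" and kl: "k \<le> l"
  have "agree_on {- int k..int k} x z" if "agree_on {- int l..int l} x z" for x z :: "int \<Rightarrow> 'a"
    by (rule agree_on_mono[OF that]) (use kl in auto)
  then show "local_set l A"
    using A by (simp add: local_set_def)
qed

lemma local_set_Int: "local_set k A \<Longrightarrow> local_set l B \<Longrightarrow> local_set (max k l) (A \<inter> B)"
  using local_set_mono[of k A "max k l"] local_set_mono[of l B "max k l"]
  by (auto simp: local_set_def)

lemma local_set_open:
  fixes A :: "(int \<Rightarrow> 'a::{finite,discrete_topology}) set"
  assumes "local_set k A"
  shows "open A"
proof (subst open_subopen, intro ballI)
  show "\<exists>T. open T \<and> x \<in> T \<and> T \<subseteq> A" if "x \<in> A" for x
    using that assms
    by (intro exI[of _ "{z. agree_on {- int k..int k} x z}"])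
       (auto simp: open_agree_set local_set_def)
qed

lemma local_set_closed:
  fixes A :: "(int \<Rightarrow> 'a::{finite,discrete_topology}) set"
  assumes "local_set k A"
  shows "closed A"
  using local_set_open[OF local_set_Compl[OF assms]] by (simp add: closed_def)

lemma open_contains_agree_set:
  fixes U :: "(int \<Rightarrow> 'a::{finite,discrete_topology}) set"
  assumes "open U" "x \<in> U"
  shows "\<exists>k::nat. \<forall>z. agree_on {- int k..int k} x z \<longrightarrow> z \<in> U"
proof -
  have "openin (product_topology (\<lambda>i. euclidean) UNIV) U"
    using assms(1) by (simp add: open_fun_def)
  then obtain V where V: "finite {i. V i \<noteq> UNIV}" "x \<in> Pi\<^sub>E UNIV V" "Pi\<^sub>E UNIV V \<subseteq> U"
    using assms(2) unfolding openin_product_topology_alt by auto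
  have "\<exists>k. \<forall>i\<in>{i. V i \<noteq> UNIV}. nat \<bar>i\<bar> \<le> k"
    using V(1) by (metis (no_types, lifting) Max_ge finite_imageI imageI)
  then obtain k where k: "\<And>i. V i \<noteq> UNIV \<Longrightarrow> nat \<bar>i\<bar> \<le> k" by auto
  have "z \<in> U" if z: "agree_on {- int k..int k} x z" for z
  proof -
    have "z i \<in> V i" for i
    proof (cases "V i = UNIV")
      case False
      then have "i \<in> {- int k..int k}" using k[of i] by auto
      then have "z i = x i" using z by (auto simp: agree_on_def)
      then show ?thesis using V(2) by auto
    qed simp
    then show ?thesis using V(3) by auto
  qed
  then show ?thesis by blast
qed

text \<open>
  The \<open>k\<close>-th set collects the points whose central cylinder of radius \<open>k\<close> lies in \<open>U\<close>. Since there are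
  only countably many radii, local sets also generate the Borel sets.
\<close>
lemma open_Union_local_set:
  fixes U :: "(int \<Rightarrow> 'a::{finite,discrete_topology}) set"
  assumes "open U"
  obtains A where "\<And>k. local_set k (A k)" "U = (\<Union>k. A k)"
proof
  define A where "A k = {x. \<forall>z. agree_on {- int k..int k} x z \<longrightarrow> z \<in> U}" for k :: nat
  show "local_set k (A k)" for k
    unfolding local_set_def A_def mem_Collect_eq
    using agree_on_trans agree_on_sym by blast
  show "U = (\<Union>k. A k)"
  proof
    show "U \<subseteq> (\<Union>k. A k)"
      using open_contains_agree_set[OF assms] unfolding A_def by blast
    show "(\<Union>k. A k) \<subseteq> U"
      unfolding A_def using agree_on_refl by blast
  qed
qed

lemma sets_borel_local_set:
  "sets (borel :: (int \<Rightarrow> 'a::{finite,discrete_topology}) measure)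
    = sigma_sets UNIV {A. \<exists>k. local_set k A}" (is "?B = ?S")
proof
  interpret S: sigma_algebra UNIV ?S
    by (rule sigma_algebra_sigma_sets) auto
  have "U \<in> ?S" if U: "open U" for U :: "(int \<Rightarrow> 'a) set"
  proof -
    obtain A where A: "\<And>k. local_set k (A k)" "U = (\<Union>k. A k)"
      using open_Union_local_set[OF U] by metis
    have "A k \<in> ?S" for k
      by (rule sigma_sets.Basic) (use A(1) in auto)
    then have "(\<Union>k. A k) \<in> ?S"
      by (rule sigma_sets.Union)
    then show ?thesis unfolding A(2) .
  qed
  then have "{S. open S} \<subseteq> ?S" by auto
  then show "?B \<subseteq> ?S"
    unfolding borel_def by (simp add: S.sigma_sets_subset)
next
  have "{A. \<exists>k. local_set k A} \<subseteq> ?B"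
    by (auto dest: local_set_open)
  then show "?S \<subseteq> ?B"
    using sets.sigma_sets_subset[of "{A. \<exists>k. local_set k A}" "borel :: (int \<Rightarrow> 'a) measure"] by simp
qed

lemma compact_shift_space: "compact (UNIV :: (int \<Rightarrow> 'a::{finite,discrete_topology}) set)"
proof -
  have "compact_space (euclidean :: 'a topology)"
    by (simp add: compact_space_def finite_imp_compact)
  then have "compact_space (product_topology (\<lambda>i. euclidean :: 'a topology) (UNIV :: int set))"
    by (simp add: compact_space_product_topology)
  then show ?thesis
    by (simp add: euclidean_product_topology compact_space_def)
qed

lemma closed_imp_compact_shift:
  fixes A :: "(int \<Rightarrow> 'a::{finite,discrete_topology}) set"
  shows "closed A \<Longrightarrow> compact A"
  using compact_Int_closed[OF compact_shift_space, of A] by simp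

lemma compact_imp_closed_shift:
  fixes A :: "(int \<Rightarrow> 'a::{finite,discrete_topology}) set"
  assumes "compact A"
  shows "closed A"
proof -
  have "Hausdorff_space (product_topology (\<lambda>i. euclidean :: 'a topology) (UNIV :: int set))"
  proof -
    have "Hausdorff_space (euclidean :: 'a topology)"
      unfolding Hausdorff_space_def
    proof (intro allI impI)
      fix x y :: 'a assume "x \<in> topspace euclidean \<and> y \<in> topspace euclidean \<and> x \<noteq> y"
      then show "\<exists>U V. openin euclidean U \<and> openin euclidean V \<and> x \<in> U \<and> y \<in> V \<and> disjnt U V"
        by (intro exI[of _ "{x}"] exI[of _ "{y}"]) (auto simp: disjnt_def intro: discrete_topology_class.open_discrete)
    qed
    then show ?thesis by (simp add: Hausdorff_space_product_topology)
  qed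
  then have "Hausdorff_space (euclidean :: (int \<Rightarrow> 'a) topology)"
    by (simp add: euclidean_product_topology)
  then show ?thesis
    using assms compactin_imp_closedin[of euclidean A] by simp
qed

lemma nested_closed_nonempty:
  fixes A :: "nat \<Rightarrow> (int \<Rightarrow> 'a::{finite,discrete_topology}) set"
  assumes cl: "\<And>k. closed (A k)" and ne: "\<And>k. A k \<noteq> {}"
    and dec: "\<And>k l. k \<le> l \<Longrightarrow> A l \<subseteq> A k"
  shows "(\<Inter>k. A k) \<noteq> {}"
proof -
  have "UNIV \<inter> (\<Inter>k\<in>UNIV. A k) \<noteq> {}"
  proof (rule compact_imp_fip_image[OF compact_shift_space])
    show "closed (A k)" for k by (rule cl)
    show "UNIV \<inter> \<Inter> (A ` I) \<noteq> {}" if I: "finite I" for I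
    proof -
      have "A (Max (insert 0 I)) \<subseteq> A i" if "i \<in> I" for i
        by (rule dec) (use I that in simp)
      then have "A (Max (insert 0 I)) \<subseteq> \<Inter> (A ` I)"
        by blast
      then show ?thesis using ne by (metis Int_UNIV_left subset_empty)
    qed
  qed
  then show ?thesis by simp
qed

lemma continuous_on_translate: "continuous_on A (translate a :: (int \<Rightarrow> 'a::{finite,discrete_topology}) \<Rightarrow> _)"
  by (rule continuous_on_coordinatewise_then_product)
     (auto simp: translate_apply intro: continuous_on_subset[OF continuous_on_product_coordinates])

lemma continuous_on_block_code:
  "continuous_on A (block_code \<Phi> :: (int \<Rightarrow> 'a::{finite,discrete_topology}) \<Rightarrow> (int \<Rightarrow> 'b::{finite,discrete_topology}))"
proof (rule continuous_on_coordinatewise_then_product)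
  fix i
  have "continuous_on A (\<lambda>x. x i :: 'a)"
    by (rule continuous_on_subset[OF continuous_on_product_coordinates]) simp
  then show "continuous_on A (\<lambda>x. block_code \<Phi> x i)"
    unfolding block_code_def
    by (rule continuous_on_compose2[of UNIV \<Phi>, rotated]) auto
qed


section \<open>Splicing and lexicographic reduction\<close>

text \<open>
  If \<open>m\<close> bounds the lengths of the forbidden words, then an occurrence of a forbidden word in the glued
  point lies entirely in one of the two original points, because these agree on the overlap of length \<open>m\<close>.
\<close>
lemma finite_type_splice:
  fixes X :: "(int \<Rightarrow> 'a::{finite,discrete_topology}) set"
  assumes "finite_type X"
  shows "\<exists>m::nat. \<forall>x\<in>X. \<forall>z\<in>X. \<forall>a. agree_on {a..<a + int m} x z
           \<longrightarrow> (\<lambda>i. if i < a then x i else z i) \<in> X"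
proof -
  obtain F where F: "finite F" "X = {x. \<forall>w\<in>F. \<not> occurs_in w x}"
    using assms by (auto simp: finite_type_def)
  define m where "m = Max (insert 0 (length ` F))"
  have m: "length w \<le> m" if "w \<in> F" for w
    unfolding m_def by (rule Max_ge) (use F(1) that in auto)
  have "(\<lambda>i. if i < a then x i else z i) \<in> X" (is "?p \<in> X")
    if x: "x \<in> X" and z: "z \<in> X" and ag: "agree_on {a..<a + int m} x z" for x z a
  proof -
    have "\<not> occurs_in w ?p" if w: "w \<in> F" for w
    proof
      assume "occurs_in w ?p"
      then obtain i where i: "\<forall>k<length w. ?p (i + int k) = w ! k"
        by (auto simp: occurs_in_def)
      have "\<forall>k<length w. z (i + int k) = w ! k" if "i \<ge> a"
        using i that by auto
      moreover have "\<forall>k<length w. x (i + int k) = w ! k" if "i < a"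
      proof (intro allI impI)
        fix k assume k: "k < length w"
        have "z (i + int k) = x (i + int k)" if "i + int k \<ge> a"
          using ag that k m[OF w] \<open>i < a\<close> by (auto simp: agree_on_def)
        then show "x (i + int k) = w ! k"
          using i k by (cases "i + int k < a") auto
      qed
      ultimately have "occurs_in w x \<or> occurs_in w z"
        unfolding occurs_in_def by (meson not_le)
      then show False using x z w F(2) by auto
    qed
    then show ?thesis using F(2) by simp
  qed
  then show ?thesis by blast
qed

text \<open>
  The two margins of width \<open>m\<close> of the window \<open>[i, i + n)\<close>. They cover it if \<open>n \<le> 2 m\<close>.
\<close>
definition boundary :: "nat \<Rightarrow> int \<Rightarrow> nat \<Rightarrow> int set"
  where "boundary m i n = {j. i \<le> j \<and> j < i + int n \<and> (j < i + int m \<or> j \<ge> i + int n - int m)}"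

lemma boundary_subset: "boundary m i n \<subseteq> {i..<i + int n}"
  by (auto simp: boundary_def)

lemma finite_boundary: "finite (boundary m i n)"
  by (rule finite_subset[OF boundary_subset]) simp

lemma card_boundary: "card (boundary m i n) \<le> 2 * m"
proof -
  have "card (boundary m i n) \<le> card ({i..<i + int m} \<union> {i + int n - int m..<i + int n})"
    by (rule card_mono) (auto simp: boundary_def)
  also have "\<dots> \<le> card {i..<i + int m} + card {i + int n - int m..<i + int n}"
    by (rule card_Un_le)
  finally show ?thesis by simp
qed

text \<open>
  The number \<open>m\<close> is the length of overlap that allows two points to be glued. The map \<open>rank\<close> serves to order the
  alphabet.
\<close>
locale lex_reduction =
  fixes X :: "(int \<Rightarrow> 'a::{finite,discrete_topology}) set"
    and \<Phi> :: "'a \<Rightarrow> 'b::{finite,discrete_topology}"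
    and m :: nat and rank :: "'a \<Rightarrow> nat"
  assumes subshift_X: "subshift X"
    and splice: "\<And>x z a. x \<in> X \<Longrightarrow> z \<in> X \<Longrightarrow> agree_on {a..<a + int m} x z
      \<Longrightarrow> (\<lambda>i. if i < a then x i else z i) \<in> X"
    and inj_rank: "inj rank"
begin

text \<open>
  This is transitive and irreflexive, and comparable whenever two points
  differ but agree far to the left, as the points of one reduction do.
\<close>
definition lex_less :: "(int \<Rightarrow> 'a) \<Rightarrow> (int \<Rightarrow> 'a) \<Rightarrow> bool"
  where "lex_less z x \<longleftrightarrow> (\<exists>j. rank (z j) < rank (x j) \<and> (\<forall>k<j. z k = x k))"

text \<open>
  The replacement point is kept equal to \<open>x\<close> on the margins of the window and beyond, so
  that by splicing reducibility depends only on the symbols inside the window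
  (\<open>reducible_cong\<close>) and is inherited by larger windows (\<open>reducible_mono\<close>).
\<close>
definition reducible :: "(int \<Rightarrow> 'a) \<Rightarrow> int \<Rightarrow> nat \<Rightarrow> bool"
  where "reducible x i n \<longleftrightarrow>
    (\<exists>z\<in>X. agree_on {j. j < i + int m \<or> j \<ge> i + int n - int m} x z \<and>
      block_code \<Phi> z = block_code \<Phi> x \<and> lex_less z x)"

definition normal_points :: "(int \<Rightarrow> 'a) set"
  where "normal_points = {x \<in> X. \<forall>i n. \<not> reducible x i n}"

lemma lex_less_irrefl: "\<not> lex_less x x"
  by (simp add: lex_less_def)

lemma lex_less_trans:
  assumes "lex_less x y" "lex_less y z"
  shows "lex_less x z"
proof -
  obtain i where i: "rank (x i) < rank (y i)" "\<And>k. k < i \<Longrightarrow> x k = y k"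
    using assms(1) by (auto simp: lex_less_def)
  obtain j where j: "rank (y j) < rank (z j)" "\<And>k. k < j \<Longrightarrow> y k = z k"
    using assms(2) by (auto simp: lex_less_def)
  have "rank (x (min i j)) < rank (z (min i j))"
    using i j(1) j(2)[of i] i(2)[of j] by (cases i j rule: linorder_cases) (auto simp: min_def)
  moreover have "\<forall>k<min i j. x k = z k"
    using i(2) j(2) by simp
  ultimately show ?thesis unfolding lex_less_def by blast
qed

lemma reducible_mono:
  assumes "reducible x i n" "i' \<le> i" "i + int n \<le> i' + int n'"
  shows "reducible x i' n'"
proof -
  obtain z where z: "z \<in> X" "agree_on {j. j < i + int m \<or> j \<ge> i + int n - int m} x z"
    "block_code \<Phi> z = block_code \<Phi> x" "lex_less z x"
    using assms(1) by (auto simp: reducible_def)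
  have "agree_on {j. j < i' + int m \<or> j \<ge> i' + int n' - int m} x z"
    by (rule agree_on_mono[OF z(2)]) (use assms(2,3) in auto)
  then show ?thesis
    using z unfolding reducible_def by blast
qed

text \<open>
  Splicing twice, once on each margin. If the margins cover the window there is nothing to change.
\<close>
lemma patch_mem:
  assumes x: "x \<in> X" and z: "z \<in> X" and ag: "agree_on (boundary m i n) x z"
  shows "(\<lambda>j. if i \<le> j \<and> j < i + int n then z j else x j) \<in> X" (is "?p \<in> X")
proof (cases "n \<le> 2 * m")
  case True
  have "j \<in> boundary m i n" if "i \<le> j" "j < i + int n" for j
    using that True by (auto simp: boundary_def)
  then have "?p = x"
    using ag by (auto simp: agree_on_def)
  then show ?thesis using x by simp
next
  case False
  define p where "p = (\<lambda>j. if j < i then x j else z j)"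
  have "agree_on {i..<i + int m} x z"
    by (rule agree_on_mono[OF ag]) (use False in \<open>auto simp: boundary_def\<close>)
  then have p: "p \<in> X"
    unfolding p_def by (rule splice[OF x z])
  define a where "a = i + int n - int m"
  have zx: "z j = x j" if "a \<le> j" "j < i + int n" for j
    using ag that False by (auto simp: boundary_def agree_on_def a_def)
  have "agree_on {a..<a + int m} p x"
    using zx False by (auto simp: agree_on_def p_def a_def)
  then have "(\<lambda>j. if j < a then p j else x j) \<in> X"
    by (rule splice[OF p x])
  also have "(\<lambda>j. if j < a then p j else x j) = ?p"
  proof
    fix j show "(if j < a then p j else x j) = ?p j"
      using zx[of j] False by (auto simp: p_def a_def)
  qed
  finally show ?thesis .
qed

lemma reducible_by_patch:
  assumes x: "x \<in> X" and z: "z \<in> X" and ag: "agree_on (boundary m i n) x z"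
    and im: "\<And>j. i \<le> j \<Longrightarrow> j < i + int n \<Longrightarrow> \<Phi> (z j) = \<Phi> (x j)"
    and j: "i \<le> j" "j < i + int n" "rank (z j) < rank (x j)"
    and less: "\<And>k. i \<le> k \<Longrightarrow> k < j \<Longrightarrow> z k = x k"
  shows "reducible x i n"
proof -
  define p where "p = (\<lambda>j. if i \<le> j \<and> j < i + int n then z j else x j)"
  have "p \<in> X" unfolding p_def by (rule patch_mem[OF x z ag])
  moreover have "agree_on {j. j < i + int m \<or> j \<ge> i + int n - int m} x p"
    using ag by (auto simp: agree_on_def p_def boundary_def)
  moreover have "block_code \<Phi> p = block_code \<Phi> x"
    using im by (auto simp: p_def block_code_def)
  moreover have "lex_less p x"
    unfolding lex_less_def p_def by (rule exI[of _ j]) (use j less in auto)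
  ultimately show ?thesis unfolding reducible_def by blast
qed

lemma reducible_cong:
  assumes x: "x \<in> X" and x': "x' \<in> X" and ag: "agree_on {i..<i + int n} x x'"
    and red: "reducible x i n"
  shows "reducible x' i n"
proof -
  obtain z where z: "z \<in> X" "agree_on {j. j < i + int m \<or> j \<ge> i + int n - int m} x z"
    "block_code \<Phi> z = block_code \<Phi> x" "lex_less z x"
    using red by (auto simp: reducible_def)
  obtain j where j: "rank (z j) < rank (x j)" "\<And>k. k < j \<Longrightarrow> z k = x k"
    using z(4) by (auto simp: lex_less_def)
  have "z j \<noteq> x j" using j(1) by auto
  then have "\<not> (j < i + int m \<or> j \<ge> i + int n - int m)"
    using z(2) by (auto simp: agree_on_def)
  then have jw: "i \<le> j" "j < i + int n" by auto
  have xx': "x' k = x k" if "i \<le> k" "k < i + int n" for k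
    using ag that by (auto simp: agree_on_def)
  show ?thesis
  proof (rule reducible_by_patch[OF x' z(1) _ _ jw])
    show "agree_on (boundary m i n) x' z"
      using z(2) xx' by (auto simp: agree_on_def boundary_def)
    show "\<Phi> (z k) = \<Phi> (x' k)" if "i \<le> k" "k < i + int n" for k
      using fun_cong[OF z(3), of k] xx'[OF that] by (simp add: block_code_def)
    show "rank (z j) < rank (x' j)" using j(1) xx' jw by simp
    show "z k = x' k" if "i \<le> k" "k < j" for k
      using j(2)[of k] xx'[of k] that jw by simp
  qed
qed

text \<open>
  At the first difference one of the two points has the smaller symbol, and its window can be patched
  into the other point, which is then reducible.
\<close>
lemma irreducible_unique:
  assumes x: "x \<in> X" and x': "x' \<in> X" and ag: "agree_on (boundary m i n) x x'"
    and im: "\<And>j. i \<le> j \<Longrightarrow> j < i + int n \<Longrightarrow> \<Phi> (x' j) = \<Phi> (x j)"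
    and nr: "\<not> reducible x i n" "\<not> reducible x' i n"
  shows "agree_on {i..<i + int n} x x'"
proof (rule ccontr)
  define S where "S = {j \<in> {i..<i + int n}. x' j \<noteq> x j}"
  assume "\<not> ?thesis"
  then have "S \<noteq> {}" by (auto simp: S_def agree_on_def)
  moreover have "finite S"
    by (rule finite_subset[of _ "{i..<i + int n}"]) (auto simp: S_def)
  ultimately have S: "S \<noteq> {}" "finite S" by simp_all
  define j where "j = Min S"
  have jS: "j \<in> S" unfolding j_def by (rule Min_in[OF S(2,1)])
  then have j: "i \<le> j" "j < i + int n" "x' j \<noteq> x j" by (auto simp: S_def)
  have less: "x' k = x k" if "i \<le> k" "k < j" for k
  proof (rule ccontr)
    assume "x' k \<noteq> x k"
    then have "k \<in> S" using that j(2) by (auto simp: S_def)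
    then have "j \<le> k" unfolding j_def by (rule Min_le[OF S(2)])
    then show False using that by simp
  qed
  have "rank (x' j) \<noteq> rank (x j)" using j(3) inj_rank by (auto dest: injD)
  then consider "rank (x' j) < rank (x j)" | "rank (x j) < rank (x' j)" by linarith
  then show False
  proof cases
    case 1
    have "reducible x i n"
      by (rule reducible_by_patch[OF x x' ag im j(1,2) 1 less])
    then show False using nr by simp
  next
    case 2
    have "reducible x' i n"
      by (rule reducible_by_patch[OF x' x agree_on_sym[OF ag] im[symmetric] j(1,2) 2 less[symmetric]])
    then show False using nr by simp
  qed
qed

lemma reducible_translateI:
  assumes "reducible x (i + a) n"
  shows "reducible (translate a x) i n"
proof -
  obtain z where z: "z \<in> X" "agree_on {j. j < i + a + int m \<or> j \<ge> i + a + int n - int m} x z"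
    "block_code \<Phi> z = block_code \<Phi> x" "lex_less z x"
    using assms by (auto simp: reducible_def)
  obtain j where j: "rank (z j) < rank (x j)" "\<And>k. k < j \<Longrightarrow> z k = x k"
    using z(4) by (auto simp: lex_less_def)
  have "agree_on {j. j < i + int m \<or> j \<ge> i + int n - int m} (translate a x) (translate a z)"
    using z(2) by (auto simp: agree_on_def translate_apply)
  moreover have "block_code \<Phi> (translate a z) = block_code \<Phi> (translate a x)"
    using z(3) by (auto simp: block_code_def translate_apply fun_eq_iff)
  moreover have "lex_less (translate a z) (translate a x)"
    unfolding lex_less_def by (rule exI[of _ "j - a"]) (use j in \<open>auto simp: translate_apply\<close>)
  ultimately show ?thesis
    using translate_mem[OF subshift_X z(1)] unfolding reducible_def by blast
qed

lemma reducible_translate: "reducible (translate a x) i n \<longleftrightarrow> reducible x (i + a) n"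
  using reducible_translateI[of x i a n] reducible_translateI[of "translate a x" "i + a" "- a" n]
  by (auto simp: translate_translate)

text \<open>
  By uniqueness such points are determined by their symbols on the at most \<open>2 m\<close> positions of the margins.
\<close>
lemma irreducible_family:
  assumes SX: "S \<subseteq> X"
    and inj: "\<And>x x'. x \<in> S \<Longrightarrow> x' \<in> S \<Longrightarrow> agree_on {i..<i + int n} x x' \<Longrightarrow> x = x'"
    and im: "\<And>x x' j. x \<in> S \<Longrightarrow> x' \<in> S \<Longrightarrow> i \<le> j \<Longrightarrow> j < i + int n \<Longrightarrow> \<Phi> (x' j) = \<Phi> (x j)"
    and nr: "\<And>x. x \<in> S \<Longrightarrow> \<not> reducible x i n"
  shows "finite S" "card S \<le> CARD('a) ^ (2 * m)"
proof -
  define B where "B = boundary m i n"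
  define f where "f x = restrict x B" for x :: "int \<Rightarrow> 'a"
  have fin: "finite (B \<rightarrow>\<^sub>E (UNIV :: 'a set))"
    by (rule finite_PiE) (simp_all add: B_def finite_boundary)
  have sub: "f ` S \<subseteq> B \<rightarrow>\<^sub>E UNIV"
    by (auto simp: f_def)
  have injf: "inj_on f S"
  proof (rule inj_onI)
    fix x x' assume x: "x \<in> S" "x' \<in> S" and eq: "f x = f x'"
    have "x' j = x j" if "j \<in> B" for j
      using fun_cong[OF eq, of j] that by (simp add: f_def)
    then have "agree_on (boundary m i n) x x'"
      by (simp add: agree_on_def B_def)
    then have "agree_on {i..<i + int n} x x'"
      using irreducible_unique[of x x' i n] x SX im nr by blast
    then show "x = x'" by (rule inj[OF x])
  qed
  show "finite S"
    by (rule inj_on_finite[OF injf sub fin])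
  have "card S \<le> card (B \<rightarrow>\<^sub>E (UNIV :: 'a set))"
    by (rule card_inj_on_le[OF injf sub fin])
  also have "\<dots> = CARD('a) ^ card B"
    by (simp add: card_PiE B_def finite_boundary)
  also have "\<dots> \<le> CARD('a) ^ (2 * m)"
    unfolding B_def by (rule power_increasing[OF card_boundary]) simp
  finally show "card S \<le> CARD('a) ^ (2 * m)" .
qed

lemma closed_X: "closed X"
  using subshift_X by (simp add: subshift_def)

lemma closed_irreducible: "closed {x \<in> X. \<not> reducible x i n}"
proof -
  define L where "L = {x. \<forall>x'\<in>X. agree_on {i..<i + int n} x x' \<longrightarrow> \<not> reducible x' i n}"
  define k where "k = nat \<bar>i\<bar> + n"
  have "local_set k L"
    unfolding local_set_def
  proof (intro allI impI)
    fix x z :: "int \<Rightarrow> 'a" assume "agree_on {- int k..int k} x z"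
    then have "agree_on {i..<i + int n} x z"
      by (rule agree_on_mono) (auto simp: k_def)
    then show "x \<in> L \<longleftrightarrow> z \<in> L"
      unfolding L_def mem_Collect_eq by (meson agree_on_sym agree_on_trans)
  qed
  then have "closed L" by (rule local_set_closed)
  moreover have "{x \<in> X. \<not> reducible x i n} = X \<inter> L"
  proof
    show "{x \<in> X. \<not> reducible x i n} \<subseteq> X \<inter> L"
    proof
      fix x assume x: "x \<in> {x \<in> X. \<not> reducible x i n}"
      have "\<not> reducible x' i n" if "x' \<in> X" "agree_on {i..<i + int n} x x'" for x'
        using reducible_cong[OF that(1) _ agree_on_sym[OF that(2)]] x by auto
      then show "x \<in> X \<inter> L" using x by (simp add: L_def)
    qed
    show "X \<inter> L \<subseteq> {x \<in> X. \<not> reducible x i n}"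
      using agree_on_refl by (auto simp: L_def)
  qed
  ultimately show ?thesis using closed_X by auto
qed

lemma closed_fibre: "closed {x. block_code \<Phi> x = y}"
proof -
  have "local_set (nat \<bar>i\<bar>) {x. \<Phi> (x i) = y i}" for i
  proof -
    have "i \<in> {- int (nat \<bar>i\<bar>)..int (nat \<bar>i\<bar>)}" by auto
    then show ?thesis unfolding local_set_def agree_on_def by simp
  qed
  then have "closed {x. \<Phi> (x i) = y i}" for i
    by (rule local_set_closed)
  then have "closed (\<Inter>i. {x. \<Phi> (x i) = y i})" by blast
  also have "(\<Inter>i. {x. \<Phi> (x i) = y i}) = {x. block_code \<Phi> x = y}"
    by (auto simp: block_code_def)
  finally show ?thesis .
qed

text \<open>
  Only finitely many points arise by changing the inside of the window, so one of them is
  lexicographically minimal.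
\<close>
lemma exists_irreducible:
  assumes x: "x \<in> X"
  shows "\<exists>z\<in>X. block_code \<Phi> z = block_code \<Phi> x \<and> \<not> reducible z i n"
proof -
  define E where "E = {j. j < i + int m \<or> j \<ge> i + int n - int m}"
  define S where "S = {z \<in> X. agree_on E x z \<and> block_code \<Phi> z = block_code \<Phi> x}"
  have fin: "finite ((- E) \<rightarrow>\<^sub>E (UNIV :: 'a set))"
  proof (rule finite_PiE)
    have "- E \<subseteq> {i..<i + int n}" by (auto simp: E_def)
    then show "finite (- E)" by (rule finite_subset) simp
  qed simp
  have inj: "inj_on (\<lambda>z. restrict z (- E)) S"
  proof (rule inj_onI)
    fix z z' assume z: "z \<in> S" "z' \<in> S" and eq: "restrict z (- E) = restrict z' (- E)"
    show "z = z'"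
    proof
      fix j show "z j = z' j"
        using z fun_cong[OF eq, of j] by (cases "j \<in> E") (auto simp: S_def agree_on_def)
    qed
  qed
  have finS: "finite S"
    by (rule inj_on_finite[OF inj _ fin]) auto
  have "x \<in> S" using x by (simp add: S_def)
  then have ne: "S \<noteq> {}" by blast
  have "asymp_on S lex_less"
    using lex_less_trans lex_less_irrefl by (intro asymp_onI) blast
  moreover have "transp_on S lex_less"
    using lex_less_trans by (intro transp_onI) blast
  ultimately obtain z where z: "z \<in> S" "\<forall>z'\<in>S. z' \<noteq> z \<longrightarrow> \<not> lex_less z' z"
    using Finite_Set.bex_min_element[OF finS _ _ ne, of lex_less] by blast
  have "\<not> reducible z i n"
  proof
    assume "reducible z i n"
    then obtain z' where z': "z' \<in> X" "agree_on E z z'"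
      "block_code \<Phi> z' = block_code \<Phi> z" "lex_less z' z"
      unfolding reducible_def E_def[symmetric] by blast
    have "z' \<in> S"
      using z' z(1) agree_on_trans[of E x z z'] by (simp add: S_def)
    then have "z' = z" using z(2) z'(4) by auto
    then show False using z'(4) lex_less_irrefl by simp
  qed
  then show ?thesis using z(1) by (auto simp: S_def)
qed

text \<open>
  Compactness: the points over a given image without reducible centred windows of radius \<open>k\<close> form a
  decreasing sequence of nonempty closed sets.
\<close>
lemma normal_points_over:
  assumes "x \<in> X"
  shows "\<exists>z\<in>normal_points. block_code \<Phi> z = block_code \<Phi> x"
proof -
  define A where "A k = {z \<in> X. \<not> reducible z (- int k) (2 * k + 1)} \<inter>
    {z. block_code \<Phi> z = block_code \<Phi> x}" for k :: nat
  have "(\<Inter>k. A k) \<noteq> {}"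
  proof (rule nested_closed_nonempty)
    show "closed (A k)" for k
      unfolding A_def by (intro closed_Int closed_irreducible closed_fibre)
    show "A k \<noteq> {}" for k
      using exists_irreducible[OF assms, of "- int k" "2 * k + 1"] by (auto simp: A_def)
    show "A l \<subseteq> A k" if "k \<le> l" for k l
      using that reducible_mono[of _ "- int k" "2 * k + 1" "- int l" "2 * l + 1"]
      by (auto simp: A_def)
  qed
  then obtain z where z: "\<And>k. z \<in> A k" by blast
  have "\<not> reducible z i n" for i n
  proof
    assume "reducible z i n"
    then have "reducible z (- int (nat \<bar>i\<bar> + n)) (2 * (nat \<bar>i\<bar> + n) + 1)"
      by (rule reducible_mono) auto
    then show False using z[of "nat \<bar>i\<bar> + n"] by (auto simp: A_def)
  qed
  then show ?thesis using z[of 0] by (auto simp: A_def normal_points_def)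
qed

lemma normal_points_subset: "normal_points \<subseteq> X"
  by (auto simp: normal_points_def)

lemma translate_normal_points: "x \<in> normal_points \<Longrightarrow> translate a x \<in> normal_points"
  by (auto simp: normal_points_def reducible_translate translate_mem[OF subshift_X])

lemma subshift_normal_points: "subshift normal_points"
proof -
  obtain x where "x \<in> X" using subshift_X by (auto simp: subshift_def)
  then have ne: "normal_points \<noteq> {}" using normal_points_over by blast
  have "normal_points = X \<inter> (\<Inter>i n. {x \<in> X. \<not> reducible x i n})"
    by (auto simp: normal_points_def)
  moreover have "closed (X \<inter> (\<Inter>i n. {x \<in> X. \<not> reducible x i n}))"
    by (intro closed_Int closed_X closed_INT ballI closed_irreducible)
  ultimately have cl: "closed normal_points" by simp
  have "x \<in> shift ` normal_points" if "x \<in> normal_points" for x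
    by (rule image_eqI[of _ _ "translate (- 1) x"])
       (use that in \<open>simp_all add: shift_eq_translate translate_translate translate_normal_points\<close>)
  moreover have "shift x \<in> normal_points" if "x \<in> normal_points" for x
    using that by (simp add: shift_eq_translate translate_normal_points)
  ultimately have "shift ` normal_points = normal_points" by blast
  with ne cl show ?thesis by (simp add: subshift_def)
qed

text \<open>
  Finitely many points of a fibre are distinguished by some window, and there the bound on irreducible
  families does not depend on the window.
\<close>
lemma finite_normal_fibre: "finite {x \<in> normal_points. block_code \<Phi> x = y}"
proof -
  define F where "F = {x \<in> normal_points. block_code \<Phi> x = y}"
  have "finite F \<and> card F \<le> CARD('a) ^ (2 * m)"
  proof (rule finite_if_finite_subsets_card_bdd)
    fix G assume G: "G \<subseteq> F" "finite G"
    obtain K where K: "\<And>x z. x \<in> G \<Longrightarrow> z \<in> G \<Longrightarrow> agree_on {- int K..int K} x z \<Longrightarrow> x = z"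
      using finite_set_separated_by_window[OF G(2)] by blast
    show "card G \<le> CARD('a) ^ (2 * m)"
    proof (rule irreducible_family(2)[of G "- int K" "2 * K + 1"])
      show "G \<subseteq> X" using G(1) by (auto simp: F_def normal_points_def)
      show "x = x'" if "x \<in> G" "x' \<in> G" "agree_on {- int K..<- int K + int (2 * K + 1)} x x'" for x x'
        by (rule K[OF that(1,2)]) (rule agree_on_mono[OF that(3)], auto)
      show "\<Phi> (x' j) = \<Phi> (x j)" if "x \<in> G" "x' \<in> G" for x x' j
      proof -
        have "x \<in> F" "x' \<in> F" using that G(1) by auto
        then have "block_code \<Phi> x' j = block_code \<Phi> x j" by (simp add: F_def)
        then show ?thesis by (simp add: block_code_def)
      qed
      show "\<not> reducible x (- int K) (2 * K + 1)" if "x \<in> G" for x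
        using that G(1) by (auto simp: F_def normal_points_def)
    qed
  qed
  then show ?thesis by (simp add: F_def)
qed

end


section \<open>The penalty function\<close>

text \<open>
  The rate is chosen so that \<open>t\<close> times it is \<open>L + 2 ln t\<close>: a window of length \<open>t\<close> penalised at
  this rate contributes the factor \<open>exp (- L) / t\<^sup>2\<close>, summable in \<open>t\<close>, whereas the rate itself still
  decays almost like \<open>1 / t\<close>. It is decreasing on \<open>[1, \<infinity>)\<close> as soon as \<open>L \<ge> 2\<close>.
\<close>
definition penalty_rate :: "real \<Rightarrow> real \<Rightarrow> real"
  where "penalty_rate L t = (L + 2 * ln t) / t"

lemma penalty_rate_nonneg: "0 \<le> L \<Longrightarrow> 1 \<le> t \<Longrightarrow> 0 \<le> penalty_rate L t"
  by (simp add: penalty_rate_def)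

lemma penalty_rate_pos: "0 < L \<Longrightarrow> 1 \<le> t \<Longrightarrow> 0 < penalty_rate L t"
  by (simp add: penalty_rate_def add_pos_nonneg)

lemma penalty_rate_antimono:
  assumes L: "2 \<le> L" and s: "1 \<le> s" and st: "s \<le> t"
  shows "penalty_rate L t \<le> penalty_rate L s"
proof (rule DERIV_nonpos_imp_nonincreasing[OF st])
  fix x assume x: "s \<le> x" "x \<le> t"
  then have x1: "1 \<le> x" using s by simp
  have "(penalty_rate L has_real_derivative ((2 - (L + 2 * ln x)) / x\<^sup>2)) (at x)"
    unfolding penalty_rate_def
    using x1 by (auto intro!: derivative_eq_intros simp: field_simps power2_eq_square)
  moreover have "(2 - (L + 2 * ln x)) / x\<^sup>2 \<le> 0"
  proof (rule divide_nonpos_nonneg)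
    show "2 - (L + 2 * ln x) \<le> 0" using L ln_ge_zero[OF x1] by linarith
  qed simp
  ultimately show "\<exists>y. (penalty_rate L has_real_derivative y) (at x) \<and> y \<le> 0" by blast
qed

lemma penalty_rate_tendsto_0: "(\<lambda>n. penalty_rate L (real n + 1)) \<longlonglongrightarrow> 0"
  unfolding penalty_rate_def by real_asymp

text \<open>
  The logarithm is absorbed into a power \<open>t powr e\<close> so small that \<open>(1 - e) p\<close> still exceeds \<open>1\<close>.
\<close>
lemma summable_penalty_rate:
  assumes L: "0 \<le> L" and p: "1 < p"
  shows "summable (\<lambda>n. (2 * penalty_rate L (real n + 1)) powr p)"
proof -
  define e where "e = (p - 1) / (2 * p)"
  have e: "0 < e" using p by (simp add: e_def)
  define C where "C = 2 * (L + 2 / e)"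
  have C: "0 \<le> C" using L e by (simp add: C_def)
  have bound: "(2 * penalty_rate L (real n + 1)) powr p \<le> C powr p * (real n + 1) powr (- (p + 1) / 2)" for n
  proof -
    define t where "t = real n + 1"
    have t: "1 \<le> t" by (simp add: t_def)
    define A B where "A = L * t powr e" and "B = t powr e / e"
    have A: "L \<le> A"
      using mult_left_mono[of 1 "t powr e" L] L t e by (simp add: A_def ge_one_powr_ge_zero)
    have B: "ln t \<le> B"
      unfolding B_def using ln_powr_bound[OF t e] .
    have "2 * (L + 2 * ln t) \<le> 2 * A + 4 * B"
      using A B by (simp add: algebra_simps)
    also have "\<dots> = C * t powr e"
      by (simp add: C_def A_def B_def algebra_simps)
    finally have "2 * (L + 2 * ln t) \<le> C * t powr e" .
    then have "2 * penalty_rate L t \<le> C * t powr e / t"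
      using t by (simp add: penalty_rate_def divide_right_mono)
    also have "\<dots> = C * t powr (e - 1)"
      using t by (simp add: powr_diff)
    finally have "(2 * penalty_rate L t) powr p \<le> (C * t powr (e - 1)) powr p"
      using p penalty_rate_nonneg[OF L t] by (intro powr_mono2) auto
    also have "\<dots> = C powr p * t powr ((e - 1) * p)"
      using C by (simp add: powr_mult powr_powr)
    also have "(e - 1) * p = - (p + 1) / 2"
      using p by (simp add: e_def field_simps)
    finally show ?thesis by (simp add: t_def)
  qed
  have "summable (\<lambda>n. real n powr (- (p + 1) / 2))"
    using p by (subst summable_real_powr_iff) auto
  then have "summable (\<lambda>n. real (Suc n) powr (- (p + 1) / 2))"
    by (subst summable_Suc_iff)
  then have "summable (\<lambda>n. C powr p * (real n + 1) powr (- (p + 1) / 2))"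
    by (intro summable_mult) (simp add: add.commute)
  then show ?thesis
    by (rule summable_comparison_test'[of _ 0]) (use bound in auto)
qed

lemma agree_on_if_shift_dist_le:
  "shift_dist x z \<le> 1 / 2 ^ n \<Longrightarrow> n > 0 \<Longrightarrow> agree_on {- int (n - 1)..int (n - 1)} x z"
proof (cases "x = z")
  case False
  assume d: "shift_dist x z \<le> 1 / 2 ^ n" and n: "n > 0"
  define l where "l = (LEAST n. \<exists>i. n = nat \<bar>i\<bar> \<and> x i \<noteq> z i)"
  have "(1::real) / 2 ^ l \<le> 1 / 2 ^ n"
    using d False by (simp add: shift_dist_def l_def)
  then have "(2::real) ^ n \<le> 2 ^ l"
    by (simp add: field_simps)
  then have nl: "n \<le> l"
    by (simp add: power_increasing_iff)
  show ?thesis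
    unfolding agree_on_def
  proof (intro ballI, rule ccontr)
    fix i assume i: "i \<in> {- int (n - 1)..int (n - 1)}" and ne: "z i \<noteq> x i"
    have "l \<le> nat \<bar>i\<bar>"
      unfolding l_def by (rule Least_le) (use ne in auto)
    then show False using i nl n by auto
  qed
qed simp

context lex_reduction
begin

text \<open>
  Meaningful only if some window is reducible, since then a centred one is.
\<close>
definition reduction_radius :: "(int \<Rightarrow> 'a) \<Rightarrow> nat"
  where "reduction_radius x = (LEAST n. reducible x (- int n) (2 * n + 1))"

definition penalty :: "real \<Rightarrow> (int \<Rightarrow> 'a) \<Rightarrow> real"
  where "penalty L x = (if \<exists>i n. reducible x i n
    then - penalty_rate L (real (reduction_radius x) + 1) else 0)"

lemma reducible_centred:
  assumes "reducible x i n" "- int k \<le> i" "i + int n \<le> int k + 1"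
  shows "reducible x (- int k) (2 * k + 1)"
  by (rule reducible_mono[OF assms(1)]) (use assms in auto)

lemma reduction_radius_le:
  assumes "reducible x i n" "- int k \<le> i" "i + int n \<le> int k + 1"
  shows "reduction_radius x \<le> k"
  unfolding reduction_radius_def by (rule Least_le) (rule reducible_centred[OF assms])

lemma reducible_radius:
  assumes "reducible x i n"
  shows "reducible x (- int (reduction_radius x)) (2 * reduction_radius x + 1)"
  unfolding reduction_radius_def
  by (rule LeastI[of _ "nat \<bar>i\<bar> + n"]) (rule reducible_centred[OF assms], auto)

lemma penalty_eq_0: "x \<in> normal_points \<Longrightarrow> penalty L x = 0"
  by (simp add: penalty_def normal_points_def)

lemma penalty_nonpos: "0 \<le> L \<Longrightarrow> penalty L x \<le> 0"
  by (simp add: penalty_def penalty_rate_nonneg)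

lemma penalty_neg: "0 < L \<Longrightarrow> x \<in> X \<Longrightarrow> x \<notin> normal_points \<Longrightarrow> penalty L x < 0"
  by (auto simp: penalty_def normal_points_def penalty_rate_pos)

text \<open>
  A reducible window of length \<open>n\<close> around the origin lies in the centred window of radius \<open>n - 1\<close>.
\<close>
lemma penalty_le:
  assumes L: "2 \<le> L" and red: "reducible x i n" and i: "i \<le> 0" "0 < i + int n"
  shows "penalty L x \<le> - penalty_rate L (real n)"
proof -
  have n: "0 < n" using i by simp
  have "reduction_radius x \<le> n - 1"
    by (rule reduction_radius_le[OF red]) (use i n in auto)
  then have "real (reduction_radius x) + 1 \<le> real n" using n by linarith
  then have "penalty_rate L (real n) \<le> penalty_rate L (real (reduction_radius x) + 1)"
    using L by (intro penalty_rate_antimono) auto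
  then show ?thesis using red by (auto simp: penalty_def)
qed

lemma penalty_ge:
  assumes L: "2 \<le> L" and nr: "\<not> reducible x (- int n) (2 * n + 1)"
  shows "- penalty_rate L (real n + 1) \<le> penalty L x"
proof (cases "\<exists>i n. reducible x i n")
  case True
  then have red: "reducible x (- int (reduction_radius x)) (2 * reduction_radius x + 1)"
    using reducible_radius by blast
  have "n \<le> reduction_radius x"
  proof (rule ccontr)
    assume "\<not> ?thesis"
    then have "reducible x (- int n) (2 * n + 1)"
      by (intro reducible_centred[OF red]) auto
    then show False using nr by simp
  qed
  then have "penalty_rate L (real (reduction_radius x) + 1) \<le> penalty_rate L (real n + 1)"
    using L by (intro penalty_rate_antimono) auto
  then show ?thesis using True by (simp add: penalty_def)
next
  case False
  then show ?thesis using L by (simp add: penalty_def penalty_rate_nonneg)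
qed

text \<open>
  If the common central window is reducible, both points have the same radius of reduction; otherwise both
  values lie between \<open>- penalty_rate L (n + 1)\<close> and \<open>0\<close>.
\<close>
lemma penalty_variation:
  assumes L: "2 \<le> L" and x: "x \<in> X" and z: "z \<in> X"
    and ag: "agree_on {- int n..int n} x z"
  shows "\<bar>penalty L x - penalty L z\<bar> \<le> penalty_rate L (real n + 1)"
proof -
  have red_iff: "reducible x (- int k) (2 * k + 1) \<longleftrightarrow> reducible z (- int k) (2 * k + 1)" if "k \<le> n" for k
  proof -
    have "agree_on {- int k..<- int k + int (2 * k + 1)} x z"
      by (rule agree_on_mono[OF ag]) (use that in auto)
    then show ?thesis
      using reducible_cong[OF x z] reducible_cong[OF z x] agree_on_sym by blast
  qed
  show ?thesis
  proof (cases "reducible x (- int n) (2 * n + 1)")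
    case True
    then have True': "reducible z (- int n) (2 * n + 1)" using red_iff[of n] by simp
    have le: "reduction_radius x \<le> n" "reduction_radius z \<le> n"
      using reduction_radius_le[OF True, of n] reduction_radius_le[OF True', of n] by auto
    have "reduction_radius z \<le> reduction_radius x"
      using reducible_radius[OF True] red_iff[OF le(1)]
      by (intro reduction_radius_le[of z "- int (reduction_radius x)" "2 * reduction_radius x + 1"]) auto
    moreover have "reduction_radius x \<le> reduction_radius z"
      using reducible_radius[OF True'] red_iff[OF le(2)]
      by (intro reduction_radius_le[of x "- int (reduction_radius z)" "2 * reduction_radius z + 1"]) auto
    ultimately have "reduction_radius x = reduction_radius z" by simp
    then have "penalty L x = penalty L z"
      using True True' by (auto simp: penalty_def)
    then show ?thesis using L by (simp add: penalty_rate_nonneg)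
  next
    case False
    then have False': "\<not> reducible z (- int n) (2 * n + 1)" using red_iff[of n] by simp
    show ?thesis
      using penalty_ge[OF L False] penalty_ge[OF L False'] penalty_nonpos[of L x] penalty_nonpos[of L z] L
      by linarith
  qed
qed

lemma continuous_on_penalty:
  assumes L: "2 \<le> L"
  shows "continuous_on X (penalty L)"
proof (subst continuous_on_topological, intro ballI allI impI)
  fix x :: "int \<Rightarrow> 'a" and B :: "real set"
  assume x: "x \<in> X" and B: "open B" "penalty L x \<in> B"
  then obtain e where e: "e > 0" "ball (penalty L x) e \<subseteq> B"
    by (meson open_contains_ball)
  have "\<forall>\<^sub>F n in sequentially. penalty_rate L (real n + 1) < e"
    using penalty_rate_tendsto_0[of L] e(1) by (rule order_tendstoD(2))
  then obtain n where n: "penalty_rate L (real n + 1) < e"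
    by (auto simp: eventually_sequentially)
  show "\<exists>A. open A \<and> x \<in> A \<and> (\<forall>y\<in>X. y \<in> A \<longrightarrow> penalty L y \<in> B)"
  proof (intro exI conjI ballI impI)
    show "open {z. agree_on {- int n..int n} x z}" by (rule open_agree_set) simp
    show "x \<in> {z. agree_on {- int n..int n} x z}" by simp
    fix z assume z: "z \<in> X" "z \<in> {z. agree_on {- int n..int n} x z}"
    then have "\<bar>penalty L x - penalty L z\<bar> < e"
      using penalty_variation[OF L x z(1), of n] n by simp
    then have "penalty L z \<in> ball (penalty L x) e" by (simp add: dist_real_def)
    then show "penalty L z \<in> B" using e(2) by blast
  qed
qed

lemma p_Dini_penalty:
  assumes L: "2 \<le> L" and p: "1 < p"
  shows "p_Dini X p (\<lambda>x. 2 * penalty L x)"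
proof -
  let ?V = "\<lambda>n. {\<bar>2 * penalty L x - 2 * penalty L z\<bar> | x z. x \<in> X \<and> z \<in> X \<and> shift_dist x z \<le> 1 / 2 ^ n}"
  have bound: "v \<le> 2 * penalty_rate L (real n + 1)" if v: "v \<in> ?V (Suc n)" for v n
  proof -
    obtain x z where xz: "x \<in> X" "z \<in> X" "shift_dist x z \<le> 1 / 2 ^ Suc n"
      "v = \<bar>2 * penalty L x - 2 * penalty L z\<bar>"
      using v by blast
    have "agree_on {- int n..int n} x z"
      using agree_on_if_shift_dist_le[OF xz(3)] by simp
    then show ?thesis
      using penalty_variation[OF L xz(1,2), of n] xz(4) by linarith
  qed
  obtain x where x: "x \<in> X" using subshift_X by (auto simp: subshift_def)
  have mem: "0 \<in> ?V n" for n
    using x by (auto simp: shift_dist_def intro!: exI[of _ x])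
  have up: "var X (\<lambda>x. 2 * penalty L x) (Suc n) \<le> 2 * penalty_rate L (real n + 1)" for n
    unfolding var_def by (rule cSup_least) (use mem[of "Suc n"] bound in blast)+
  have lo: "0 \<le> var X (\<lambda>x. 2 * penalty L x) (Suc n)" for n
    unfolding var_def
    by (rule cSup_upper[OF mem]) (rule bdd_aboveI, rule bound)
  have "summable (\<lambda>n. var X (\<lambda>x. 2 * penalty L x) (Suc n) powr p)"
  proof (rule summable_comparison_test'[of _ 0])
    show "summable (\<lambda>n. (2 * penalty_rate L (real n + 1)) powr p)"
      using L p by (intro summable_penalty_rate) auto
    show "norm (var X (\<lambda>x. 2 * penalty L x) (Suc n) powr p) \<le> (2 * penalty_rate L (real n + 1)) powr p" for n
      using up[of n] lo[of n] p by (simp add: powr_mono2)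
  qed
  then show ?thesis
    unfolding p_Dini_def by (subst (asm) summable_Suc_iff)
qed

end


section \<open>Partition sums over the fibres\<close>

abbreviation birkhoff_sum :: "((int \<Rightarrow> 'a) \<Rightarrow> real) \<Rightarrow> nat \<Rightarrow> (int \<Rightarrow> 'a) \<Rightarrow> real"
  where "birkhoff_sum \<phi> n x \<equiv> (\<Sum>k<n. \<phi> ((shift ^^ k) x))"

definition cylinder_sup :: "(int \<Rightarrow> 'a) set \<Rightarrow> ((int \<Rightarrow> 'a) \<Rightarrow> real) \<Rightarrow> 'a list \<Rightarrow> real"
  where "cylinder_sup X \<phi> w = (SUP x\<in>cylinder X w. birkhoff_sum \<phi> (length w) x)"

lemma shift_funpow_mem: "subshift X \<Longrightarrow> x \<in> X \<Longrightarrow> (shift ^^ k) x \<in> X"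
  by (simp add: funpow_shift translate_mem)

lemma language_iff_cylinder:
  assumes "subshift X"
  shows "w \<in> language X \<longleftrightarrow> cylinder X w \<noteq> {}"
proof
  assume "w \<in> language X"
  then obtain x i where x: "x \<in> X" "\<forall>k<length w. x (i + int k) = w ! k"
    by (auto simp: language_def occurs_in_def)
  then have "translate i x \<in> cylinder X w"
    using translate_mem[OF assms x(1)] by (simp add: cylinder_def translate_apply add.commute)
  then show "cylinder X w \<noteq> {}" by blast
next
  assume "cylinder X w \<noteq> {}"
  then obtain x where "x \<in> X" "\<forall>k<length w. x (0 + int k) = w ! k"
    by (auto simp: cylinder_def)
  then show "w \<in> language X"
    unfolding language_def occurs_in_def by blast
qed

lemma cylinder_drop:
  assumes "subshift X" "x \<in> cylinder X u" "l \<le> length u"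
  shows "(shift ^^ l) x \<in> cylinder X (drop l u)"
  using assms(2,3) shift_funpow_mem[OF assms(1)]
  by (auto simp: cylinder_def funpow_shift translate_apply add.commute)
     (metis add.commute less_diff_conv of_nat_add)

lemma cylinder_take: "x \<in> cylinder X u \<Longrightarrow> x \<in> cylinder X (take l u)"
  by (auto simp: cylinder_def)

lemma finite_words: "finite {w \<in> language X. length w = n}" for X :: "(int \<Rightarrow> 'a::finite) set"
  by (rule finite_subset[OF _ finite_lists_length_eq[of "UNIV :: 'a set" n]]) auto

lemma bdd_above_birkhoff_sum:
  assumes X: "subshift X" and \<phi>: "\<And>x. x \<in> X \<Longrightarrow> \<phi> x \<le> B"
  shows "bdd_above (birkhoff_sum \<phi> n ` cylinder X w)"
proof (rule bdd_aboveI2)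
  fix x assume "x \<in> cylinder X w"
  then have "x \<in> X" by (simp add: cylinder_def)
  then have "birkhoff_sum \<phi> n x \<le> (\<Sum>k<n. B)"
    by (intro sum_mono \<phi> shift_funpow_mem[OF X])
  then show "birkhoff_sum \<phi> n x \<le> real n * B" by simp
qed

lemma cylinder_sup_upper:
  assumes "subshift X" "\<And>x. x \<in> X \<Longrightarrow> \<phi> x \<le> B" "x \<in> cylinder X w"
  shows "birkhoff_sum \<phi> (length w) x \<le> cylinder_sup X \<phi> w"
  unfolding cylinder_sup_def
  by (rule cSUP_upper[OF assms(3)]) (rule bdd_above_birkhoff_sum[OF assms(1,2)])

lemma cylinder_sup_least:
  assumes "subshift X" "w \<in> language X"
    "\<And>x. x \<in> cylinder X w \<Longrightarrow> birkhoff_sum \<phi> (length w) x \<le> c"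
  shows "cylinder_sup X \<phi> w \<le> c"
  unfolding cylinder_sup_def
  by (rule cSUP_least) (use assms language_iff_cylinder in auto)

lemma sum_inverse_squares_le: "(\<Sum>l=1..n. 1 / (real l)\<^sup>2) \<le> 2"
proof -
  have "(\<Sum>l=1..n. 1 / (real l)\<^sup>2) \<le> 2 - 1 / real n" if "n \<ge> 1"
    using that
  proof (induction n rule: dec_induct)
    case (step n)
    have "1 / (real (Suc n))\<^sup>2 \<le> 1 / (real n * real (Suc n))"
      using step(1) by (intro divide_left_mono) (auto simp: power2_eq_square)
    also have "\<dots> = 1 / real n - 1 / real (Suc n)"
      using step(1) by (simp add: field_simps)
    finally show ?case using step by simp
  qed simp
  then show ?thesis by (cases "n \<ge> 1") (auto intro: order_trans)
qed

context lex_reduction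
begin

text \<open>
  By \<open>reducible_cong\<close> the choice of the point in the cylinder does not matter as long as
  \<open>l \<le> length u\<close>.
\<close>
definition word_reducible :: "'a list \<Rightarrow> nat \<Rightarrow> bool"
  where "word_reducible u l \<longleftrightarrow> (\<exists>x\<in>cylinder X u. reducible x 0 l)"

definition fibre_words :: "'b list \<Rightarrow> 'a list set"
  where "fibre_words w = {u \<in> language X. map \<Phi> u = w}"

lemma finite_fibre_words: "finite (fibre_words w)"
  by (rule finite_subset[OF _ finite_words[of X "length w"]]) (auto simp: fibre_words_def)

lemma reducible_pos: "reducible x i n \<Longrightarrow> 0 < n"
proof (rule ccontr)
  assume red: "reducible x i n" and n: "\<not> 0 < n"
  obtain z where z: "agree_on {j. j < i + int m \<or> j \<ge> i + int n - int m} x z" "lex_less z x"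
    using red by (auto simp: reducible_def)
  have "z j = x j" for j using z(1) n by (auto simp: agree_on_def)
  then show False using z(2) by (simp add: lex_less_def)
qed

lemma word_reducible_iff:
  assumes x: "x \<in> cylinder X u" and l: "l \<le> length u"
  shows "word_reducible u l \<longleftrightarrow> reducible x 0 l"
proof
  assume "word_reducible u l"
  then obtain z where z: "z \<in> cylinder X u" "reducible z 0 l" by (auto simp: word_reducible_def)
  have "x j = z j" if "0 \<le> j" "j < int l" for j
  proof -
    have "nat j < length u" using that l by linarith
    then have "x (int (nat j)) = u ! nat j" "z (int (nat j)) = u ! nat j"
      using x z(1) unfolding cylinder_def by blast+
    then show ?thesis using that by simp
  qed
  then have "agree_on {0..<0 + int l} z x" by (simp add: agree_on_def)
  then show "reducible x 0 l"
    using reducible_cong[of z x 0 l] x z by (auto simp: cylinder_def)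
qed (use x in \<open>auto simp: word_reducible_def\<close>)

lemma card_irreducible_words:
  "card {u \<in> fibre_words w. \<not> word_reducible u (length w)} \<le> CARD('a) ^ (2 * m)"
proof -
  define W where "W = {u \<in> fibre_words w. \<not> word_reducible u (length w)}"
  define pt where "pt u = (SOME x. x \<in> cylinder X u)" for u
  have pt: "pt u \<in> cylinder X u" if "u \<in> W" for u
    unfolding pt_def some_in_eq
    using that language_iff_cylinder[OF subshift_X] by (auto simp: W_def fibre_words_def)
  have len: "length u = length w" if "u \<in> W" for u
    using that by (auto simp: W_def fibre_words_def)
  have nth: "pt u j = u ! nat j" if "u \<in> W" "0 \<le> j" "j < int (length w)" for u j
  proof -
    have "nat j < length u" using that len[OF that(1)] by linarith
    then have "pt u (int (nat j)) = u ! nat j" using pt[OF that(1)] by (auto simp: cylinder_def)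
    then show ?thesis using that by simp
  qed
  have eq: "u = v" if uv: "u \<in> W" "v \<in> W" and ag: "agree_on {0..<0 + int (length w)} (pt u) (pt v)" for u v
  proof (rule nth_equalityI)
    show "length u = length v" using len uv by simp
    fix k assume "k < length u"
    then have k: "int k < int (length w)" using len uv by simp
    then have "pt v (int k) = pt u (int k)" using ag by (auto simp: agree_on_def)
    then show "u ! k = v ! k" using nth[OF uv(1) _ k] nth[OF uv(2) _ k] by simp
  qed
  have inj: "inj_on pt W"
    by (rule inj_onI) (use eq in auto)
  have "card (pt ` W) \<le> CARD('a) ^ (2 * m)"
  proof (rule irreducible_family(2)[of _ 0 "length w"])
    show "pt ` W \<subseteq> X" using pt by (auto simp: cylinder_def)
    show "x = x'" if x: "x \<in> pt ` W" "x' \<in> pt ` W"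
      and ag: "agree_on {0..<0 + int (length w)} x x'" for x x'
    proof -
      obtain u v where uv: "u \<in> W" "v \<in> W" "x = pt u" "x' = pt v" using x by auto
      then show ?thesis using eq[OF uv(1,2)] ag by simp
    qed
    show "\<Phi> (x' j) = \<Phi> (x j)" if x: "x \<in> pt ` W" "x' \<in> pt ` W"
      and j: "0 \<le> j" "j < 0 + int (length w)" for x x' j
    proof -
      obtain u v where uv: "u \<in> W" "v \<in> W" "x = pt u" "x' = pt v" using x by auto
      have "map \<Phi> u ! nat j = map \<Phi> v ! nat j" using uv by (simp add: W_def fibre_words_def)
      then have "\<Phi> (u ! nat j) = \<Phi> (v ! nat j)" using len uv(1,2) j by simp
      then show ?thesis using nth uv j by simp
    qed
    show "\<not> reducible x 0 (length w)" if x: "x \<in> pt ` W" for x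
    proof -
      obtain u where u: "u \<in> W" "x = pt u" using x by auto
      then have "\<not> word_reducible u (length w)" by (simp add: W_def)
      then show ?thesis
        using word_reducible_iff[OF pt[OF u(1)], of "length w"] len[OF u(1)] u(2) by simp
    qed
  qed
  then show ?thesis
    using card_image[OF inj] by (simp add: W_def)
qed

text \<open>
  Deleting the last letter leaves an irreducible word.
\<close>
lemma card_minimally_reducible_words:
  assumes w: "length w = Suc l"
  shows "card {u \<in> fibre_words w. \<not> word_reducible u l} \<le> CARD('a) * CARD('a) ^ (2 * m)"
proof -
  define I where "I = {u \<in> fibre_words (butlast w). \<not> word_reducible u (length (butlast w))}"
  define W where "W = {u \<in> fibre_words w. \<not> word_reducible u l}"
  have len: "length u = Suc l" if "u \<in> W" for u
    using that w by (auto simp: W_def fibre_words_def)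
  have sub: "(\<lambda>u. (last u, butlast u)) ` W \<subseteq> UNIV \<times> I"
  proof (intro image_subsetI)
    fix u assume u: "u \<in> W"
    obtain x where x: "x \<in> cylinder X u"
      using u language_iff_cylinder[OF subshift_X] by (auto simp: W_def fibre_words_def)
    then have x': "x \<in> cylinder X (butlast u)"
      using cylinder_take[of x X u] by (simp add: butlast_conv_take)
    then have "butlast u \<in> language X" using language_iff_cylinder[OF subshift_X] by blast
    moreover have "map \<Phi> (butlast u) = butlast w"
      using u by (auto simp: W_def fibre_words_def map_butlast)
    moreover have "\<not> word_reducible (butlast u) l"
      using word_reducible_iff[OF x', of l] word_reducible_iff[OF x, of l] len[OF u] u
      by (simp add: W_def)
    ultimately show "(last u, butlast u) \<in> UNIV \<times> I"
      using w by (simp add: I_def fibre_words_def)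
  qed
  have inj: "inj_on (\<lambda>u. (last u, butlast u)) W"
  proof (rule inj_onI)
    fix u v assume uv: "u \<in> W" "v \<in> W" "(last u, butlast u) = (last v, butlast v)"
    then have "u \<noteq> []" "v \<noteq> []" using len by fastforce+
    then show "u = v" using uv(3) by (metis append_butlast_last_id prod.inject)
  qed
  have "card W \<le> card ((UNIV :: 'a set) \<times> I)"
    by (rule card_inj_on_le[OF inj sub]) (simp add: I_def finite_fibre_words)
  also have "\<dots> = CARD('a) * card I" by (simp add: card_cartesian_product)
  also have "\<dots> \<le> CARD('a) * CARD('a) ^ (2 * m)"
    using card_irreducible_words[of "butlast w"] by (simp add: I_def)
  finally show ?thesis by (simp add: W_def)
qed

text \<open>
  Each of the first \<open>l\<close> shifts sees the reducible prefix as a window of length \<open>l\<close> around the origin and so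
  has penalty at most \<open>- penalty_rate L l\<close>.
\<close>
lemma exp_cylinder_sup_drop_reducible:
  assumes L: "2 \<le> L" and u: "u \<in> language X" and l: "l \<le> length u" and red: "word_reducible u l"
  shows "exp (cylinder_sup X (penalty L) u)
    \<le> exp (- L) / (real l)\<^sup>2 * exp (cylinder_sup X (penalty L) (drop l u))"
proof -
  obtain x where x: "x \<in> cylinder X u" using red by (auto simp: word_reducible_def)
  then have l0: "0 < l" using red word_reducible_iff[OF x l] reducible_pos by simp
  have "cylinder_sup X (penalty L) u \<le> - (L + 2 * ln (real l)) + cylinder_sup X (penalty L) (drop l u)"
  proof (rule cylinder_sup_least[OF subshift_X u])
    fix x assume x: "x \<in> cylinder X u"
    have redx: "reducible x 0 l" using red word_reducible_iff[OF x l] by simp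
    have "birkhoff_sum (penalty L) (length u) x
      = birkhoff_sum (penalty L) l x + (\<Sum>k=l..<length u. penalty L ((shift ^^ k) x))"
      using l sum.atLeastLessThan_concat[of 0 l "length u" "\<lambda>k. penalty L ((shift ^^ k) x)"]
      by (simp add: lessThan_atLeast0)
    also have "(\<Sum>k=l..<length u. penalty L ((shift ^^ k) x))
      = birkhoff_sum (penalty L) (length (drop l u)) ((shift ^^ l) x)"
      by (rule sum.reindex_bij_witness[of _ "\<lambda>k. k + l" "\<lambda>k. k - l"])
         (auto simp: funpow_shift translate_translate simp flip: of_nat_add)
    also have "\<dots> \<le> cylinder_sup X (penalty L) (drop l u)"
      using L by (intro cylinder_sup_upper[OF subshift_X _ cylinder_drop[OF subshift_X x l], of _ 0])
        (auto simp: penalty_nonpos)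
    also have "birkhoff_sum (penalty L) l x \<le> (\<Sum>k<l. - penalty_rate L (real l))"
    proof (rule sum_mono)
      fix k assume k: "k \<in> {..<l}"
      have "reducible (translate (int k) x) (- int k) l"
        using redx by (simp add: reducible_translate)
      then show "penalty L ((shift ^^ k) x) \<le> - penalty_rate L (real l)"
        unfolding funpow_shift by (rule penalty_le[OF L]) (use k in auto)
    qed
    also have "(\<Sum>k<l. - penalty_rate L (real l)) = - (L + 2 * ln (real l))"
      using l0 by (simp add: penalty_rate_def)
    finally show "birkhoff_sum (penalty L) (length u) x
      \<le> - (L + 2 * ln (real l)) + cylinder_sup X (penalty L) (drop l u)" by simp
  qed
  then have "exp (cylinder_sup X (penalty L) u)
    \<le> exp (- (L + 2 * ln (real l)) + cylinder_sup X (penalty L) (drop l u))" by simp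
  also have "\<dots> = exp (- (L + 2 * ln (real l))) * exp (cylinder_sup X (penalty L) (drop l u))"
    by (rule exp_add)
  also have "- (L + 2 * ln (real l)) = - L - (ln (real l) + ln (real l))" by simp
  also have "exp (- L - (ln (real l) + ln (real l))) = exp (- L) / (real l)\<^sup>2"
    unfolding exp_diff exp_add using l0 by (simp add: power2_eq_square)
  finally show ?thesis .
qed

lemma exp_cylinder_sup_le_1:
  assumes "0 \<le> L" "u \<in> language X"
  shows "exp (cylinder_sup X (penalty L) u) \<le> 1"
proof -
  have "cylinder_sup X (penalty L) u \<le> 0"
    by (rule cylinder_sup_least[OF subshift_X assms(2)]) (intro sum_nonpos penalty_nonpos assms(1))
  then show ?thesis by simp
qed

text \<open>
  Induction on the length of \<open>w\<close>. At most \<open>C\<close> words over \<open>w\<close> are irreducible, and each contributes at most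
  \<open>1\<close>. Every other word is cut after its shortest reducible prefix, whose length is called \<open>l\<close>: there are at most \<open>C\<close> such prefixes
  over the first \<open>l\<close> letters of \<open>w\<close>, each of weight \<open>exp (- L) / l\<^sup>2\<close>, and the remaining words sum to at most \<open>2 C\<close>
  by induction. As \<open>\<Sum> 1 / l\<^sup>2 \<le> 2\<close>, the hypothesis on \<open>L\<close> makes the total of these at most \<open>C\<close>.
\<close>
lemma fibre_partition_sum_le:
  assumes L: "2 \<le> L" and C: "C = real (CARD('a) * CARD('a) ^ (2 * m))" "4 * C \<le> exp L"
  shows "(\<Sum>u\<in>fibre_words w. exp (cylinder_sup X (penalty L) u)) \<le> 2 * C"
proof (induction "length w" arbitrary: w rule: less_induct)
  case less
  define n where "n = length w"
  define h where "h u = exp (cylinder_sup X (penalty L) u)" for u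
  define S where "S w' = sum h (fibre_words w')" for w'
  have C0: "C \<ge> 0" by (simp add: C(1))
  have h0: "h u \<ge> 0" for u by (simp add: h_def)
  define I where "I = {u \<in> fibre_words w. \<not> word_reducible u n}"
  define R where "R = {u \<in> fibre_words w. word_reducible u n}"
  define t where "t u = (LEAST l. word_reducible u l)" for u
  have len: "length u = n" if "u \<in> fibre_words w" for u
    using that by (auto simp: fibre_words_def n_def)
  have t: "word_reducible u (t u)" "t u \<le> n" "t u \<ge> 1" "\<And>l. l < t u \<Longrightarrow> \<not> word_reducible u l"
    if "u \<in> R" for u
  proof -
    have red: "word_reducible u n" using that by (simp add: R_def)
    show "word_reducible u (t u)" unfolding t_def using red by (rule LeastI)
    then show "t u \<ge> 1" using reducible_pos by (force simp: word_reducible_def)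
    show "t u \<le> n" unfolding t_def using red by (rule Least_le)
    show "\<not> word_reducible u l" if "l < t u" for l using that unfolding t_def by (rule not_less_Least)
  qed
  have "S w = sum h I + sum h R"
    unfolding S_def
    by (subst sum.union_disjoint[symmetric]) (auto simp: I_def R_def finite_fibre_words intro: sum.cong)
  also have "sum h I \<le> C"
  proof -
    have "sum h I \<le> (\<Sum>u\<in>I. 1)"
      unfolding h_def using L
      by (intro sum_mono exp_cylinder_sup_le_1) (simp_all add: I_def fibre_words_def)
    also have "\<dots> = real (card I)" by simp
    also have "\<dots> \<le> real (CARD('a) ^ (2 * m))"
      using card_irreducible_words[of w] by (simp add: I_def n_def)
    also have "\<dots> \<le> C"
      unfolding C(1) of_nat_le_iff using mult_le_mono1[of 1 "CARD('a)" "CARD('a) ^ (2 * m)"]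
      by (simp add: Suc_leI)
    finally show ?thesis .
  qed
  also have "sum h R = (\<Sum>l=1..n. sum h {u \<in> R. t u = l})"
  proof (rule sum.group[symmetric])
    show "finite R" by (simp add: R_def finite_fibre_words)
    show "t ` R \<subseteq> {1..n}" using t(2,3) by auto
  qed simp
  also have "\<dots> \<le> (\<Sum>l=1..n. C * exp (- L) * (2 * C) * (1 / (real l)\<^sup>2))"
  proof (rule sum_mono)
    fix l assume l: "l \<in> {1..n}"
    define A where "A = {u \<in> fibre_words (take l w). \<not> word_reducible u (l - 1)}"
    define c where "c = exp (- L) / (real l)\<^sup>2"
    have c0: "c \<ge> 0" by (simp add: c_def)
    have finA: "finite A" by (simp add: A_def finite_fibre_words)
    have cardA: "real (card A) \<le> C"
      using card_minimally_reducible_words[of "take l w" "l - 1"] l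
      unfolding A_def C(1) of_nat_le_iff by (simp add: n_def)
    have inj: "inj_on (\<lambda>u. (take l u, drop l u)) {u \<in> R. t u = l}"
      by (rule inj_onI) (metis append_take_drop_id prod.inject)
    have sub: "(\<lambda>u. (take l u, drop l u)) ` {u \<in> R. t u = l} \<subseteq> A \<times> fibre_words (drop l w)"
    proof (intro image_subsetI)
      fix u assume u: "u \<in> {u \<in> R. t u = l}"
      then have uf: "u \<in> fibre_words w" and uR: "u \<in> R" and tu: "t u = l" by (auto simp: R_def)
      obtain x where x: "x \<in> cylinder X u"
        using uf language_iff_cylinder[OF subshift_X] by (auto simp: fibre_words_def)
      have "take l u \<in> language X" "drop l u \<in> language X"
        using cylinder_take[OF x, of l] cylinder_drop[OF subshift_X x, of l] l len[OF uf]
          language_iff_cylinder[OF subshift_X] by auto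
      moreover have "\<not> word_reducible (take l u) (l - 1)"
      proof -
        have "\<not> reducible x 0 (l - 1)"
        proof -
          have "l - 1 < t u" "l - 1 \<le> length u" using tu l len[OF uf] by auto
          then show ?thesis using t(4)[OF uR] word_reducible_iff[OF x] by blast
        qed
        moreover have "l - 1 \<le> length (take l u)" using l len[OF uf] by simp
        ultimately show ?thesis
          using word_reducible_iff[OF cylinder_take[OF x, of l], of "l - 1"] by blast
      qed
      ultimately show "(take l u, drop l u) \<in> A \<times> fibre_words (drop l w)"
        using uf by (auto simp: A_def fibre_words_def take_map drop_map)
    qed
    have "sum h {u \<in> R. t u = l} \<le> (\<Sum>u\<in>{u \<in> R. t u = l}. c * h (drop l u))"
    proof (rule sum_mono)
      fix u assume u: "u \<in> {u \<in> R. t u = l}"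
      then have "u \<in> fibre_words w" by (simp add: R_def)
      then show "h u \<le> c * h (drop l u)"
        unfolding h_def c_def using u l len[of u] t(1)[of u]
        by (intro exp_cylinder_sup_drop_reducible[OF L]) (auto simp: fibre_words_def)
    qed
    also have "\<dots> = (\<Sum>(p, s)\<in>(\<lambda>u. (take l u, drop l u)) ` {u \<in> R. t u = l}. c * h s)"
      by (subst sum.reindex[OF inj]) simp
    also have "\<dots> \<le> (\<Sum>(p, s)\<in>A \<times> fibre_words (drop l w). c * h s)"
      by (rule sum_mono2[OF _ sub]) (use finA finite_fibre_words c0 h0 in auto)
    also have "\<dots> = (\<Sum>p\<in>A. \<Sum>s\<in>fibre_words (drop l w). c * h s)"
      by (rule sum.cartesian_product[symmetric])
    also have "\<dots> = real (card A) * (c * S (drop l w))"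
      by (simp add: S_def sum_distrib_left)
    also have "\<dots> \<le> C * (c * (2 * C))"
    proof (intro mult_mono mult_left_mono)
      show "S (drop l w) \<le> 2 * C"
        unfolding S_def h_def by (rule less) (use l in \<open>auto simp: n_def\<close>)
      show "0 \<le> c * S (drop l w)" using c0 h0 by (simp add: S_def sum_nonneg)
    qed (use c0 C0 cardA h0 in \<open>auto simp: S_def sum_nonneg\<close>)
    finally show "sum h {u \<in> R. t u = l} \<le> C * exp (- L) * (2 * C) * (1 / (real l)\<^sup>2)"
      by (simp add: c_def mult_ac)
  qed
  also have "\<dots> = C * exp (- L) * (2 * C) * (\<Sum>l=1..n. 1 / (real l)\<^sup>2)"
    by (rule sum_distrib_left[symmetric])
  also have "\<dots> \<le> C * exp (- L) * (2 * C) * 2"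
    by (rule mult_left_mono[OF sum_inverse_squares_le]) (simp add: C0)
  also have "\<dots> = (4 * C) * exp (- L) * C" by simp
  also have "\<dots> \<le> exp L * exp (- L) * C"
    using C(2) C0 by (intro mult_right_mono) auto
  also have "\<dots> = C" by (simp add: exp_minus)
  finally show ?case by (simp add: S_def h_def)
qed

end


section \<open>Pressure\<close>

definition partition_sum :: "(int \<Rightarrow> 'a) set \<Rightarrow> ((int \<Rightarrow> 'a) \<Rightarrow> real) \<Rightarrow> nat \<Rightarrow> real"
  where "partition_sum X \<phi> n = (\<Sum>w\<in>{w \<in> language X. length w = n}. exp (cylinder_sup X \<phi> w))"

lemma pressure_eq: "pressure X \<phi> = lim (\<lambda>n. ln (partition_sum X \<phi> n) / real n)"
proof -
  have "(\<Sum>w\<in>{w \<in> language X. length w = n}. exp (SUP x\<in>cylinder X w. birkhoff_sum \<phi> n x))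
    = partition_sum X \<phi> n" for n
    unfolding partition_sum_def cylinder_sup_def by (rule sum.cong) auto
  then show ?thesis unfolding pressure_def by simp
qed

text \<open>
  The equality also covers divergent sequences, because \<open>lim\<close> is a definite description that depends
  only on the predicate of being a limit. So pressures can be compared without proving that
  the limits exist.
\<close>
lemma lim_eq_of_diff_tendsto_0:
  fixes a b :: "nat \<Rightarrow> real"
  assumes "(\<lambda>n. a n - b n) \<longlonglongrightarrow> 0"
  shows "lim a = lim b"
proof -
  have "a \<longlonglongrightarrow> l \<longleftrightarrow> b \<longlonglongrightarrow> l" for l
  proof
    assume "b \<longlonglongrightarrow> l"
    from tendsto_add[OF this assms] show "a \<longlonglongrightarrow> l" by simp
  next
    assume "a \<longlonglongrightarrow> l"
    from tendsto_diff[OF this assms] show "b \<longlonglongrightarrow> l" by simp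
  qed
  then show ?thesis by (simp add: lim_def)
qed

lemma continuous_bounded_above:
  fixes f :: "(int \<Rightarrow> 'a::{finite,discrete_topology}) \<Rightarrow> real"
  assumes "closed X" "continuous_on X f"
  obtains B where "\<And>x. x \<in> X \<Longrightarrow> f x \<le> B"
proof -
  have "compact (f ` X)"
    by (rule compact_continuous_image[OF assms(2) closed_imp_compact_shift[OF assms(1)]])
  then have "bounded (f ` X)" by (rule compact_imp_bounded)
  then obtain B where "\<And>x. x \<in> X \<Longrightarrow> norm (f x) \<le> B" by (auto simp: bounded_iff)
  then show ?thesis using that[of B] by (auto simp: abs_le_iff)
qed

lemma partition_sum_pos:
  fixes X :: "(int \<Rightarrow> 'a::{finite,discrete_topology}) set"
  assumes X: "subshift X"
  shows "0 < partition_sum X \<phi> n"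
  unfolding partition_sum_def
proof (rule sum_pos)
  obtain x where "x \<in> X" using X by (auto simp: subshift_def)
  then have "x \<in> cylinder X (map (\<lambda>k. x (int k)) [0..<n])" by (simp add: cylinder_def)
  then have "map (\<lambda>k. x (int k)) [0..<n] \<in> {w \<in> language X. length w = n}"
    using language_iff_cylinder[OF X] by auto
  then show "{w \<in> language X. length w = n} \<noteq> {}" by blast
qed (simp_all add: finite_words)

lemma block_code_funpow_shift: "block_code \<Phi> ((shift ^^ k) x) = (shift ^^ k) (block_code \<Phi> x)"
  by (simp add: funpow_shift block_code_def translate_def)

context lex_reduction
begin

lemma map_fibre_cylinder:
  "x \<in> cylinder X u \<Longrightarrow> block_code \<Phi> x \<in> cylinder (block_code \<Phi> ` X) (map \<Phi> u)"
  by (auto simp: cylinder_def block_code_def)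

lemma map_mem_language:
  assumes Y: "subshift Y" "block_code \<Phi> ` X = Y" and u: "u \<in> language X"
  shows "map \<Phi> u \<in> language Y"
proof -
  obtain x where "x \<in> cylinder X u"
    using u language_iff_cylinder[OF subshift_X, of u] by auto
  then have "block_code \<Phi> x \<in> cylinder Y (map \<Phi> u)"
    using map_fibre_cylinder Y(2) by blast
  then show ?thesis using language_iff_cylinder[OF Y(1)] by blast
qed

lemma partition_sum_le:
  assumes Y: "subshift Y" "block_code \<Phi> ` X = Y" and \<phi>: "\<And>y. y \<in> Y \<Longrightarrow> \<phi> y \<le> B"
    and f: "\<And>x. x \<in> X \<Longrightarrow> f x \<le> penalty L x" and L: "2 \<le> L"
    and C: "C = real (CARD('a) * CARD('a) ^ (2 * m))" "4 * C \<le> exp L"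
  shows "partition_sum X (\<lambda>x. f x + \<phi> (block_code \<Phi> x)) n \<le> 2 * C * partition_sum Y \<phi> n"
proof -
  define W where "W = {u \<in> language X. length u = n}"
  define V where "V = {w \<in> language Y. length w = n}"
  have mem: "map \<Phi> u \<in> V" if u: "u \<in> W" for u
    using u map_mem_language[OF Y] by (simp add: V_def W_def)
  have le: "cylinder_sup X (\<lambda>x. f x + \<phi> (block_code \<Phi> x)) u
    \<le> cylinder_sup X (penalty L) u + cylinder_sup Y \<phi> (map \<Phi> u)" if u: "u \<in> W" for u
  proof (rule cylinder_sup_least[OF subshift_X])
    show "u \<in> language X" using u by (simp add: W_def)
    fix x assume x: "x \<in> cylinder X u"
    have xX: "x \<in> X" using x by (simp add: cylinder_def)
    have "birkhoff_sum (\<lambda>x. f x + \<phi> (block_code \<Phi> x)) (length u) x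
      = birkhoff_sum f (length u) x + birkhoff_sum \<phi> (length (map \<Phi> u)) (block_code \<Phi> x)"
      by (simp add: sum.distrib block_code_funpow_shift)
    also have "birkhoff_sum f (length u) x \<le> birkhoff_sum (penalty L) (length u) x"
      by (intro sum_mono f shift_funpow_mem[OF subshift_X xX])
    also have "\<dots> \<le> cylinder_sup X (penalty L) u"
      by (rule cylinder_sup_upper[OF subshift_X _ x, of _ 0]) (use L in \<open>simp add: penalty_nonpos\<close>)
    also have "birkhoff_sum \<phi> (length (map \<Phi> u)) (block_code \<Phi> x) \<le> cylinder_sup Y \<phi> (map \<Phi> u)"
      using map_fibre_cylinder[OF x] Y(2) by (intro cylinder_sup_upper[OF Y(1) \<phi>]) auto
    finally show "birkhoff_sum (\<lambda>x. f x + \<phi> (block_code \<Phi> x)) (length u) x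
      \<le> cylinder_sup X (penalty L) u + cylinder_sup Y \<phi> (map \<Phi> u)" by simp
  qed
  have "partition_sum X (\<lambda>x. f x + \<phi> (block_code \<Phi> x)) n
    \<le> (\<Sum>u\<in>W. exp (cylinder_sup X (penalty L) u + cylinder_sup Y \<phi> (map \<Phi> u)))"
    unfolding partition_sum_def W_def[symmetric] by (rule sum_mono) (use le in simp)
  also have "\<dots> = (\<Sum>w\<in>V. \<Sum>u\<in>{u \<in> W. map \<Phi> u = w}. exp (cylinder_sup X (penalty L) u + cylinder_sup Y \<phi> (map \<Phi> u)))"
    by (rule sum.group[symmetric]) (use mem finite_words in \<open>auto simp: W_def V_def\<close>)
  also have "\<dots> = (\<Sum>w\<in>V. (\<Sum>u\<in>fibre_words w. exp (cylinder_sup X (penalty L) u)) * exp (cylinder_sup Y \<phi> w))"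
  proof (rule sum.cong[OF refl])
    fix w assume w: "w \<in> V"
    have "{u \<in> W. map \<Phi> u = w} = fibre_words w"
      using w by (auto simp: W_def V_def fibre_words_def)
    then show "(\<Sum>u\<in>{u \<in> W. map \<Phi> u = w}. exp (cylinder_sup X (penalty L) u + cylinder_sup Y \<phi> (map \<Phi> u)))
      = (\<Sum>u\<in>fibre_words w. exp (cylinder_sup X (penalty L) u)) * exp (cylinder_sup Y \<phi> w)"
      unfolding sum_distrib_right by (intro sum.cong) (auto simp: exp_add fibre_words_def)
  qed
  also have "\<dots> \<le> (\<Sum>w\<in>V. 2 * C * exp (cylinder_sup Y \<phi> w))"
    by (intro sum_mono mult_right_mono fibre_partition_sum_le[OF L C]) simp
  also have "\<dots> = 2 * C * partition_sum Y \<phi> n"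
    by (simp add: partition_sum_def V_def sum_distrib_left)
  finally show ?thesis .
qed

text \<open>
  Every point of \<open>Y\<close> has a preimage among the normal points, along whose orbit \<open>f\<close> vanishes. The supremum
  over the cylinder of \<open>w\<close> need not be taken at one preimage word, so the bound is shown point by point.
\<close>
lemma partition_sum_ge:
  assumes Y: "subshift Y" "block_code \<Phi> ` X = Y"
    and bdd: "\<And>x. x \<in> X \<Longrightarrow> f x + \<phi> (block_code \<Phi> x) \<le> B"
    and f: "\<And>x. x \<in> normal_points \<Longrightarrow> f x = 0"
  shows "partition_sum Y \<phi> n \<le> partition_sum X (\<lambda>x. f x + \<phi> (block_code \<Phi> x)) n"
proof -
  define W where "W = {u \<in> language X. length u = n}"
  define V where "V = {w \<in> language Y. length w = n}"
  define h where "h u = cylinder_sup X (\<lambda>x. f x + \<phi> (block_code \<Phi> x)) u" for u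
  have mem: "map \<Phi> u \<in> V" if u: "u \<in> W" for u
    using u map_mem_language[OF Y] by (simp add: V_def W_def)
  have finW: "finite W" by (simp add: W_def finite_words)
  have "exp (cylinder_sup Y \<phi> w) \<le> (\<Sum>u\<in>{u \<in> W. map \<Phi> u = w}. exp (h u))" (is "_ \<le> ?c")
    if w: "w \<in> V" for w
  proof -
    have *: "exp (birkhoff_sum \<phi> (length w) y) \<le> ?c" if y: "y \<in> cylinder Y w" for y
    proof -
      obtain x' where "x' \<in> X" "y = block_code \<Phi> x'"
        using y Y(2) by (auto simp: cylinder_def)
      then obtain x where x: "x \<in> normal_points" "block_code \<Phi> x = y"
        using normal_points_over by metis
      define u where "u = map (\<lambda>k. x (int k)) [0..<n]"
      have xu: "x \<in> cylinder X u"
        using x(1) normal_points_subset by (auto simp: cylinder_def u_def)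
      have lw: "length w = n" using w by (simp add: V_def)
      have uw: "map \<Phi> u = w"
      proof (rule nth_equalityI)
        fix k assume "k < length (map \<Phi> u)"
        then have "k < length w" by (simp add: u_def lw)
        then have "y (int k) = w ! k" using y by (simp add: cylinder_def)
        then show "map \<Phi> u ! k = w ! k"
          using x(2) \<open>k < length w\<close> by (auto simp: u_def lw block_code_def)
      qed (simp add: u_def lw)
      have uW: "u \<in> W"
        using xu language_iff_cylinder[OF subshift_X] by (auto simp: W_def u_def)
      have "birkhoff_sum \<phi> (length w) y = birkhoff_sum (\<lambda>x. f x + \<phi> (block_code \<Phi> x)) (length u) x"
        using x unfolding block_code_funpow_shift
        by (simp add: sum.distrib f funpow_shift translate_normal_points lw u_def)
      also have "\<dots> \<le> h u"
        unfolding h_def by (rule cylinder_sup_upper[OF subshift_X bdd xu])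
      finally have "exp (birkhoff_sum \<phi> (length w) y) \<le> exp (h u)" by simp
      also have "\<dots> \<le> ?c"
        by (rule member_le_sum) (use uW uw finW in auto)
      finally show ?thesis .
    qed
    obtain y where "y \<in> cylinder Y w"
      using w language_iff_cylinder[OF Y(1)] by (auto simp: V_def)
    then have c: "0 < ?c" using * by (smt (verit) exp_gt_zero)
    have "cylinder_sup Y \<phi> w \<le> ln ?c"
      by (rule cylinder_sup_least[OF Y(1)]) (use w * c in \<open>auto simp: V_def ln_ge_iff\<close>)
    then show ?thesis using c by (simp add: ln_ge_iff)
  qed
  then have "partition_sum Y \<phi> n \<le> (\<Sum>w\<in>V. \<Sum>u\<in>{u \<in> W. map \<Phi> u = w}. exp (h u))"
    unfolding partition_sum_def V_def[symmetric] by (rule sum_mono)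
  also have "\<dots> = (\<Sum>u\<in>W. exp (h u))"
    by (rule sum.group) (use mem finite_words in \<open>auto simp: W_def V_def\<close>)
  finally show ?thesis by (simp add: partition_sum_def W_def h_def)
qed

lemma compensation_functionI:
  assumes Y: "subshift Y" "block_code \<Phi> ` X = Y" and cont: "continuous_on X f"
    and f: "\<And>x. x \<in> X \<Longrightarrow> f x \<le> penalty L x" "\<And>x. x \<in> normal_points \<Longrightarrow> f x = 0"
    and L: "2 \<le> L" and C: "C = real (CARD('a) * CARD('a) ^ (2 * m))" "4 * C \<le> exp L"
  shows "compensation_function X Y (block_code \<Phi>) f"
  unfolding compensation_function_def
proof (intro conjI allI impI cont)
  fix \<phi> :: "(int \<Rightarrow> 'b) \<Rightarrow> real" assume \<phi>: "continuous_on Y \<phi>"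
  have "closed Y" using Y(1) by (simp add: subshift_def)
  then obtain B where B: "\<And>y. y \<in> Y \<Longrightarrow> \<phi> y \<le> B"
    using continuous_bounded_above[OF _ \<phi>] by blast
  have B': "f x + \<phi> (block_code \<Phi> x) \<le> B" if "x \<in> X" for x
    using f(1)[OF that] penalty_nonpos[of L x] B[of "block_code \<Phi> x"] L Y(2) that by fastforce
  define a where "a = partition_sum X (\<lambda>x. f x + \<phi> (block_code \<Phi> x))"
  define b where "b = partition_sum Y \<phi>"
  have pos: "0 < b n" for n unfolding b_def by (rule partition_sum_pos[OF Y(1)])
  have up: "a n \<le> 2 * C * b n" for n
    unfolding a_def b_def by (rule partition_sum_le[OF Y B f(1) L C])
  have lo: "b n \<le> a n" for n
    unfolding a_def b_def by (rule partition_sum_ge[OF Y, of f \<phi> B]) (use B' f(2) in auto)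
  have C0: "0 < C" by (simp add: C(1))
  have "(\<lambda>n. ln (a n) / real n - ln (b n) / real n) \<longlonglongrightarrow> 0"
  proof (rule tendsto_sandwich[of "\<lambda>_. 0" _ _ "\<lambda>n. ln (2 * C) / real n"])
    have "ln (b n) \<le> ln (a n)" for n using lo[of n] pos[of n] by simp
    then show "\<forall>\<^sub>F n in sequentially. 0 \<le> ln (a n) / real n - ln (b n) / real n"
      by (simp add: divide_right_mono)
    have "ln (a n) \<le> ln (2 * C) + ln (b n)" for n
    proof -
      have "ln (a n) \<le> ln (2 * C * b n)"
        using up[of n] lo[of n] pos[of n] by (subst ln_le_cancel_iff) auto
      also have "\<dots> = ln (2 * C) + ln (b n)"
        by (rule ln_mult_pos) (use C0 pos[of n] in auto)
      finally show ?thesis .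
    qed
    then have "ln (a n) / real n - ln (b n) / real n \<le> ln (2 * C) / real n" for n
      using divide_right_mono[of "ln (a n)" "ln (2 * C) + ln (b n)" "real n"]
      by (simp add: add_divide_distrib)
    then show "\<forall>\<^sub>F n in sequentially. ln (a n) / real n - ln (b n) / real n \<le> ln (2 * C) / real n"
      by simp
    show "(\<lambda>n. ln (2 * C) / real n) \<longlonglongrightarrow> 0" by real_asymp
  qed simp
  then show "pressure X (\<lambda>x. f x + \<phi> (block_code \<Phi> x)) = pressure Y \<phi>"
    unfolding pressure_eq a_def b_def by (rule lim_eq_of_diff_tendsto_0)
qed

end


section \<open>Entropy of finite-valued maps\<close>

text \<open>
  Entropy of the partition into the fibres of a finite-valued map. For maps, refinements are
  pairings and coarsenings are compositions, which makes the entropy calculus simpler than for partitions.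
\<close>
definition map_entropy :: "'x measure \<Rightarrow> ('x \<Rightarrow> 'c) \<Rightarrow> real"
  where "map_entropy M U =
    - (\<Sum>c\<in>U ` space M. measure M (U -` {c} \<inter> space M) * ln (measure M (U -` {c} \<inter> space M)))"

definition itinerary :: "('x \<Rightarrow> 'x) \<Rightarrow> ('x \<Rightarrow> 'c) \<Rightarrow> nat \<Rightarrow> 'x \<Rightarrow> 'c list"
  where "itinerary T U n x = map (\<lambda>i. U ((T ^^ i) x)) [0..<n]"

lemma (in prob_space) information_space_exp: "information_space M (exp 1)"
  by unfold_locales simp

lemma (in prob_space) map_entropy_eq:
  assumes "simple_function M U"
  shows "entropy (exp 1) (count_space (U ` space M)) U = map_entropy M U"
proof -
  interpret information_space M "exp 1" by (rule information_space_exp)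
  show ?thesis
    using entropy_simple_distributed[OF simple_distributedI[OF assms measure_nonneg refl]]
    by (simp add: map_entropy_def log_ln)
qed

lemma map_entropy_cong:
  assumes "\<And>x. x \<in> space M \<Longrightarrow> U x = V x"
  shows "map_entropy M U = map_entropy M V"
proof -
  have "U ` space M = V ` space M" using assms by auto
  moreover have "U -` {c} \<inter> space M = V -` {c} \<inter> space M" for c using assms by auto
  ultimately show ?thesis by (simp add: map_entropy_def)
qed

lemma (in prob_space) map_entropy_function_le:
  assumes U: "simple_function M U" and f: "\<And>x. x \<in> space M \<Longrightarrow> V x = f (U x)"
  shows "map_entropy M V \<le> map_entropy M U"
proof -
  interpret information_space M "exp 1" by (rule information_space_exp)
  have "map_entropy M V = map_entropy M (f \<circ> U)"
    by (rule map_entropy_cong) (simp add: f)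
  also have "\<dots> \<le> map_entropy M U"
    using entropy_data_processing[OF U, of f] map_entropy_eq[OF U]
      map_entropy_eq[OF simple_function_compose[OF U, of f]] by simp
  finally show ?thesis .
qed

lemma (in prob_space) map_entropy_Pair_le:
  assumes U: "simple_function M U" and V: "simple_function M V"
  shows "map_entropy M (\<lambda>x. (U x, V x)) \<le> map_entropy M U + map_entropy M V"
proof -
  interpret information_space M "exp 1" by (rule information_space_exp)
  show ?thesis
    using entropy_chain_rule[OF U V] conditional_entropy_less_eq_entropy[OF V U]
    by (simp add: map_entropy_eq simple_function_Pair U V)
qed

lemma (in prob_space) map_entropy_nonneg: "0 \<le> map_entropy M U"
proof -
  have "measure M (U -` {c} \<inter> space M) * ln (measure M (U -` {c} \<inter> space M)) \<le> 0" for c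
    by (cases "measure M (U -` {c} \<inter> space M) = 0")
       (auto intro!: mult_nonneg_nonpos simp: ln_le_zero_iff zero_less_measure_iff)
  then show ?thesis
    unfolding map_entropy_def by (simp add: sum_nonpos)
qed

lemma simple_function_comp_measurable:
  assumes V: "simple_function N V" and \<pi>: "\<pi> \<in> measurable M N"
  shows "simple_function M (\<lambda>x. V (\<pi> x))"
  unfolding simple_function_def
proof (intro conjI ballI)
  have "(\<lambda>x. V (\<pi> x)) ` space M \<subseteq> V ` space N"
    using measurable_space[OF \<pi>] by auto
  then show "finite ((\<lambda>x. V (\<pi> x)) ` space M)"
    using simple_functionD(1)[OF V] by (rule finite_subset)
  fix c
  have "(\<lambda>x. V (\<pi> x)) -` {c} \<inter> space M = \<pi> -` (V -` {c} \<inter> space N) \<inter> space M"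
    using measurable_space[OF \<pi>] by auto
  then show "(\<lambda>x. V (\<pi> x)) -` {c} \<inter> space M \<in> sets M"
    using measurable_sets[OF \<pi> simple_functionD(2)[OF V, of "{c}"]] by simp
qed

text \<open>
  Values of \<open>V\<close> outside the image of \<open>\<pi>\<close> have measure zero and hence contribute nothing.
\<close>
lemma map_entropy_distr:
  assumes \<pi>: "\<pi> \<in> measurable M N" and N: "distr M N \<pi> = N" and V: "simple_function N V"
  shows "map_entropy M (\<lambda>x. V (\<pi> x)) = map_entropy N V"
proof -
  have eq: "measure M ((\<lambda>x. V (\<pi> x)) -` {c} \<inter> space M) = measure N (V -` {c} \<inter> space N)" for c
  proof -
    have "(\<lambda>x. V (\<pi> x)) -` {c} \<inter> space M = \<pi> -` (V -` {c} \<inter> space N) \<inter> space M"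
      using measurable_space[OF \<pi>] by auto
    then show ?thesis
      using measure_distr[OF \<pi> simple_functionD(2)[OF V, of "{c}"]] N by simp
  qed
  have sub: "(\<lambda>x. V (\<pi> x)) ` space M \<subseteq> V ` space N"
    using measurable_space[OF \<pi>] by auto
  have zero: "measure N (V -` {c} \<inter> space N) = 0" if "c \<notin> (\<lambda>x. V (\<pi> x)) ` space M" for c
  proof -
    have "(\<lambda>x. V (\<pi> x)) -` {c} \<inter> space M = {}" using that by auto
    then show ?thesis using eq[of c] by simp
  qed
  show ?thesis
    unfolding map_entropy_def eq
    using sum.mono_neutral_left[OF simple_functionD(1)[OF V] sub,
        of "\<lambda>c. measure N (V -` {c} \<inter> space N) * ln (measure N (V -` {c} \<inter> space N))"] zero
    by auto
qed

locale finite_measure_system = prob_space M for M :: "'x measure" +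
  fixes T :: "'x \<Rightarrow> 'x"
  assumes T_measurable: "T \<in> measurable M M" and T_invariant: "distr M M T = M"
begin

lemma funpow_measurable: "T ^^ n \<in> measurable M M"
proof (induction n)
  case (Suc n)
  then show ?case using measurable_comp[OF Suc T_measurable] by (simp add: comp_def)
qed (simp add: id_def)

lemma funpow_invariant: "distr M M (T ^^ n) = M"
proof (induction n)
  case (Suc n)
  have "distr M M (T ^^ Suc n) = distr (distr M M (T ^^ n)) M T"
    by (subst distr_distr[OF T_measurable funpow_measurable]) (simp add: comp_def)
  also have "\<dots> = M" by (simp only: Suc T_invariant)
  finally show ?case .
qed (simp add: id_def distr_id)

lemma simple_function_itinerary:
  assumes U: "simple_function M U"
  shows "simple_function M (itinerary T U n)"
proof (induction n)
  case 0
  show ?case by (simp add: itinerary_def[abs_def])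
next
  case (Suc n)
  have "simple_function M (\<lambda>x. itinerary T U n x @ [U ((T ^^ n) x)])"
    using simple_function_compose2[OF Suc simple_function_comp_measurable[OF U funpow_measurable[of n]],
        of "\<lambda>l c. l @ [c]"] by simp
  then show ?case by (simp add: itinerary_def[abs_def])
qed

definition itinerary_entropy :: "('x \<Rightarrow> 'c) \<Rightarrow> nat \<Rightarrow> real"
  where "itinerary_entropy U n = map_entropy M (itinerary T U n)"

lemma itinerary_entropy_nonneg: "0 \<le> itinerary_entropy U n"
  unfolding itinerary_entropy_def by (rule map_entropy_nonneg)

lemma itinerary_add: "itinerary T U (n + k) x = itinerary T U n x @ itinerary T U k ((T ^^ n) x)"
proof (rule nth_equalityI)
  fix i assume "i < length (itinerary T U (n + k) x)"
  then have i: "i < n + k" by (simp add: itinerary_def)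
  have "(T ^^ i) x = (T ^^ (i - n)) ((T ^^ n) x)" if "i \<ge> n"
    using that funpow_add[of "i - n" n T] by (simp add: fun_eq_iff)
  then show "itinerary T U (n + k) x ! i = (itinerary T U n x @ itinerary T U k ((T ^^ n) x)) ! i"
    using i by (auto simp: itinerary_def nth_append)
qed (simp add: itinerary_def)

lemma itinerary_entropy_subadditive:
  assumes U: "simple_function M U"
  shows "itinerary_entropy U (n + k) \<le> itinerary_entropy U n + itinerary_entropy U k"
proof -
  note sn = simple_function_itinerary[OF U, of n]
  note sk = simple_function_comp_measurable[OF simple_function_itinerary[OF U, of k] funpow_measurable[of n]]
  have "itinerary_entropy U (n + k)
    \<le> map_entropy M (\<lambda>x. (itinerary T U n x, itinerary T U k ((T ^^ n) x)))"
    unfolding itinerary_entropy_def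
    by (rule map_entropy_function_le[OF simple_function_Pair[OF sn sk], of _ "\<lambda>(u, v). u @ v"])
       (simp add: itinerary_add)
  also have "\<dots> \<le> itinerary_entropy U n + map_entropy M (\<lambda>x. itinerary T U k ((T ^^ n) x))"
    unfolding itinerary_entropy_def by (rule map_entropy_Pair_le[OF sn sk])
  also have "map_entropy M (\<lambda>x. itinerary T U k ((T ^^ n) x)) = itinerary_entropy U k"
    unfolding itinerary_entropy_def
    by (rule map_entropy_distr[OF funpow_measurable funpow_invariant simple_function_itinerary[OF U]])
  finally show ?thesis by simp
qed

lemma itinerary_entropy_le:
  assumes U: "simple_function M U"
  shows "itinerary_entropy U n \<le> real n * map_entropy M U"
proof (induction n)
  case 0
  have "itinerary_entropy U 0 = 0"
    by (auto simp: itinerary_entropy_def map_entropy_def itinerary_def[abs_def] prob_space image_def)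
  then show ?case by simp
next
  case (Suc n)
  have "itinerary_entropy U 1 \<le> map_entropy M U"
    unfolding itinerary_entropy_def
    by (rule map_entropy_function_le[OF U, of _ "\<lambda>c. [c]"]) (simp add: itinerary_def)
  then show ?case
    using itinerary_entropy_subadditive[OF U, of n 1] Suc by (simp add: algebra_simps)
qed

end

text \<open>
  The ratios converge to their infimum: dividing \<open>n\<close> by a nearly optimal \<open>k\<close> bounds \<open>a n / n\<close> by \<open>a k / k\<close> up to
  a remainder that is bounded before division by \<open>n\<close>.
\<close>
lemma fekete:
  fixes a :: "nat \<Rightarrow> real"
  assumes sub: "\<And>m n. a (m + n) \<le> a m + a n" and nonneg: "\<And>n. 0 \<le> a n"
  shows "convergent (\<lambda>n. a n / real n)"
proof -
  define L where "L = (INF n\<in>{1..}. a n / real n)"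
  have bdd: "bdd_below ((\<lambda>n. a n / real n) ` {1..})"
    by (rule bdd_belowI2[of _ 0]) (simp add: nonneg)
  have "(\<lambda>n. a n / real n) \<longlonglongrightarrow> L"
  proof (rule LIMSEQ_I)
    fix e :: real assume e: "0 < e"
    have "\<exists>k\<in>{1..}. a k / real k < L + e / 2"
      using cINF_less_iff[OF _ bdd, of "L + e / 2"] e unfolding L_def[symmetric] by auto
    then obtain k where k: "1 \<le> k" "a k / real k < L + e / 2" by auto
    define A where "A = (\<Sum>r<k. a r)"
    have mult: "a (q * k + r) \<le> real q * a k + a r" for q r
    proof (induction q)
      case (Suc q)
      have "a (Suc q * k + r) \<le> a k + a (q * k + r)" using sub[of k "q * k + r"] by (simp add: add.assoc)
      then show ?case using Suc by (simp add: algebra_simps)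
    qed simp
    have up: "a n / real n \<le> a k / real k + A / real n" if n: "1 \<le> n" for n
    proof -
      have "a (n mod k) \<le> A"
        unfolding A_def by (rule member_le_sum) (use k nonneg in auto)
      moreover have "real (n div k) * a k \<le> real n / real k * a k"
        by (intro mult_right_mono nonneg) (rule of_nat_div_le_of_nat)
      ultimately have "a n \<le> real n / real k * a k + A"
        using mult[of "n div k" "n mod k"] by simp
      then have "a n / real n \<le> (real n / real k * a k + A) / real n"
        by (rule divide_right_mono) simp
      also have "\<dots> = a k / real k + A / real n" using n by (simp add: add_divide_distrib)
      finally show ?thesis .
    qed
    obtain n0 where n0: "2 * A / e < real n0" using reals_Archimedean2 by blast
    have "norm (a n / real n - L) < e" if n: "n \<ge> max 1 n0" for n
    proof -
      have "L \<le> a n / real n" unfolding L_def using n by (intro cINF_lower[OF bdd]) simp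
      moreover have "A / real n < e / 2"
      proof -
        have "2 * A / e < real n" using n0 n by linarith
        then have "2 * A < real n * e" using e by (simp add: pos_divide_less_eq)
        then show ?thesis using n by (simp add: divide_simps mult.commute)
      qed
      moreover have "a n / real n \<le> a k / real k + A / real n" using n by (intro up) simp
      ultimately show ?thesis using k(2) unfolding real_norm_def abs_less_iff by linarith
    qed
    then show "\<exists>n0. \<forall>n\<ge>n0. norm (a n / real n - L) < e" by blast
  qed
  then show ?thesis by (rule convergentI)
qed

context finite_measure_system
begin

definition entropy_rate :: "('x \<Rightarrow> 'c) \<Rightarrow> real"
  where "entropy_rate U = lim (\<lambda>n. itinerary_entropy U n / real n)"

lemma entropy_rate_tendsto:
  assumes "simple_function M U"
  shows "(\<lambda>n. itinerary_entropy U n / real n) \<longlonglongrightarrow> entropy_rate U"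
  unfolding entropy_rate_def
  using fekete[OF itinerary_entropy_subadditive[OF assms] itinerary_entropy_nonneg]
  by (simp add: convergent_LIMSEQ_iff)

lemma partition_entropy_eq_map_entropy:
  assumes U: "simple_function M U" and fin: "finite Q"
    and Q: "Q - {{}} = (\<lambda>c. U -` {c} \<inter> space M) ` U ` space M"
  shows "partition_entropy M Q = map_entropy M U"
proof -
  have inj: "inj_on (\<lambda>c. U -` {c} \<inter> space M) (U ` space M)"
    by (rule inj_onI) auto
  have "(\<Sum>A\<in>Q. measure M A * ln (measure M A)) = (\<Sum>A\<in>Q - {{}}. measure M A * ln (measure M A))"
    using fin by (intro sum.mono_neutral_right) auto
  then show ?thesis
    unfolding partition_entropy_def map_entropy_def Q sum.reindex[OF inj] by (simp add: comp_def)
qed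

text \<open>
  A partition is turned into the map that sends a point to its cell. The nonempty members of the
  iterated join are then exactly the fibres of the itinerary of this map.
\<close>
lemma partition_entropy_iterated_join:
  assumes P: "P \<in> measurable_partitions M"
  shows "simple_function M (\<lambda>x. THE A. A \<in> P \<and> x \<in> A)"
    and "partition_entropy M (iterated_join M T P n) = itinerary_entropy (\<lambda>x. THE A. A \<in> P \<and> x \<in> A) n"
proof -
  define cell where "cell x = (THE A. A \<in> P \<and> x \<in> A)" for x
  have P': "finite P" "P \<subseteq> sets M" "\<Union>P = space M" "disjoint P"
    using P by (auto simp: measurable_partitions_def partition_on_def)
  have cell_eq: "cell x = A" if "A \<in> P" "x \<in> A" for x A
    unfolding cell_def using that P'(4) by (intro the_equality) (auto simp: disjoint_def)
  have cell: "cell x \<in> P" "x \<in> cell x" if "x \<in> space M" for x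
    using that P'(3) cell_eq by blast+
  have simple: "simple_function M cell"
    unfolding simple_function_def
  proof (intro conjI ballI)
    show "finite (cell ` space M)" by (rule finite_subset[OF _ P'(1)]) (use cell in auto)
    fix A assume "A \<in> cell ` space M"
    then have A: "A \<in> P" using cell by auto
    have "cell -` {A} \<inter> space M = A"
      using A cell cell_eq P'(3) by auto
    then show "cell -` {A} \<inter> space M \<in> sets M" using A P'(2) by auto
  qed
  then show "simple_function M (\<lambda>x. THE A. A \<in> P \<and> x \<in> A)" unfolding cell_def .
  have Tsp: "(T ^^ i) x \<in> space M" if "x \<in> space M" for i x
    using measurable_space[OF funpow_measurable that] .
  define J where "J s = {x \<in> space M. \<forall>i<n. (T ^^ i) x \<in> s i}" for s
  have J: "iterated_join M T P n = J ` ({..<n} \<rightarrow>\<^sub>E P)"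
    unfolding iterated_join_def J_def by simp
  have fibre: "itinerary T cell n -` {itinerary T cell n x} \<inter> space M
      = J (\<lambda>i\<in>{..<n}. cell ((T ^^ i) x))" if x: "x \<in> space M" for x
  proof -
    have "itinerary T cell n z = itinerary T cell n x \<longleftrightarrow> (\<forall>i<n. (T ^^ i) z \<in> cell ((T ^^ i) x))"
      if z: "z \<in> space M" for z
    proof -
      have "itinerary T cell n z = itinerary T cell n x \<longleftrightarrow> (\<forall>i<n. cell ((T ^^ i) z) = cell ((T ^^ i) x))"
        by (auto simp: itinerary_def)
      then show ?thesis using cell Tsp[OF z] Tsp[OF x] cell_eq by metis
    qed
    then show ?thesis by (auto simp: J_def)
  qed
  have "iterated_join M T P n - {{}}
    = (\<lambda>c. itinerary T cell n -` {c} \<inter> space M) ` itinerary T cell n ` space M" (is "?L = ?R")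
  proof
    show "?L \<subseteq> ?R"
    proof
      fix A assume "A \<in> ?L"
      then obtain s x where s: "s \<in> {..<n} \<rightarrow>\<^sub>E P" "A = J s" and x: "x \<in> A" unfolding J by auto
      have xs: "x \<in> space M" using x s(2) by (simp add: J_def)
      have "s = (\<lambda>i\<in>{..<n}. cell ((T ^^ i) x))"
      proof
        fix i show "s i = (\<lambda>i\<in>{..<n}. cell ((T ^^ i) x)) i"
        proof (cases "i < n")
          case True
          have "s i \<in> P" "(T ^^ i) x \<in> s i" using s x True by (auto simp: J_def)
          then show ?thesis using cell_eq True by simp
        next
          case False
          then show ?thesis using PiE_arb[OF s(1)] by simp
        qed
      qed
      then have "A = itinerary T cell n -` {itinerary T cell n x} \<inter> space M"
        using fibre[OF xs] s(2) by simp
      then show "A \<in> ?R" using xs by blast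
    qed
    show "?R \<subseteq> ?L"
    proof
      fix A assume "A \<in> ?R"
      then obtain x where x: "x \<in> space M" "A = itinerary T cell n -` {itinerary T cell n x} \<inter> space M" by blast
      have "(\<lambda>i\<in>{..<n}. cell ((T ^^ i) x)) \<in> {..<n} \<rightarrow>\<^sub>E P"
        using cell(1) Tsp[OF x(1)] by simp
      then have "A \<in> iterated_join M T P n" unfolding J x(2) fibre[OF x(1)] by blast
      moreover have "x \<in> A" using x by simp
      ultimately show "A \<in> ?L" by blast
    qed
  qed
  moreover have "finite (iterated_join M T P n)"
    unfolding J using P'(1) by (intro finite_imageI finite_PiE) auto
  ultimately have "partition_entropy M (iterated_join M T P n) = map_entropy M (itinerary T cell n)"
    by (intro partition_entropy_eq_map_entropy simple_function_itinerary simple)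
  then show "partition_entropy M (iterated_join M T P n) = itinerary_entropy (\<lambda>x. THE A. A \<in> P \<and> x \<in> A) n"
    unfolding itinerary_entropy_def cell_def .
qed

lemma entropy_rate_function_le:
  assumes U: "simple_function M U" and V: "simple_function M V"
    and f: "\<And>x. x \<in> space M \<Longrightarrow> V x = f (U x)"
  shows "entropy_rate V \<le> entropy_rate U"
proof (rule LIMSEQ_le[OF entropy_rate_tendsto[OF V] entropy_rate_tendsto[OF U]])
  have "itinerary_entropy V n \<le> itinerary_entropy U n" for n
    unfolding itinerary_entropy_def
    by (rule map_entropy_function_le[OF simple_function_itinerary[OF U], of _ "map f"])
       (simp add: itinerary_def f measurable_space[OF funpow_measurable])
  then show "\<exists>N. \<forall>n\<ge>N. itinerary_entropy V n / real n \<le> itinerary_entropy U n / real n"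
    by (simp add: divide_right_mono)
qed

text \<open>
  The map \<open>U\<close> and the cell map of its partition into fibres are functions of each other.
\<close>
lemma entropy_rate_le_ks_entropy:
  assumes U: "simple_function M U"
  shows "ereal (entropy_rate U) \<le> ks_entropy M T"
proof -
  define P where "P = (\<lambda>c. U -` {c} \<inter> space M) ` U ` space M"
  have P: "P \<in> measurable_partitions M"
    unfolding measurable_partitions_def mem_Collect_eq
  proof (intro conjI)
    show "finite P" unfolding P_def using simple_functionD(1)[OF U] by simp
    show "P \<subseteq> sets M" unfolding P_def using simple_functionD(2)[OF U] by auto
    show "partition_on (space M) P" by (auto simp: P_def partition_on_def disjoint_def)
  qed
  have cell: "(THE A. A \<in> P \<and> x \<in> A) = U -` {U x} \<inter> space M" if "x \<in> space M" for x
    by (rule the_equality) (use that in \<open>auto simp: P_def\<close>)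
  have "entropy_rate U \<le> entropy_rate (\<lambda>x. THE A. A \<in> P \<and> x \<in> A)"
  proof (rule entropy_rate_function_le[OF partition_entropy_iterated_join(1)[OF P] U])
    fix x assume x: "x \<in> space M"
    \<comment> \<open>A value of \<open>U\<close> is recovered from its fibre by evaluating \<open>U\<close> at any point of the fibre.\<close>
    have "(SOME z. z \<in> U -` {U x} \<inter> space M) \<in> U -` {U x} \<inter> space M"
      by (rule someI[of _ x]) (use x in simp)
    then show "U x = U (SOME z. z \<in> (THE A. A \<in> P \<and> x \<in> A))"
      unfolding cell[OF x] by simp
  qed
  also have "ereal (entropy_rate (\<lambda>x. THE A. A \<in> P \<and> x \<in> A)) \<le> ks_entropy M T"
    unfolding ks_entropy_def entropy_rate_def partition_entropy_iterated_join(2)[OF P, symmetric]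
    by (rule SUP_upper[OF P])
  finally show ?thesis by simp
qed

lemma ks_entropy_le:
  assumes "\<And>U :: 'x \<Rightarrow> 'x set. simple_function M U \<Longrightarrow> ereal (entropy_rate U) \<le> c"
  shows "ks_entropy M T \<le> c"
  unfolding ks_entropy_def
proof (rule SUP_least)
  fix P assume P: "P \<in> measurable_partitions M"
  show "ereal (lim (\<lambda>n. partition_entropy M (iterated_join M T P n) / real n)) \<le> c"
    using assms[OF partition_entropy_iterated_join(1)[OF P]]
    unfolding partition_entropy_iterated_join(2)[OF P] entropy_rate_def .
qed

end

text \<open>
  Every finite-valued map on the factor pulls back to one with the same itinerary entropies.
\<close>
lemma ks_entropy_factor_le:
  assumes M: "finite_measure_system M S" and N: "finite_measure_system N T"
    and \<pi>: "\<pi> \<in> measurable M N" "distr M N \<pi> = N"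
    and eq: "\<And>x. x \<in> space M \<Longrightarrow> \<pi> (S x) = T (\<pi> x)"
  shows "ks_entropy N T \<le> ks_entropy M S"
proof -
  interpret M: finite_measure_system M S by (rule M)
  interpret N: finite_measure_system N T by (rule N)
  show ?thesis
  proof (rule N.ks_entropy_le)
    fix U :: "'b \<Rightarrow> 'b set" assume U: "simple_function N U"
    have pow: "\<pi> ((S ^^ i) x) = (T ^^ i) (\<pi> x)" if "x \<in> space M" for i x
      using that eq measurable_space[OF M.funpow_measurable] by (induction i) auto
    have "M.itinerary_entropy (\<lambda>x. U (\<pi> x)) n = N.itinerary_entropy U n" for n
    proof -
      have "M.itinerary_entropy (\<lambda>x. U (\<pi> x)) n = map_entropy M (\<lambda>x. itinerary T U n (\<pi> x))"
        unfolding M.itinerary_entropy_def by (rule map_entropy_cong) (simp add: itinerary_def pow)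
      also have "\<dots> = N.itinerary_entropy U n"
        unfolding N.itinerary_entropy_def
        by (rule map_entropy_distr[OF \<pi> N.simple_function_itinerary[OF U]])
      finally show ?thesis .
    qed
    then have "N.entropy_rate U = M.entropy_rate (\<lambda>x. U (\<pi> x))"
      by (simp add: N.entropy_rate_def M.entropy_rate_def)
    then show "ereal (N.entropy_rate U) \<le> ks_entropy M S"
      using M.entropy_rate_le_ks_entropy[OF simple_function_comp_measurable[OF U \<pi>(1)]] by simp
  qed
qed


section \<open>The zero coordinate generates the entropy of a subshift\<close>

lemma invariant_measure_space:
  fixes X :: "(int \<Rightarrow> 'a::{finite,discrete_topology}) set"
  assumes "\<mu> \<in> invariant_measures X"
  shows "space \<mu> = X"
proof -
  have "sets \<mu> = sets (restrict_space borel X)" using assms by (simp add: invariant_measures_def)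
  then show ?thesis by (simp add: sets_eq_imp_space_eq space_restrict_space)
qed

lemma invariant_measure_sets:
  "\<mu> \<in> invariant_measures X \<Longrightarrow> sets \<mu> = (\<lambda>A. A \<inter> X) ` sets borel"
  by (auto simp: invariant_measures_def sets_restrict_space Int_commute)

lemma measurable_shift_restrict:
  fixes X :: "(int \<Rightarrow> 'a::{finite,discrete_topology}) set"
  assumes "subshift X"
  shows "shift \<in> measurable (restrict_space borel X) (restrict_space borel X)"
proof (rule measurable_restrict_space3)
  show "(shift :: (int \<Rightarrow> 'a) \<Rightarrow> _) \<in> borel_measurable borel"
    unfolding shift_eq_translate by (rule borel_measurable_continuous_onI[OF continuous_on_translate])
  show "shift \<in> X \<rightarrow> X" using assms by (auto simp: subshift_def)
qed

lemma invariant_measure_system: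
  fixes X :: "(int \<Rightarrow> 'a::{finite,discrete_topology}) set"
  assumes X: "subshift X" and \<mu>: "\<mu> \<in> invariant_measures X"
  shows "finite_measure_system \<mu> shift"
proof -
  have *: "prob_space \<mu>" "sets \<mu> = sets (restrict_space borel X)" "distr \<mu> \<mu> shift = \<mu>"
    using \<mu> by (auto simp: invariant_measures_def)
  interpret prob_space \<mu> by (rule *(1))
  show ?thesis
  proof
    show "shift \<in> measurable \<mu> \<mu>"
      using measurable_shift_restrict[OF X] measurable_cong_sets[OF *(2) *(2)] by simp
  qed (rule *(3))
qed

lemma simple_function_zero_coordinate:
  fixes X :: "(int \<Rightarrow> 'a::{finite,discrete_topology}) set"
  assumes \<mu>: "\<mu> \<in> invariant_measures X"
  shows "simple_function \<mu> (\<lambda>x. x 0)"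
  unfolding simple_function_def
proof (intro conjI ballI)
  fix c :: 'a
  have "local_set 0 {x :: int \<Rightarrow> 'a. x 0 = c}" by (auto simp: local_set_def agree_on_def)
  then have "{x :: int \<Rightarrow> 'a. x 0 = c} \<in> sets borel" by (intro borel_open local_set_open)
  then have "{x. x 0 = c} \<inter> X \<in> sets \<mu>" using invariant_measure_sets[OF \<mu>] by blast
  also have "{x. x 0 = c} \<inter> X = (\<lambda>x. x 0) -` {c} \<inter> space \<mu>"
    using invariant_measure_space[OF \<mu>] by auto
  finally show "(\<lambda>x. x 0) -` {c} \<inter> space \<mu> \<in> sets \<mu>" .
qed simp

text \<open>
  The sets that can be approximated contain the local sets and are closed under complements. For a countable union
  a finite part carries all but \<open>e / 2\<close> of the measure, and its members are approximated one by one.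
\<close>
lemma local_approximation:
  fixes X :: "(int \<Rightarrow> 'a::{finite,discrete_topology}) set"
  assumes \<mu>: "\<mu> \<in> invariant_measures X" and A: "A \<in> sets borel" and e: "0 < e"
  shows "\<exists>k B. local_set k B \<and> measure \<mu> ((A - B \<union> (B - A)) \<inter> X) < e"
proof -
  interpret prob_space \<mu> using \<mu> by (simp add: invariant_measures_def)
  have meas: "B \<inter> X \<in> sets \<mu>" if "B \<in> sets borel" for B
    using invariant_measure_sets[OF \<mu>] that by blast
  have loc: "B \<in> sets borel" if "local_set k B" for k and B :: "(int \<Rightarrow> 'a) set"
    using that by (intro borel_open local_set_open)
  define G where "G = {A :: (int \<Rightarrow> 'a) set. \<exists>k. local_set k A}"
  have borel: "sets borel = sigma_sets UNIV G"
    unfolding G_def by (rule sets_borel_local_set)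
  have "A \<in> sigma_sets UNIV G" using A borel by simp
  then have "\<forall>e>0. \<exists>k B. local_set k B \<and> measure \<mu> ((A - B \<union> (B - A)) \<inter> X) < e"
  proof induction
    case (Basic a)
    then obtain k where "local_set k a" by (auto simp: G_def)
    then show ?case by (intro allI impI exI[of _ k] exI[of _ a]) simp
  next
    case Empty
    then show ?case by (intro allI impI exI[of _ 0] exI[of _ "{}"]) (simp add: local_set_def)
  next
    case (Compl a)
    show ?case
    proof (intro allI impI)
      fix e :: real assume "0 < e"
      then obtain k B where B: "local_set k B" "measure \<mu> ((a - B \<union> (B - a)) \<inter> X) < e"
        using Compl.IH by blast
      have "(UNIV - a) - (- B) \<union> (- B - (UNIV - a)) = a - B \<union> (B - a)" by auto
      then show "\<exists>k B. local_set k B \<and> measure \<mu> (((UNIV - a) - B \<union> (B - (UNIV - a))) \<inter> X) < e"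
        using local_set_Compl[OF B(1)] B(2) by metis
    qed
  next
    case (Union a)
    show ?case
    proof (intro allI impI)
      fix e :: real assume e: "0 < e"
      have a: "a i \<in> sets borel" for i using Union.hyps borel by simp
      define S where "S n = (\<Union>i\<le>n. a i) \<inter> X" for n
      have S: "S n \<in> sets \<mu>" for n
        unfolding S_def using a by (intro meas sets.finite_UN) auto
      have UX: "(\<Union>i. a i) \<inter> X \<in> sets \<mu>" using a by (intro meas sets.countable_UN) auto
      have "(\<lambda>n. measure \<mu> (S n)) \<longlonglongrightarrow> measure \<mu> (\<Union>n. S n)"
        by (rule finite_Lim_measure_incseq) (use S in \<open>auto simp: incseq_def S_def\<close>, force)
      moreover have "(\<Union>n. S n) = (\<Union>i. a i) \<inter> X" by (auto simp: S_def)
      ultimately have "\<forall>\<^sub>F n in sequentially. measure \<mu> ((\<Union>i. a i) \<inter> X) - e / 2 < measure \<mu> (S n)"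
        using e by (intro order_tendstoD(1)) auto
      then obtain n where n: "measure \<mu> ((\<Union>i. a i) \<inter> X) - e / 2 < measure \<mu> (S n)"
        by (auto simp: eventually_sequentially)
      have "\<exists>k B. local_set k B \<and> measure \<mu> ((a i - B \<union> (B - a i)) \<inter> X) < e / (2 * (real n + 1))" for i
        using Union.IH[of i] e by simp
      then obtain k B where B: "\<And>i. local_set (k i) (B i)"
        "\<And>i. measure \<mu> ((a i - B i \<union> (B i - a i)) \<inter> X) < e / (2 * (real n + 1))" by metis
      define K where "K = Max (k ` {..n})"
      have "local_set K (B i)" if "i \<le> n" for i
        unfolding K_def by (rule local_set_mono[OF B(1)]) (use that in auto)
      then have loc': "local_set K (\<Union>i\<le>n. B i)"
        unfolding local_set_def by blast
      define D where "D i = (a i - B i \<union> (B i - a i)) \<inter> X" for i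
      have D: "D i \<in> sets \<mu>" for i
        unfolding D_def using a loc[OF B(1)] by (intro meas sets.Un sets.Diff) auto
      have "((\<Union>i. a i) - (\<Union>i\<le>n. B i) \<union> ((\<Union>i\<le>n. B i) - (\<Union>i. a i))) \<inter> X
        \<subseteq> ((\<Union>i. a i) \<inter> X - S n) \<union> (\<Union>i\<le>n. D i)"
        unfolding S_def D_def by blast
      then have "measure \<mu> (((\<Union>i. a i) - (\<Union>i\<le>n. B i) \<union> ((\<Union>i\<le>n. B i) - (\<Union>i. a i))) \<inter> X)
        \<le> measure \<mu> (((\<Union>i. a i) \<inter> X - S n) \<union> (\<Union>i\<le>n. D i))"
        by (rule finite_measure_mono) (use UX S D in \<open>auto intro!: sets.Un sets.Diff sets.finite_UN\<close>)
      also have "\<dots> \<le> measure \<mu> ((\<Union>i. a i) \<inter> X - S n) + measure \<mu> (\<Union>i\<le>n. D i)"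
        by (rule measure_Un_le) (use UX S D in \<open>auto intro!: sets.Diff sets.finite_UN\<close>)
      also have "measure \<mu> ((\<Union>i. a i) \<inter> X - S n) < e / 2"
      proof -
        have "S n \<subseteq> (\<Union>i. a i) \<inter> X" by (auto simp: S_def)
        then show ?thesis using n finite_measure_Diff[OF UX S, of n] by simp
      qed
      also have "measure \<mu> (\<Union>i\<le>n. D i) \<le> (\<Sum>i\<le>n. measure \<mu> (D i))"
        by (rule finite_measure_subadditive_finite) (use D in auto)
      also have "\<dots> \<le> (\<Sum>i\<le>n. e / (2 * (real n + 1)))"
        by (rule sum_mono) (use B(2) in \<open>auto simp: D_def intro: less_imp_le\<close>)
      also have "\<dots> = e / 2" by (simp add: field_simps)
      finally have "measure \<mu> (((\<Union>i. a i) - (\<Union>i\<le>n. B i) \<union> ((\<Union>i\<le>n. B i) - (\<Union>i. a i))) \<inter> X) < e"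
        by simp
      then show "\<exists>k B. local_set k B \<and> measure \<mu> (((\<Union>i. a i) - B \<union> (B - (\<Union>i. a i))) \<inter> X) < e"
        using loc' by blast
    qed
  qed
  then show ?thesis using e by blast
qed

lemma itinerary_zero_coordinate:
  "itinerary shift (\<lambda>x. x 0) n x = map (\<lambda>i. x (int i)) [0..<n]"
  by (simp add: itinerary_def funpow_shift translate_apply)

text \<open>
  The fibres of \<open>V\<close> are approximated by local sets and \<open>V'\<close> is read off from these. The shift by \<open>k\<close> turns the
  symmetric window of \<open>V'\<close> into the positions \<open>0, \<dots>, 2 k\<close> of an itinerary.
\<close>
lemma approximation_by_itinerary:
  fixes X :: "(int \<Rightarrow> 'a::{finite,discrete_topology}) set"
  assumes X: "subshift X" and \<mu>: "\<mu> \<in> invariant_measures X" and V: "simple_function \<mu> V" and e: "0 < e"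
  shows "\<exists>k f. measure \<mu> {x \<in> space \<mu>. V ((shift ^^ k) x) \<noteq> f (itinerary shift (\<lambda>x. x 0) (2 * k + 1) x)} < e"
proof -
  interpret finite_measure_system \<mu> shift by (rule invariant_measure_system[OF X \<mu>])
  have sp: "space \<mu> = X" by (rule invariant_measure_space[OF \<mu>])
  define vals where "vals = V ` X"
  have fin: "finite vals" using simple_functionD(1)[OF V] sp by (simp add: vals_def)
  define d where "d = e / (real (card vals) + 1)"
  have d: "0 < d" using e by (simp add: d_def)
  have "\<exists>k B. local_set k B \<and> V -` {c} \<inter> X - B \<union> (B \<inter> X - V -` {c}) \<in> sets \<mu>
    \<and> measure \<mu> (V -` {c} \<inter> X - B \<union> (B \<inter> X - V -` {c})) < d" for c
  proof -
    obtain A where A: "A \<in> sets borel" "V -` {c} \<inter> X = A \<inter> X"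
      using simple_functionD(2)[OF V, of "{c}"] invariant_measure_sets[OF \<mu>] sp by auto
    obtain k B where B: "local_set k B" "measure \<mu> ((A - B \<union> (B - A)) \<inter> X) < d"
      using local_approximation[OF \<mu> A(1) d] by blast
    have "B \<in> sets borel" using B(1) by (intro borel_open local_set_open)
    then have "(A - B \<union> (B - A)) \<inter> X \<in> sets \<mu>"
      using A(1) invariant_measure_sets[OF \<mu>] by blast
    moreover have "(A - B \<union> (B - A)) \<inter> X = V -` {c} \<inter> X - B \<union> (B \<inter> X - V -` {c})"
      using A(2) by blast
    ultimately show ?thesis using B by metis
  qed
  then obtain k B where B: "\<And>c. local_set (k c) (B c)"
    "\<And>c. V -` {c} \<inter> X - B c \<union> (B c \<inter> X - V -` {c}) \<in> sets \<mu>"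
    "\<And>c. measure \<mu> (V -` {c} \<inter> X - B c \<union> (B c \<inter> X - V -` {c})) < d"
    by metis
  define K where "K = Max (insert 0 (k ` vals))"
  define V' where "V' x = (THE c. c \<in> vals \<and> x \<in> B c)" for x
  have V'_local: "V' x = V' z" if ag: "agree_on {- int K..int K} x z" for x z
  proof -
    have "x \<in> B c \<longleftrightarrow> z \<in> B c" if "c \<in> vals" for c
    proof -
      have "local_set K (B c)"
        unfolding K_def by (rule local_set_mono[OF B(1)]) (use fin that in auto)
      then show ?thesis using ag by (simp add: local_set_def)
    qed
    then have "(\<lambda>c. c \<in> vals \<and> x \<in> B c) = (\<lambda>c. c \<in> vals \<and> z \<in> B c)" by auto
    then show ?thesis by (simp add: V'_def)
  qed
  define D where "D c = V -` {c} \<inter> X - B c \<union> (B c \<inter> X - V -` {c})" for c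
  have D: "D c \<in> sets \<mu>" for c using B(2) by (simp add: D_def)
  have UD: "(\<Union>c\<in>vals. D c) \<in> sets \<mu>" using fin D by (intro sets.finite_UN) auto
  have "measure \<mu> (\<Union>c\<in>vals. D c) \<le> (\<Sum>c\<in>vals. measure \<mu> (D c))"
    by (rule finite_measure_subadditive_finite) (use fin D in auto)
  also have "\<dots> \<le> (\<Sum>c\<in>vals. d)"
    by (rule sum_mono) (use B(3) in \<open>auto simp: D_def intro: less_imp_le\<close>)
  also have "\<dots> = e * (real (card vals) / (real (card vals) + 1))" by (simp add: d_def)
  also have "\<dots> < e * 1" using e by (intro mult_strict_left_mono) auto
  finally have small: "measure \<mu> (\<Union>c\<in>vals. D c) < e" by simp
  have good: "V x = V' x" if x: "x \<in> X" "x \<notin> (\<Union>c\<in>vals. D c)" for x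
  proof -
    have "c \<in> vals \<and> x \<in> B c \<longleftrightarrow> c = V x" for c
    proof (cases "c \<in> vals")
      case True
      then have "x \<notin> D c" using x(2) by blast
      then have "x \<in> B c \<longleftrightarrow> V x = c" using x(1) unfolding D_def by blast
      then show ?thesis using True by auto
    next
      case False
      then show ?thesis using x(1) unfolding vals_def by blast
    qed
    then show ?thesis by (simp add: V'_def)
  qed
  \<comment> \<open>The values of the dummy point outside the window are irrelevant, as \<open>V'\<close> is local.\<close>
  define f where "f l = V' (\<lambda>j. if \<bar>j\<bar> \<le> int K then l ! nat (j + int K) else undefined)" for l
  have f: "f (itinerary shift (\<lambda>x. x 0) (2 * K + 1) x) = V' ((shift ^^ K) x)" for x
    unfolding f_def itinerary_zero_coordinate
    by (rule V'_local) (auto simp: agree_on_def funpow_shift translate_apply simp del: upt_Suc)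
  have "{x \<in> space \<mu>. V ((shift ^^ K) x) \<noteq> f (itinerary shift (\<lambda>x. x 0) (2 * K + 1) x)}
    \<subseteq> (shift ^^ K) -` (\<Union>c\<in>vals. D c) \<inter> space \<mu>"
    unfolding f using good measurable_space[OF funpow_measurable] sp by blast
  then have "measure \<mu> {x \<in> space \<mu>. V ((shift ^^ K) x) \<noteq> f (itinerary shift (\<lambda>x. x 0) (2 * K + 1) x)}
    \<le> measure \<mu> ((shift ^^ K) -` (\<Union>c\<in>vals. D c) \<inter> space \<mu>)"
    by (rule finite_measure_mono) (rule measurable_sets[OF funpow_measurable UD])
  also have "\<dots> = measure \<mu> (\<Union>c\<in>vals. D c)"
    using measure_distr[OF funpow_measurable UD, of K] funpow_invariant[of K] by simp
  finally show ?thesis using small by (intro exI[of _ K] exI[of _ f]) simp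
qed

text \<open>
  Both follow from \<open>ln t \<le> t - 1\<close>, the second one applied to \<open>sqrt p\<close>.
\<close>
lemma minus_mult_ln_le:
  fixes p :: real
  assumes "0 \<le> p"
  shows "- (p * ln p) \<le> 1 - p" "- (p * ln p) \<le> 2 * sqrt p"
proof -
  have le: "- (q * ln q) \<le> 1 - q" if "0 \<le> q" for q :: real
  proof (cases "q = 0")
    case False
    then have q: "0 < q" using that by simp
    have "ln (1 / q) \<le> 1 / q - 1" using q by (intro ln_le_minus_one) simp
    then have "q * (- ln q) \<le> q * (1 / q - 1)" using q by (intro mult_left_mono) (auto simp: ln_div)
    then show ?thesis using q by (simp add: algebra_simps)
  qed simp
  show "- (p * ln p) \<le> 1 - p" by (rule le[OF assms])
  have "- (sqrt p * ln (sqrt p)) \<le> 1"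
    using le[of "sqrt p"] assms by simp (smt (verit) real_sqrt_ge_zero)
  then have "(2 * sqrt p) * - (sqrt p * ln (sqrt p)) \<le> (2 * sqrt p) * 1"
    by (rule mult_left_mono) (use assms in simp)
  moreover have "(2 * sqrt p) * - (sqrt p * ln (sqrt p)) = - (p * ln p)"
  proof (cases "p = 0")
    case False
    then have "ln (sqrt p) = ln p / 2" using assms by (simp add: ln_sqrt)
    moreover have "sqrt p * sqrt p = p" using assms by simp
    ultimately show ?thesis by (simp add: algebra_simps)
  qed simp
  ultimately show "- (p * ln p) \<le> 2 * sqrt p" by simp
qed

text \<open>
  The bound tends to \<open>0\<close> with \<open>e\<close>; this makes the correction map in the next proof cheap.
\<close>
lemma (in prob_space) map_entropy_rarely_Some:
  assumes D: "simple_function M D" and e: "measure M {x \<in> space M. D x \<noteq> None} \<le> e"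
    and S: "finite S" "D ` space M \<subseteq> insert None (Some ` S)"
  shows "map_entropy M D \<le> e + 2 * real (card S) * sqrt e"
proof -
  define h where "h c = - (measure M (D -` {c} \<inter> space M) * ln (measure M (D -` {c} \<inter> space M)))" for c
  have N: "D -` {None} \<inter> space M \<in> sets M" by (rule simple_functionD(2)[OF D])
  have e0: "0 \<le> e" using e measure_nonneg[of M] order_trans by blast
  have "{x \<in> space M. D x \<noteq> None} = space M - (D -` {None} \<inter> space M)" by auto
  then have "1 - measure M (D -` {None} \<inter> space M) \<le> e"
    using e prob_compl[OF N] by simp
  then have hN: "h None \<le> e"
    using minus_mult_ln_le(1)[of "measure M (D -` {None} \<inter> space M)"] by (simp add: h_def)
  have hS: "h (Some c) \<le> 2 * sqrt e" for c
  proof -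
    have "measure M (D -` {Some c} \<inter> space M) \<le> measure M {x \<in> space M. D x \<noteq> None}"
    proof (rule finite_measure_mono)
      have "{x \<in> space M. D x \<noteq> None} = space M - (D -` {None} \<inter> space M)" by auto
      then show "{x \<in> space M. D x \<noteq> None} \<in> sets M" using N by auto
    qed auto
    then have "sqrt (measure M (D -` {Some c} \<inter> space M)) \<le> sqrt e" using e by simp
    then show ?thesis
      using minus_mult_ln_le(2)[of "measure M (D -` {Some c} \<inter> space M)"]
      unfolding h_def by (smt (verit) measure_nonneg)
  qed
  have h0: "0 \<le> h c" for c
    unfolding h_def neg_0_le_iff_le
    by (cases "measure M (D -` {c} \<inter> space M) = 0")
       (auto intro!: mult_nonneg_nonpos simp: ln_le_zero_iff zero_less_measure_iff)
  have "map_entropy M D = sum h (D ` space M)"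
    by (simp add: map_entropy_def h_def sum_negf)
  also have "\<dots> \<le> sum h (insert None (Some ` S))"
    by (rule sum_mono2) (use S h0 in auto)
  also have "\<dots> = h None + (\<Sum>c\<in>S. h (Some c))"
    using S(1) by (subst sum.insert) (auto simp: sum.reindex comp_def)
  also have "\<dots> \<le> e + (\<Sum>c\<in>S. 2 * sqrt e)"
    by (intro add_mono hN sum_mono hS)
  finally show ?thesis by simp
qed

text \<open>
  The generator theorem. Up to a shift, \<open>V\<close> is recovered from a map \<open>V2\<close> of
  finitely many coordinates and a correction \<open>D\<close>, which is \<open>None\<close> where the two agree. As \<open>D\<close> rarely
  differs from \<open>None\<close> it has small entropy, and its itineraries cost at most that entropy per step; the itineraries
  of \<open>V2\<close> of length \<open>n\<close> are determined by \<open>n + 2 k\<close> coordinates. Subadditivity and monotonicity of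
  the entropy give the rest.
\<close>
lemma entropy_rate_zero_coordinate:
  fixes X :: "(int \<Rightarrow> 'a::{finite,discrete_topology}) set"
  assumes X: "subshift X" and \<mu>: "\<mu> \<in> invariant_measures X" and V: "simple_function \<mu> V"
  shows "finite_measure_system.entropy_rate \<mu> shift V
    \<le> finite_measure_system.entropy_rate \<mu> shift (\<lambda>x. x 0)"
proof -
  interpret finite_measure_system \<mu> shift by (rule invariant_measure_system[OF X \<mu>])
  define G where "G x = x 0" for x :: "int \<Rightarrow> 'a"
  have G: "simple_function \<mu> G"
    unfolding G_def by (rule simple_function_zero_coordinate[OF \<mu>])
  define N where "N = real (card (V ` space \<mu>))"
  have "entropy_rate V \<le> entropy_rate G + e" if e: "0 < e" for e
  proof -
    \<comment> \<open>For \<open>s \<le> 1\<close> the entropy bound \<open>s\<^sup>2 + 2 N s\<close> of the correction is at most \<open>(1 + 2 N) s\<close>.\<close>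
    define s where "s = min 1 (e / (1 + 2 * N))"
    have s: "0 < s" "s \<le> 1" "(1 + 2 * N) * s \<le> e"
    proof -
      have "0 < 1 + 2 * N" by (simp add: N_def)
      then show "0 < s" "s \<le> 1" using e by (auto simp: s_def)
      have "(1 + 2 * N) * s \<le> (1 + 2 * N) * (e / (1 + 2 * N))"
        using \<open>0 < 1 + 2 * N\<close> by (intro mult_left_mono) (auto simp: s_def)
      then show "(1 + 2 * N) * s \<le> e" using \<open>0 < 1 + 2 * N\<close> by simp
    qed
    obtain k f where kf: "measure \<mu> {x \<in> space \<mu>. V ((shift ^^ k) x) \<noteq> f (itinerary shift G (2 * k + 1) x)} < s\<^sup>2"
      using approximation_by_itinerary[OF X \<mu> V, of "s\<^sup>2"] s unfolding G_def by auto
    define V1 where "V1 x = V ((shift ^^ k) x)" for x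
    define V2 where "V2 x = f (itinerary shift G (2 * k + 1) x)" for x
    define D where "D x = (if V1 x = V2 x then None else Some (V1 x))" for x
    have V1: "simple_function \<mu> V1"
      unfolding V1_def by (rule simple_function_comp_measurable[OF V funpow_measurable])
    have V2: "simple_function \<mu> V2"
      unfolding V2_def by (rule simple_function_compose1[OF simple_function_itinerary[OF G]])
    have D: "simple_function \<mu> D"
      unfolding D_def by (rule simple_function_compose2[OF V1 V2])
    have "map_entropy \<mu> D \<le> s\<^sup>2 + 2 * N * sqrt (s\<^sup>2)"
      unfolding N_def
    proof (rule map_entropy_rarely_Some[OF D])
      have "{x \<in> space \<mu>. D x \<noteq> None} = {x \<in> space \<mu>. V ((shift ^^ k) x) \<noteq> f (itinerary shift G (2 * k + 1) x)}"
        by (auto simp: D_def V1_def V2_def)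
      then show "measure \<mu> {x \<in> space \<mu>. D x \<noteq> None} \<le> s\<^sup>2" using kf by simp
      show "finite (V ` space \<mu>)" by (rule simple_functionD(1)[OF V])
      show "D ` space \<mu> \<subseteq> insert None (Some ` V ` space \<mu>)"
        using measurable_space[OF funpow_measurable] by (auto simp: D_def V1_def)
    qed
    also have "\<dots> \<le> s + 2 * N * s"
      using s by (simp add: power2_eq_square mult_left_le)
    also have "\<dots> \<le> e" using s(3) by (simp add: algebra_simps)
    finally have De: "map_entropy \<mu> D \<le> e" .
    have bound: "itinerary_entropy V n \<le> itinerary_entropy G n + itinerary_entropy G (2 * k) + real n * e" for n
    proof -
      have "itinerary_entropy V n = map_entropy \<mu> (\<lambda>x. itinerary shift V n ((shift ^^ k) x))"
        unfolding itinerary_entropy_def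
        by (rule map_entropy_distr[OF funpow_measurable funpow_invariant simple_function_itinerary[OF V], symmetric])
      also have "(\<lambda>x. itinerary shift V n ((shift ^^ k) x)) = itinerary shift V1 n"
        by (auto simp: itinerary_def V1_def funpow_shift translate_translate add.commute)
      also have "map_entropy \<mu> (itinerary shift V1 n)
        \<le> map_entropy \<mu> (\<lambda>x. (itinerary shift V2 n x, itinerary shift D n x))"
      proof (rule map_entropy_function_le[OF simple_function_Pair])
        fix x
        show "itinerary shift V1 n x = (\<lambda>(u, v). map (\<lambda>(a, d). case d of None \<Rightarrow> a | Some b \<Rightarrow> b) (zip u v))
            (itinerary shift V2 n x, itinerary shift D n x)"
          by (rule nth_equalityI) (auto simp: itinerary_def D_def)
      qed (rule simple_function_itinerary V2 D)+
      also have "\<dots> \<le> itinerary_entropy V2 n + itinerary_entropy D n"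
        unfolding itinerary_entropy_def
        by (rule map_entropy_Pair_le) (rule simple_function_itinerary V2 D)+
      also have "itinerary_entropy D n \<le> real n * e"
        using itinerary_entropy_le[OF D, of n] mult_left_mono[OF De, of "real n"] by simp
      also have "itinerary_entropy V2 n \<le> itinerary_entropy G (n + 2 * k)"
        unfolding itinerary_entropy_def
      proof (rule map_entropy_function_le[OF simple_function_itinerary[OF G]])
        fix x
        show "itinerary shift V2 n x
          = (\<lambda>l. map (\<lambda>i. f (take (2 * k + 1) (drop i l))) [0..<n]) (itinerary shift G (n + 2 * k) x)"
        proof (rule nth_equalityI)
          fix i assume "i < length (itinerary shift V2 n x)"
          then have i: "i < n" by (simp add: itinerary_def)
          have "itinerary shift G (2 * k + 1) ((shift ^^ i) x) = take (2 * k + 1) (drop i (itinerary shift G (n + 2 * k) x))"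
            by (rule nth_equalityI)
               (use i in \<open>auto simp: G_def itinerary_def funpow_shift translate_apply add_ac simp del: upt_Suc\<close>)
          then show "itinerary shift V2 n x ! i
            = (\<lambda>l. map (\<lambda>i. f (take (2 * k + 1) (drop i l))) [0..<n]) (itinerary shift G (n + 2 * k) x) ! i"
            using i by (simp add: itinerary_def V2_def)
        qed (simp add: itinerary_def)
      qed
      also have "itinerary_entropy G (n + 2 * k) \<le> itinerary_entropy G n + itinerary_entropy G (2 * k)"
        by (rule itinerary_entropy_subadditive[OF G])
      finally show ?thesis unfolding itinerary_entropy_def by simp
    qed
    have lim: "(\<lambda>n. itinerary_entropy G n / real n + itinerary_entropy G (2 * k) / real n + e)
      \<longlonglongrightarrow> entropy_rate G + 0 + e"
      by (intro tendsto_add entropy_rate_tendsto[OF G] tendsto_const)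
         (rule real_tendsto_divide_at_top[OF tendsto_const filterlim_real_sequentially])
    have "itinerary_entropy V n / real n \<le> itinerary_entropy G n / real n + itinerary_entropy G (2 * k) / real n + e"
      if n: "1 \<le> n" for n
      using divide_right_mono[OF bound[of n], of "real n"] n by (simp add: add_divide_distrib)
    then show ?thesis
      using LIMSEQ_le[OF entropy_rate_tendsto[OF V] lim] by auto
  qed
  then show ?thesis
    unfolding G_def using field_le_epsilon by blast
qed

lemma ks_entropy_subshift:
  fixes X :: "(int \<Rightarrow> 'a::{finite,discrete_topology}) set"
  assumes X: "subshift X" and \<mu>: "\<mu> \<in> invariant_measures X"
  shows "ks_entropy \<mu> shift = ereal (finite_measure_system.entropy_rate \<mu> shift (\<lambda>x. x 0))"
proof (rule antisym)
  interpret finite_measure_system \<mu> shift by (rule invariant_measure_system[OF X \<mu>])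
  show "ks_entropy \<mu> shift \<le> ereal (entropy_rate (\<lambda>x. x 0))"
    by (rule ks_entropy_le) (simp add: entropy_rate_zero_coordinate[OF X \<mu>])
  show "ereal (entropy_rate (\<lambda>x. x 0)) \<le> ks_entropy \<mu> shift"
    by (rule entropy_rate_le_ks_entropy[OF simple_function_zero_coordinate[OF \<mu>]])
qed


section \<open>Uniform lifts to the normal points\<close>

lemma sets_restrict_borel_local_set:
  fixes X :: "(int \<Rightarrow> 'a::{finite,discrete_topology}) set"
  assumes X: "closed X"
  shows "sets (restrict_space borel X) = sigma_sets X ((\<lambda>A. X \<inter> A) ` {A. \<exists>k. local_set k A})"
proof -
  have "X \<in> sigma_sets UNIV {A. \<exists>k. local_set k A}"
    using borel_closed[OF X] unfolding sets_borel_local_set .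
  have "sets (restrict_space borel X) = (\<lambda>A. X \<inter> A) ` sigma_sets UNIV {A. \<exists>k. local_set k A}"
    by (simp add: sets_restrict_space sets_borel_local_set)
  also have "\<dots> = sigma_sets X ((\<lambda>A. X \<inter> A) ` {A. \<exists>k. local_set k A})"
    using \<open>X \<in> sigma_sets UNIV {A. \<exists>k. local_set k A}\<close> by (intro sigma_sets_Int) auto
  finally show ?thesis .
qed

lemma block_code_measurable:
  fixes X :: "(int \<Rightarrow> 'a::{finite,discrete_topology}) set"
    and Y :: "(int \<Rightarrow> 'b::{finite,discrete_topology}) set"
  assumes "block_code \<Phi> ` X = Y"
  shows "block_code \<Phi> \<in> measurable (restrict_space borel X) (restrict_space borel Y)"
  by (rule measurable_restrict_space3)
     (use assms in \<open>auto intro!: borel_measurable_continuous_onI continuous_on_block_code\<close>)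

text \<open>
  The number of patterns on \<open>[-N, N]\<close> of the points in a fibre is a finite sum of indicator functions of
  compact sets, and it reaches the number of points once the window separates them.
\<close>
lemma card_fibre_measurable:
  fixes Z :: "(int \<Rightarrow> 'a::{finite,discrete_topology}) set"
    and \<Phi> :: "'a \<Rightarrow> 'b::{finite,discrete_topology}"
  assumes Z: "closed Z" and fin: "\<And>y. finite {x \<in> Z. block_code \<Phi> x = y}"
  shows "(\<lambda>y. real (card {x \<in> Z. block_code \<Phi> x = y})) \<in> borel_measurable borel"
proof -
  define F where "F y = {x \<in> Z. block_code \<Phi> x = y}" for y
  define r where "r N x = restrict x {- int N..int N}" for N and x :: "int \<Rightarrow> 'a"
  define P where "P N = {- int N..int N} \<rightarrow>\<^sub>E (UNIV :: 'a set)" for N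
  have finP: "finite (P N)" for N unfolding P_def by (rule finite_PiE) auto
  define c where "c N y = (\<Sum>q\<in>P N. indicator (block_code \<Phi> ` {x \<in> Z. r N x = q}) y :: real)" for N y
  have meas: "c N \<in> borel_measurable borel" for N
  proof -
    have "block_code \<Phi> ` {x \<in> Z. r N x = q} \<in> sets borel" for q
    proof -
      have "local_set N {x. r N x = q}"
        unfolding local_set_def
      proof (intro allI impI)
        fix x z :: "int \<Rightarrow> 'a" assume "agree_on {- int N..int N} x z"
        then have "r N x = r N z" unfolding r_def agree_on_def by (intro restrict_ext) simp
        then show "x \<in> {x. r N x = q} \<longleftrightarrow> z \<in> {x. r N x = q}" by simp
      qed
      then have "closed (Z \<inter> {x. r N x = q})"
        by (intro closed_Int[OF Z local_set_closed])
      then have "compact (block_code \<Phi> ` (Z \<inter> {x. r N x = q}))"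
        by (intro compact_continuous_image continuous_on_block_code closed_imp_compact_shift)
      then have "block_code \<Phi> ` (Z \<inter> {x. r N x = q}) \<in> sets borel"
        by (intro borel_closed compact_imp_closed_shift)
      then show ?thesis by (simp add: Int_def)
    qed
    then show ?thesis unfolding c_def by (intro borel_measurable_sum borel_measurable_indicator) auto
  qed
  have c_eq: "c N y = real (card (r N ` F y))" for N y
  proof -
    have "r N ` F y \<subseteq> P N" by (auto simp: r_def P_def)
    have "c N y = (\<Sum>q\<in>P N. indicator (r N ` F y) q)"
      unfolding c_def F_def by (intro sum.cong refl) (auto simp: indicator_def)
    also have "\<dots> = real (card (P N \<inter> r N ` F y))"
      using finP by (simp add: sum.If_cases indicator_def of_bool_def)
    also have "P N \<inter> r N ` F y = r N ` F y" using \<open>r N ` F y \<subseteq> P N\<close> by blast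
    finally show ?thesis .
  qed
  have lim: "(\<lambda>N. c N y) \<longlonglongrightarrow> real (card (F y))" for y
  proof -
    have "finite (F y)" using fin by (simp add: F_def)
    then obtain K where K: "\<And>x z. x \<in> F y \<Longrightarrow> z \<in> F y \<Longrightarrow> agree_on {- int K..int K} x z \<Longrightarrow> x = z"
      using finite_set_separated_by_window by blast
    have "c N y = real (card (F y))" if N: "N \<ge> K" for N
    proof -
      have "inj_on (r N) (F y)"
      proof (rule inj_onI)
        fix x x' assume x: "x \<in> F y" "x' \<in> F y" "r N x = r N x'"
        have "x' i = x i" if "i \<in> {- int K..int K}" for i
        proof -
          have "i \<in> {- int N..int N}" using that N by auto
          then show ?thesis using fun_cong[OF x(3), of i] by (simp add: r_def)
        qed
        then show "x = x'" by (intro K[OF x(1,2)]) (simp add: agree_on_def)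
      qed
      then show ?thesis by (simp add: c_eq card_image)
    qed
    then have "\<forall>\<^sub>F N in sequentially. c N y = real (card (F y))"
      unfolding eventually_sequentially by blast
    then show ?thesis by (rule tendsto_eventually)
  qed
  show ?thesis
    using borel_measurable_LIMSEQ_real[OF lim meas] by (simp add: F_def)
qed

context lex_reduction
begin

definition normal_fibre :: "(int \<Rightarrow> 'b) \<Rightarrow> (int \<Rightarrow> 'a) set"
  where "normal_fibre y = {x \<in> normal_points. block_code \<Phi> x = y}"

definition fibre_measure :: "(int \<Rightarrow> 'b) \<Rightarrow> (int \<Rightarrow> 'a) measure"
  where "fibre_measure y =
    distr (uniform_count_measure (normal_fibre y)) (restrict_space borel X) (\<lambda>x. x)"

lemma finite_fibre: "finite (normal_fibre y)"
  unfolding normal_fibre_def by (rule finite_normal_fibre)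

lemma normal_fibre_nonempty: "y \<in> block_code \<Phi> ` X \<Longrightarrow> normal_fibre y \<noteq> {}"
  using normal_points_over by (auto simp: normal_fibre_def)

lemma fibre_inclusion_measurable:
  "(\<lambda>x. x) \<in> measurable (uniform_count_measure (normal_fibre y)) (restrict_space borel X)"
proof (rule measurableI)
  show "x \<in> space (restrict_space borel X)" if "x \<in> space (uniform_count_measure (normal_fibre y))" for x
    using that normal_points_subset
    by (auto simp: space_uniform_count_measure space_restrict_space normal_fibre_def)
qed (auto simp: space_uniform_count_measure sets_uniform_count_measure)

lemma emeasure_fibre_measure:
  assumes "A \<in> sets (restrict_space borel X)"
  shows "emeasure (fibre_measure y) A = ennreal (card (A \<inter> normal_fibre y) / card (normal_fibre y))"
  unfolding fibre_measure_def
  by (subst emeasure_distr[OF fibre_inclusion_measurable assms])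
     (simp add: space_uniform_count_measure emeasure_uniform_count_measure finite_fibre)

lemma prob_space_fibre_measure:
  assumes "y \<in> block_code \<Phi> ` X"
  shows "prob_space (fibre_measure y)"
proof -
  interpret prob_space "uniform_count_measure (normal_fibre y)"
    by (rule prob_space_uniform_count_measure[OF finite_fibre normal_fibre_nonempty[OF assms]])
  show ?thesis
    unfolding fibre_measure_def by (rule prob_space_distr[OF fibre_inclusion_measurable])
qed

lemma fibre_measure_measurable:
  assumes Y: "block_code \<Phi> ` X = Y" and \<nu>: "\<nu> \<in> invariant_measures Y"
  shows "fibre_measure \<in> measurable \<nu> (prob_algebra (restrict_space borel X))"
proof (rule measurable_prob_algebra_generated[OF sets_restrict_borel_local_set[OF closed_X]])
  show "Int_stable ((\<lambda>A. X \<inter> A) ` {A. \<exists>k. local_set k A})"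
  proof (rule Int_stableI)
    fix a b assume "a \<in> (\<lambda>A. X \<inter> A) ` {A. \<exists>k. local_set k A}" "b \<in> (\<lambda>A. X \<inter> A) ` {A. \<exists>k. local_set k A}"
    then obtain k l A B where "local_set k A" "a = X \<inter> A" "local_set l B" "b = X \<inter> B" by auto
    then have "local_set (max k l) (A \<inter> B)" "a \<inter> b = X \<inter> (A \<inter> B)" using local_set_Int by auto
    then show "a \<inter> b \<in> (\<lambda>A. X \<inter> A) ` {A. \<exists>k. local_set k A}" by blast
  qed
  show "(\<lambda>A. X \<inter> A) ` {A. \<exists>k. local_set k A} \<subseteq> Pow X" by blast
  show "prob_space (fibre_measure y)" if "y \<in> space \<nu>" for y
    using that invariant_measure_space[OF \<nu>] Y by (intro prob_space_fibre_measure) simp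
  show "sets (fibre_measure y) = sets (restrict_space borel X)" for y
    by (simp add: fibre_measure_def)
  fix a assume "a \<in> (\<lambda>A. X \<inter> A) ` {A. \<exists>k. local_set k A}"
  then obtain k A where A: "local_set k A" "a = X \<inter> A" by auto
  have a: "a \<in> sets (restrict_space borel X)"
    using A borel_open[OF local_set_open[OF A(1)]] by (auto simp: sets_restrict_space)
  have \<nu>m: "f \<in> borel_measurable \<nu>" if "f \<in> borel_measurable borel" for f :: "(int \<Rightarrow> 'b) \<Rightarrow> real"
    using measurable_restrict_space1[OF that] measurable_cong_sets[of \<nu> "restrict_space borel Y" borel borel] \<nu>
    by (auto simp: invariant_measures_def)
  have "closed normal_points" using subshift_normal_points by (simp add: subshift_def)
  then have "(\<lambda>y. real (card {x \<in> A \<inter> normal_points. block_code \<Phi> x = y})) \<in> borel_measurable borel"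
    by (intro card_fibre_measurable closed_Int local_set_closed[OF A(1)] finite_subset[OF _ finite_normal_fibre]) auto
  moreover have "(\<lambda>y. real (card {x \<in> normal_points. block_code \<Phi> x = y})) \<in> borel_measurable borel"
    by (rule card_fibre_measurable[OF \<open>closed normal_points\<close> finite_normal_fibre])
  moreover have "{x \<in> A \<inter> normal_points. block_code \<Phi> x = y} = a \<inter> normal_fibre y" for y
    using A(2) normal_points_subset by (auto simp: normal_fibre_def)
  ultimately have "(\<lambda>y. real (card (a \<inter> normal_fibre y)) / real (card (normal_fibre y))) \<in> borel_measurable \<nu>"
    by (intro \<nu>m borel_measurable_divide) (simp_all add: normal_fibre_def)
  then show "(\<lambda>y. emeasure (fibre_measure y) a) \<in> borel_measurable \<nu>"
    unfolding emeasure_fibre_measure[OF a] by (rule measurable_compose[OF _ measurable_ennreal])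
qed

lemma normal_fibre_shift: "normal_fibre (shift y) = shift ` normal_fibre y"
proof -
  have code: "block_code \<Phi> (translate a x) = translate a (block_code \<Phi> x)" for a x
    by (simp add: block_code_def translate_def)
  show ?thesis
  proof
    show "shift ` normal_fibre y \<subseteq> normal_fibre (shift y)"
      by (auto simp: normal_fibre_def shift_eq_translate translate_normal_points code)
    show "normal_fibre (shift y) \<subseteq> shift ` normal_fibre y"
    proof
      fix x assume x: "x \<in> normal_fibre (shift y)"
      have "translate (- 1) x \<in> normal_fibre y"
        using x by (simp add: normal_fibre_def shift_eq_translate translate_normal_points code translate_translate)
      moreover have "x = shift (translate (- 1) x)"
        by (simp add: shift_eq_translate translate_translate)
      ultimately show "x \<in> shift ` normal_fibre y" by blast
    qed
  qed
qed

text \<open>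
  The lift averages \<open>\<nu>\<close> over the uniform distributions on the finite fibres of the normal points. It is
  invariant because the shift maps the fibre over \<open>y\<close> bijectively onto the fibre over \<open>shift y\<close>.
\<close>
lemma lift_to_normal_points:
  assumes Y: "subshift Y" "block_code \<Phi> ` X = Y" and \<nu>: "\<nu> \<in> invariant_measures Y"
  shows "\<exists>\<mu>\<in>measures_over X (block_code \<Phi>) \<nu>. AE x in \<mu>. x \<in> normal_points"
proof -
  define N where "N = restrict_space (borel :: (int \<Rightarrow> 'a) measure) X"
  define \<mu> where "\<mu> = \<nu> \<bind> fibre_measure"
  have \<nu>': "prob_space \<nu>" "sets \<nu> = sets (restrict_space borel Y)" "distr \<nu> \<nu> shift = \<nu>"
    using \<nu> by (auto simp: invariant_measures_def)
  have sp\<nu>: "space \<nu> = Y" by (rule invariant_measure_space[OF \<nu>])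
  interpret S: finite_measure_system \<nu> shift by (rule invariant_measure_system[OF Y(1) \<nu>])
  have K: "fibre_measure \<in> measurable \<nu> (prob_algebra N)"
    unfolding N_def by (rule fibre_measure_measurable[OF Y(2) \<nu>])
  have \<nu>a: "\<nu> \<in> space (prob_algebra \<nu>)" using \<nu>'(1) by (simp add: space_prob_algebra)
  have sets\<mu>: "sets \<mu> = sets N" unfolding \<mu>_def by (rule sets_bind'[OF \<nu>a K])
  have sp\<mu>: "space \<mu> = X" using sets_eq_imp_space_eq[OF sets\<mu>] by (simp add: N_def space_restrict_space)
  have prob: "prob_space \<mu>" unfolding \<mu>_def by (rule prob_space_bind'[OF \<nu>a K])
  interpret \<mu>: prob_space \<mu> by (rule prob)
  have em: "emeasure \<mu> A = (\<integral>\<^sup>+y. emeasure (fibre_measure y) A \<partial>\<nu>)" if "A \<in> sets N" for A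
    unfolding \<mu>_def by (rule emeasure_bind_prob_algebra[OF \<nu>a K that])
  have shN: "shift \<in> measurable \<mu> \<mu>"
    using measurable_shift_restrict[OF subshift_X] measurable_cong_sets[OF sets\<mu> sets\<mu>] by (simp add: N_def)
  have inv: "distr \<mu> \<mu> shift = \<mu>"
  proof (rule measure_eqI)
    fix A assume "A \<in> sets (distr \<mu> \<mu> shift)"
    then have A: "A \<in> sets \<mu>" by simp
    have A': "shift -` A \<inter> X \<in> sets N" using measurable_sets[OF shN A] sets\<mu> sp\<mu> by simp
    have fib: "emeasure (fibre_measure y) (shift -` A \<inter> X) = emeasure (fibre_measure (shift y)) A" for y
    proof -
      have "A \<inter> normal_fibre (shift y) = shift ` ((shift -` A \<inter> X) \<inter> normal_fibre y)"
        unfolding normal_fibre_shift using normal_points_subset by (auto simp: normal_fibre_def)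
      then have "card (A \<inter> normal_fibre (shift y)) = card ((shift -` A \<inter> X) \<inter> normal_fibre y)"
        by (simp add: card_image inj_on_subset[OF inj_shift])
      moreover have "card (normal_fibre (shift y)) = card (normal_fibre y)"
        unfolding normal_fibre_shift by (simp add: card_image inj_on_subset[OF inj_shift])
      ultimately show ?thesis
        using A A' sets\<mu> by (simp add: emeasure_fibre_measure N_def)
    qed
    have kA: "(\<lambda>y. emeasure (fibre_measure y) A) \<in> borel_measurable \<nu>"
      using measurable_emeasure_kernel[OF measurable_prob_algebraD[OF K]] A sets\<mu> by simp
    have "emeasure (distr \<mu> \<mu> shift) A = (\<integral>\<^sup>+y. emeasure (fibre_measure (shift y)) A \<partial>\<nu>)"
      using emeasure_distr[OF shN A] sp\<mu> em[OF A'] by (simp add: fib)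
    also have "\<dots> = (\<integral>\<^sup>+y. emeasure (fibre_measure y) A \<partial>distr \<nu> \<nu> shift)"
      by (rule nn_integral_distr[OF S.T_measurable, symmetric]) (use kA in simp)
    also have "\<dots> = emeasure \<mu> A" using \<nu>'(3) em A sets\<mu> by simp
    finally show "emeasure (distr \<mu> \<mu> shift) A = emeasure \<mu> A" .
  qed simp
  have \<pi>m: "block_code \<Phi> \<in> measurable \<mu> \<nu>"
    using block_code_measurable[OF Y(2)] measurable_cong_sets[OF sets\<mu> \<nu>'(2)] by (simp add: N_def)
  have proj: "distr \<mu> \<nu> (block_code \<Phi>) = \<nu>"
  proof (rule measure_eqI)
    fix B assume "B \<in> sets (distr \<mu> \<nu> (block_code \<Phi>))"
    then have B: "B \<in> sets \<nu>" by simp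
    have B': "block_code \<Phi> -` B \<inter> X \<in> sets N" using measurable_sets[OF \<pi>m B] sets\<mu> sp\<mu> by simp
    have "emeasure (fibre_measure y) (block_code \<Phi> -` B \<inter> X) = indicator B y" if y: "y \<in> space \<nu>" for y
    proof -
      have ne: "card (normal_fibre y) \<noteq> 0"
        using normal_fibre_nonempty[of y] finite_fibre y sp\<nu> Y(2) by simp
      have "(block_code \<Phi> -` B \<inter> X) \<inter> normal_fibre y = (if y \<in> B then normal_fibre y else {})"
        using normal_points_subset by (auto simp: normal_fibre_def)
      then show ?thesis
        using ne B' by (simp add: emeasure_fibre_measure N_def)
    qed
    then have "(\<integral>\<^sup>+y. emeasure (fibre_measure y) (block_code \<Phi> -` B \<inter> X) \<partial>\<nu>) = (\<integral>\<^sup>+y. indicator B y \<partial>\<nu>)"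
      by (rule nn_integral_cong)
    then show "emeasure (distr \<mu> \<nu> (block_code \<Phi>)) B = emeasure \<nu> B"
      using emeasure_distr[OF \<pi>m B] sp\<mu> em[OF B'] B by simp
  qed simp
  have nm: "normal_points \<in> sets N"
  proof -
    have "normal_points \<in> sets borel" using subshift_normal_points by (simp add: subshift_def borel_closed)
    then show ?thesis using normal_points_subset by (auto simp: N_def sets_restrict_space)
  qed
  have "emeasure \<mu> normal_points = (\<integral>\<^sup>+y. 1 \<partial>\<nu>)"
    unfolding em[OF nm]
  proof (rule nn_integral_cong)
    fix y assume y: "y \<in> space \<nu>"
    have "card (normal_fibre y) \<noteq> 0"
      using normal_fibre_nonempty[of y] finite_fibre y sp\<nu> Y(2) by simp
    moreover have "normal_points \<inter> normal_fibre y = normal_fibre y" by (auto simp: normal_fibre_def)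
    ultimately show "emeasure (fibre_measure y) normal_points = 1"
      using nm by (simp add: emeasure_fibre_measure N_def)
  qed
  then have "emeasure \<mu> normal_points = 1" using S.emeasure_space_1 by simp
  then have "AE x in \<mu>. x \<in> normal_points"
    using nm sets\<mu> by (subst \<mu>.AE_in_set_eq_1) (simp_all add: measure_def)
  moreover have "\<mu> \<in> measures_over X (block_code \<Phi>) \<nu>"
    using prob sets\<mu> inv proj by (simp add: measures_over_def invariant_measures_def N_def)
  ultimately show ?thesis by blast
qed

end


section \<open>The relative entropy inequality\<close>

text \<open>
  Relative to \<open>q w\<close> the weights \<open>p\<close> on the fibre over \<open>w\<close> form a probability vector, and the Gibbs
  inequality bounds its entropy plus its mean of \<open>a\<close> by \<open>ln D\<close>. It comes from \<open>ln t \<le> t - 1\<close> for the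
  quotient \<open>t\<close> of \<open>q w * exp (a u) / D\<close> by \<open>p u\<close>.
\<close>
lemma fibred_Gibbs_inequality:
  fixes p a :: "'u \<Rightarrow> real" and q :: "'w \<Rightarrow> real"
  assumes U: "finite U" and W: "finite W" and \<phi>: "\<phi> ` U \<subseteq> W"
    and p: "\<And>u. u \<in> U \<Longrightarrow> 0 \<le> p u" and sum1: "sum p U = 1"
    and q: "\<And>w. w \<in> W \<Longrightarrow> q w = sum p {u \<in> U. \<phi> u = w}"
    and D: "0 < D" "\<And>w. w \<in> W \<Longrightarrow> (\<Sum>u\<in>{u \<in> U. \<phi> u = w}. exp (a u)) \<le> D"
  shows "(\<Sum>u\<in>U. p u * a u) - (\<Sum>u\<in>U. p u * ln (p u)) \<le> - (\<Sum>w\<in>W. q w * ln (q w)) + ln D"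
proof -
  have q0: "0 \<le> q w" if "w \<in> W" for w
    unfolding q[OF that] by (rule sum_nonneg) (use p in auto)
  have point: "p u * (a u - ln (p u) + ln (q (\<phi> u)) - ln D) \<le> q (\<phi> u) * exp (a u) / D - p u"
    if u: "u \<in> U" for u
  proof (cases "p u = 0")
    case True
    then show ?thesis using q0[of "\<phi> u"] u \<phi> D(1) by auto
  next
    case False
    then have pu: "0 < p u" using p[OF u] by simp
    have "\<phi> u \<in> W" using u \<phi> by blast
    have "p u \<le> q (\<phi> u)"
      unfolding q[OF \<open>\<phi> u \<in> W\<close>] by (rule member_le_sum) (use u U p in auto)
    then have qu: "0 < q (\<phi> u)" using pu by simp
    define t where "t = q (\<phi> u) * exp (a u) / (p u * D)"
    have "ln t = a u - ln (p u) + ln (q (\<phi> u)) - ln D"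
      using pu qu D(1) by (simp add: t_def ln_div ln_mult)
    moreover have "ln t \<le> t - 1"
      using pu qu D(1) by (intro ln_le_minus_one) (simp add: t_def)
    ultimately have "p u * (a u - ln (p u) + ln (q (\<phi> u)) - ln D) \<le> p u * (t - 1)"
      using pu by (intro mult_left_mono) auto
    also have "\<dots> = q (\<phi> u) * exp (a u) / D - p u"
      using pu D(1) by (simp add: t_def field_simps)
    finally show ?thesis .
  qed
  have "(\<Sum>u\<in>U. p u * (a u - ln (p u) + ln (q (\<phi> u)) - ln D))
    \<le> (\<Sum>u\<in>U. q (\<phi> u) * exp (a u) / D - p u)"
    by (rule sum_mono[OF point])
  also have "\<dots> = (\<Sum>w\<in>W. \<Sum>u\<in>{u \<in> U. \<phi> u = w}. q (\<phi> u) * exp (a u) / D - p u)"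
    by (rule sum.group[OF U W \<phi>, symmetric])
  also have "\<dots> \<le> (\<Sum>w\<in>W. 0)"
  proof (rule sum_mono)
    fix w assume w: "w \<in> W"
    have "(\<Sum>u\<in>{u \<in> U. \<phi> u = w}. q (\<phi> u) * exp (a u) / D - p u)
      = q w / D * (\<Sum>u\<in>{u \<in> U. \<phi> u = w}. exp (a u)) - q w"
      by (simp add: q[OF w] sum_subtractf sum_distrib_left)
    also have "\<dots> \<le> q w / D * D - q w"
      using D w q0[OF w] by (intro diff_right_mono mult_left_mono) auto
    finally show "(\<Sum>u\<in>{u \<in> U. \<phi> u = w}. q (\<phi> u) * exp (a u) / D - p u) \<le> 0"
      using D(1) by simp
  qed
  finally have "(\<Sum>u\<in>U. p u * (a u - ln (p u) + ln (q (\<phi> u)) - ln D)) \<le> 0" by simp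
  moreover have "(\<Sum>u\<in>U. p u * (a u - ln (p u) + ln (q (\<phi> u)) - ln D))
    = (\<Sum>u\<in>U. p u * a u) - (\<Sum>u\<in>U. p u * ln (p u)) + (\<Sum>u\<in>U. p u * ln (q (\<phi> u))) - ln D"
    using sum1 by (simp add: algebra_simps sum.distrib sum_subtractf flip: sum_distrib_left)
  moreover have "(\<Sum>u\<in>U. p u * ln (q (\<phi> u))) = (\<Sum>w\<in>W. q w * ln (q w))"
  proof -
    have "(\<Sum>u\<in>U. p u * ln (q (\<phi> u))) = (\<Sum>w\<in>W. \<Sum>u\<in>{u \<in> U. \<phi> u = w}. p u * ln (q (\<phi> u)))"
      by (rule sum.group[OF U W \<phi>, symmetric])
    also have "\<dots> = (\<Sum>w\<in>W. q w * ln (q w))"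
      by (intro sum.cong refl) (simp add: q sum_distrib_right)
    finally show ?thesis .
  qed
  ultimately show ?thesis by linarith
qed

lemma itinerary_fibre_eq_cylinder:
  assumes "length u = n"
  shows "itinerary shift (\<lambda>x. x 0) n -` {u} \<inter> X = cylinder X u"
proof -
  have "itinerary shift (\<lambda>x. x 0) n x = u \<longleftrightarrow> (\<forall>k<length u. x (int k) = u ! k)" for x
    unfolding itinerary_zero_coordinate list_eq_iff_nth_eq using assms by simp
  then show ?thesis unfolding cylinder_def by blast
qed

lemma itinerary_range:
  assumes "subshift X"
  shows "itinerary shift (\<lambda>x. x 0) n ` X = {u \<in> language X. length u = n}"
proof
  show "itinerary shift (\<lambda>x. x 0) n ` X \<subseteq> {u \<in> language X. length u = n}"
  proof (intro image_subsetI)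
    fix x assume "x \<in> X"
    then have "x \<in> cylinder X (itinerary shift (\<lambda>x. x 0) n x)"
      by (simp add: cylinder_def itinerary_zero_coordinate)
    then show "itinerary shift (\<lambda>x. x 0) n x \<in> {u \<in> language X. length u = n}"
      using language_iff_cylinder[OF assms] by (auto simp: itinerary_def)
  qed
  show "{u \<in> language X. length u = n} \<subseteq> itinerary shift (\<lambda>x. x 0) n ` X"
  proof
    fix u assume u: "u \<in> {u \<in> language X. length u = n}"
    then obtain x where "x \<in> cylinder X u" using language_iff_cylinder[OF assms] by auto
    then have "x \<in> itinerary shift (\<lambda>x. x 0) n -` {u} \<inter> X"
      using itinerary_fibre_eq_cylinder[of u n X] u by simp
    then show "u \<in> itinerary shift (\<lambda>x. x 0) n ` X" by blast
  qed
qed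

lemma map_entropy_itinerary:
  fixes X :: "(int \<Rightarrow> 'a::{finite,discrete_topology}) set"
  assumes X: "subshift X" and \<mu>: "\<mu> \<in> invariant_measures X"
  shows "map_entropy \<mu> (itinerary shift (\<lambda>x. x 0) n)
    = - (\<Sum>u\<in>{u \<in> language X. length u = n}. measure \<mu> (cylinder X u) * ln (measure \<mu> (cylinder X u)))"
  unfolding map_entropy_def invariant_measure_space[OF \<mu>] itinerary_range[OF X]
  by (intro arg_cong[where f = uminus] sum.cong refl) (simp add: itinerary_fibre_eq_cylinder)

lemma cylinder_measurable:
  fixes X :: "(int \<Rightarrow> 'a::{finite,discrete_topology}) set"
  assumes X: "subshift X" and \<mu>: "\<mu> \<in> invariant_measures X"
  shows "cylinder X u \<in> sets \<mu>"
proof -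
  interpret finite_measure_system \<mu> shift by (rule invariant_measure_system[OF X \<mu>])
  show ?thesis
    using simple_functionD(2)[OF simple_function_itinerary[OF simple_function_zero_coordinate[OF \<mu>]],
        of "length u" "{u}"] itinerary_fibre_eq_cylinder[of u "length u" X]
    by (simp add: invariant_measure_space[OF \<mu>])
qed

context lex_reduction
begin

lemma penalty_lower_bound:
  assumes "2 \<le> L"
  shows "- penalty_rate L 1 \<le> penalty L x"
proof -
  have "penalty_rate L (real (reduction_radius x) + 1) \<le> penalty_rate L 1"
    using assms by (intro penalty_rate_antimono) auto
  moreover have "0 \<le> penalty_rate L 1" using assms by (intro penalty_rate_nonneg) auto
  ultimately show ?thesis by (simp add: penalty_def)
qed

lemma integrable_penalty:
  assumes L: "2 \<le> L" and \<mu>: "\<mu> \<in> invariant_measures X"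
  shows "integrable \<mu> (penalty L)"
proof -
  interpret finite_measure_system \<mu> shift by (rule invariant_measure_system[OF subshift_X \<mu>])
  show ?thesis
  proof (rule integrable_const_bound[of _ "penalty_rate L 1"])
    show "AE x in \<mu>. norm (penalty L x) \<le> penalty_rate L 1"
      using penalty_lower_bound[OF L] penalty_nonpos[of L] L by (intro AE_I2) (simp add: abs_le_iff, smt (verit))
    have "penalty L \<in> borel_measurable (restrict_space borel X)"
      by (rule borel_measurable_continuous_on_restrict[OF continuous_on_penalty[OF L]])
    then show "penalty L \<in> borel_measurable \<mu>"
      using \<mu> measurable_cong_sets[of \<mu> "restrict_space borel X" borel borel]
      by (auto simp: invariant_measures_def)
  qed
qed

text \<open>
  The Gibbs inequality for the measures of the cylinders of length \<open>n\<close>; by invariance the integral of the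
  \<open>n\<close>-th Birkhoff sum is \<open>n\<close> times that of the penalty.
\<close>
lemma itinerary_entropy_penalty_le:
  assumes Y: "subshift Y" "block_code \<Phi> ` X = Y"
    and \<nu>: "\<nu> \<in> invariant_measures Y" and \<mu>: "\<mu> \<in> measures_over X (block_code \<Phi>) \<nu>"
    and L: "2 \<le> L" and C: "C = real (CARD('a) * CARD('a) ^ (2 * m))" "4 * C \<le> exp L"
  shows "map_entropy \<mu> (itinerary shift (\<lambda>x. x 0) n) + real n * (\<integral>x. penalty L x \<partial>\<mu>)
    \<le> map_entropy \<nu> (itinerary shift (\<lambda>y. y 0) n) + ln (2 * C)"
proof -
  have \<mu>': "\<mu> \<in> invariant_measures X" "distr \<mu> \<nu> (block_code \<Phi>) = \<nu>"
    using \<mu> by (auto simp: measures_over_def)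
  interpret finite_measure_system \<mu> shift by (rule invariant_measure_system[OF subshift_X \<mu>'(1)])
  define U where "U = {u \<in> language X. length u = n}"
  define W where "W = {w \<in> language Y. length w = n}"
  define p where "p u = measure \<mu> (cylinder X u)" for u
  define q where "q w = measure \<nu> (cylinder Y w)" for w
  define a where "a = cylinder_sup X (penalty L)"
  have sp: "space \<mu> = X" "space \<nu> = Y"
    using invariant_measure_space[OF \<mu>'(1)] invariant_measure_space[OF \<nu>] by auto
  have cyl: "cylinder X u \<in> sets \<mu>" for u by (rule cylinder_measurable[OF subshift_X \<mu>'(1)])
  have finU: "finite U" and finW: "finite W" by (simp_all add: U_def W_def finite_words)
  have disj: "disjoint_family_on (cylinder X) U"
    unfolding disjoint_family_on_def U_def
    by (auto simp: cylinder_def list_eq_iff_nth_eq)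
  have part: "x \<in> cylinder X u \<longleftrightarrow> u = itinerary shift (\<lambda>x. x 0) n x" if "x \<in> X" "u \<in> U" for x u
    using that itinerary_fibre_eq_cylinder[of u n X, symmetric] by (auto simp: U_def)
  have it: "itinerary shift (\<lambda>x. x 0) n x \<in> U" if "x \<in> X" for x
    using that itinerary_range[OF subshift_X, of n] by (auto simp: U_def)
  have \<pi>m: "block_code \<Phi> \<in> measurable \<mu> \<nu>"
    using block_code_measurable[OF Y(2)] \<mu>'(1) \<nu>
      measurable_cong_sets[of \<mu> "restrict_space borel X" \<nu> "restrict_space borel Y"]
    by (simp add: invariant_measures_def)
  have \<phi>: "map \<Phi> ` U \<subseteq> W"
    using map_mem_language[OF Y] by (auto simp: U_def W_def)
  have q: "q w = sum p {u \<in> U. map \<Phi> u = w}" if w: "w \<in> W" for w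
  proof -
    have "block_code \<Phi> -` cylinder Y w \<inter> X = (\<Union>u\<in>{u \<in> U. map \<Phi> u = w}. cylinder X u)"
    proof
      show "(\<Union>u\<in>{u \<in> U. map \<Phi> u = w}. cylinder X u) \<subseteq> block_code \<Phi> -` cylinder Y w \<inter> X"
        using map_fibre_cylinder Y(2) by (auto simp: cylinder_def)
      show "block_code \<Phi> -` cylinder Y w \<inter> X \<subseteq> (\<Union>u\<in>{u \<in> U. map \<Phi> u = w}. cylinder X u)"
      proof
        fix x assume x: "x \<in> block_code \<Phi> -` cylinder Y w \<inter> X"
        define u where "u = itinerary shift (\<lambda>x. x 0) n x"
        have u: "u \<in> U" "x \<in> cylinder X u" using it part x by (auto simp: u_def)
        have "map \<Phi> u = w"
          using x w by (auto simp: u_def itinerary_zero_coordinate list_eq_iff_nth_eq W_def cylinder_def block_code_def)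
        then show "x \<in> (\<Union>u\<in>{u \<in> U. map \<Phi> u = w}. cylinder X u)" using u by blast
      qed
    qed
    moreover have "q w = measure \<mu> (block_code \<Phi> -` cylinder Y w \<inter> X)"
      using measure_distr[OF \<pi>m cylinder_measurable[OF Y(1) \<nu>], of w] \<mu>'(2) sp by (simp add: q_def)
    moreover have "measure \<mu> (\<Union>u\<in>{u \<in> U. map \<Phi> u = w}. cylinder X u) = sum p {u \<in> U. map \<Phi> u = w}"
      unfolding p_def
      by (rule finite_measure_finite_Union)
         (use finU cyl disj in \<open>auto intro: disjoint_family_on_mono[rotated]\<close>)
    ultimately show ?thesis by simp
  qed
  have sum1: "sum p U = 1"
  proof -
    have "(\<Union>u\<in>U. cylinder X u) = space \<mu>"
    proof
      show "(\<Union>u\<in>U. cylinder X u) \<subseteq> space \<mu>" by (auto simp: sp cylinder_def)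
      show "space \<mu> \<subseteq> (\<Union>u\<in>U. cylinder X u)" using it part by (auto simp: sp)
    qed
    moreover have "measure \<mu> (\<Union>u\<in>U. cylinder X u) = sum p U"
      unfolding p_def by (rule finite_measure_finite_Union) (use finU cyl disj in auto)
    ultimately show ?thesis using prob_space by simp
  qed
  have int: "integrable \<mu> (penalty L)" by (rule integrable_penalty[OF L \<mu>'(1)])
  have int_k: "integrable \<mu> (\<lambda>x. penalty L ((shift ^^ k) x))"
    "(\<integral>x. penalty L ((shift ^^ k) x) \<partial>\<mu>) = (\<integral>x. penalty L x \<partial>\<mu>)" for k
  proof -
    show "integrable \<mu> (\<lambda>x. penalty L ((shift ^^ k) x))"
      by (rule integrable_distr[OF funpow_measurable]) (simp only: funpow_invariant int)
    show "(\<integral>x. penalty L ((shift ^^ k) x) \<partial>\<mu>) = (\<integral>x. penalty L x \<partial>\<mu>)"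
      using integral_distr[OF funpow_measurable borel_measurable_integrable[OF int], of k]
      by (simp only: funpow_invariant)
  qed
  have "real n * (\<integral>x. penalty L x \<partial>\<mu>) = (\<integral>x. birkhoff_sum (penalty L) n x \<partial>\<mu>)"
    by (simp add: int_k)
  also have "\<dots> \<le> (\<integral>x. (\<Sum>u\<in>U. a u * indicator (cylinder X u) x) \<partial>\<mu>)"
  proof (rule integral_mono)
    show "integrable \<mu> (birkhoff_sum (penalty L) n)" by (intro Bochner_Integration.integrable_sum int_k)
    show "integrable \<mu> (\<lambda>x. \<Sum>u\<in>U. a u * indicator (cylinder X u) x)"
      using cyl by (intro Bochner_Integration.integrable_sum integrable_mult_right integrable_real_indicator)
        (auto simp: emeasure_eq_measure)
    fix x assume x: "x \<in> space \<mu>"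
    define u where "u = itinerary shift (\<lambda>x. x 0) n x"
    have u: "u \<in> U" "x \<in> cylinder X u" using it part x sp by (auto simp: u_def)
    have "(\<Sum>v\<in>U. a v * indicator (cylinder X v) x) = (\<Sum>v\<in>U. if v = u then a u else 0)"
      by (rule sum.cong) (use part x sp in \<open>auto simp: u_def indicator_def\<close>)
    also have "\<dots> = a u" using u finU by simp
    finally have "(\<Sum>v\<in>U. a v * indicator (cylinder X v) x) = a u" .
    moreover have "birkhoff_sum (penalty L) (length u) x \<le> a u"
      unfolding a_def
      by (rule cylinder_sup_upper[OF subshift_X _ u(2), of _ 0]) (use L in \<open>simp add: penalty_nonpos\<close>)
    ultimately show "birkhoff_sum (penalty L) n x \<le> (\<Sum>u\<in>U. a u * indicator (cylinder X u) x)"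
      using u(1) by (simp add: U_def)
  qed
  also have "\<dots> = (\<Sum>u\<in>U. p u * a u)"
    using cyl sets.sets_into_space[OF cyl]
    by (subst Bochner_Integration.integral_sum)
       (auto simp: p_def emeasure_eq_measure Int_absorb2 mult.commute intro!: sum.cong)
  finally have "real n * (\<integral>x. penalty L x \<partial>\<mu>) \<le> (\<Sum>u\<in>U. p u * a u)" .
  moreover have "(\<Sum>u\<in>U. p u * a u) - (\<Sum>u\<in>U. p u * ln (p u)) \<le> - (\<Sum>w\<in>W. q w * ln (q w)) + ln (2 * C)"
  proof (rule fibred_Gibbs_inequality[OF finU finW \<phi> _ sum1 q])
    show "0 \<le> p u" for u by (simp add: p_def)
    show "0 < 2 * C" by (simp add: C(1))
    fix w assume "w \<in> W"
    then have "{u \<in> U. map \<Phi> u = w} = fibre_words w" by (auto simp: U_def W_def fibre_words_def)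
    then show "(\<Sum>u\<in>{u \<in> U. map \<Phi> u = w}. exp (a u)) \<le> 2 * C"
      using fibre_partition_sum_le[OF L C, of w] by (simp add: a_def)
  qed
  moreover have "map_entropy \<mu> (itinerary shift (\<lambda>x. x 0) n) = - (\<Sum>u\<in>U. p u * ln (p u))"
    unfolding map_entropy_itinerary[OF subshift_X \<mu>'(1)] U_def p_def ..
  moreover have "map_entropy \<nu> (itinerary shift (\<lambda>x. x 0) n) = - (\<Sum>w\<in>W. q w * ln (q w))"
    unfolding map_entropy_itinerary[OF Y(1) \<nu>] W_def q_def ..
  ultimately show ?thesis by linarith
qed

lemma relative_entropy_penalty_le:
  assumes Y: "subshift Y" "block_code \<Phi> ` X = Y"
    and \<nu>: "\<nu> \<in> invariant_measures Y" and \<mu>: "\<mu> \<in> measures_over X (block_code \<Phi>) \<nu>"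
    and L: "2 \<le> L" and C: "C = real (CARD('a) * CARD('a) ^ (2 * m))" "4 * C \<le> exp L"
  shows "finite_measure_system.entropy_rate \<mu> shift (\<lambda>x. x 0) + (\<integral>x. penalty L x \<partial>\<mu>)
    \<le> finite_measure_system.entropy_rate \<nu> shift (\<lambda>y. y 0)"
proof -
  have \<mu>': "\<mu> \<in> invariant_measures X" using \<mu> by (auto simp: measures_over_def)
  interpret M: finite_measure_system \<mu> shift by (rule invariant_measure_system[OF subshift_X \<mu>'])
  interpret N: finite_measure_system \<nu> shift by (rule invariant_measure_system[OF Y(1) \<nu>])
  let ?I = "\<integral>x. penalty L x \<partial>\<mu>"
  have "(\<lambda>n. M.itinerary_entropy (\<lambda>x. x 0) n / real n + ?I) \<longlonglongrightarrow> M.entropy_rate (\<lambda>x. x 0) + ?I"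
    by (intro tendsto_add M.entropy_rate_tendsto simple_function_zero_coordinate[OF \<mu>'] tendsto_const)
  moreover have "(\<lambda>n. N.itinerary_entropy (\<lambda>x. x 0) n / real n + ln (2 * C) / real n)
    \<longlonglongrightarrow> N.entropy_rate (\<lambda>x. x 0) + 0"
    by (intro tendsto_add N.entropy_rate_tendsto simple_function_zero_coordinate[OF \<nu>])
       (rule real_tendsto_divide_at_top[OF tendsto_const filterlim_real_sequentially])
  moreover have "M.itinerary_entropy (\<lambda>x. x 0) n / real n + ?I
    \<le> N.itinerary_entropy (\<lambda>x. x 0) n / real n + ln (2 * C) / real n" if n: "1 \<le> n" for n
    using divide_right_mono[OF itinerary_entropy_penalty_le[OF Y \<nu> \<mu> L C, of n], of "real n"] n
    by (simp add: add_divide_distrib M.itinerary_entropy_def N.itinerary_entropy_def)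
  ultimately show ?thesis
    using LIMSEQ_le[of "\<lambda>n. M.itinerary_entropy (\<lambda>x. x 0) n / real n + ?I" _
        "\<lambda>n. N.itinerary_entropy (\<lambda>x. x 0) n / real n + ln (2 * C) / real n"] by auto
qed

text \<open>
  The lift of \<open>\<nu>\<close> to the normal points shows that the supremum is nonnegative. One of the two copies of the
  penalty integral already compensates the relative entropy of \<open>\<mu>\<close>, so the other one must vanish.
\<close>
lemma relative_equilibrium_state_normal:
  assumes Y: "subshift Y" "block_code \<Phi> ` X = Y" and \<nu>: "\<nu> \<in> invariant_measures Y"
    and eq: "relative_equilibrium_state X (block_code \<Phi>) (\<lambda>x. 2 * penalty L x) \<nu> \<mu>"
    and L: "2 \<le> L" and C: "C = real (CARD('a) * CARD('a) ^ (2 * m))" "4 * C \<le> exp L"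
  shows "measure \<mu> normal_points = 1"
proof -
  have \<mu>: "\<mu> \<in> measures_over X (block_code \<Phi>) \<nu>"
    using eq by (simp add: relative_equilibrium_state_def)
  then have \<mu>': "\<mu> \<in> invariant_measures X" by (simp add: measures_over_def)
  interpret M: finite_measure_system \<mu> shift by (rule invariant_measure_system[OF subshift_X \<mu>'])
  interpret N: finite_measure_system \<nu> shift by (rule invariant_measure_system[OF Y(1) \<nu>])
  obtain \<mu>0 where \<mu>0: "\<mu>0 \<in> measures_over X (block_code \<Phi>) \<nu>" "AE x in \<mu>0. x \<in> normal_points"
    using lift_to_normal_points[OF Y \<nu>] by blast
  have \<mu>0': "\<mu>0 \<in> invariant_measures X" "distr \<mu>0 \<nu> (block_code \<Phi>) = \<nu>"
    using \<mu>0(1) by (auto simp: measures_over_def)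
  interpret M0: finite_measure_system \<mu>0 shift by (rule invariant_measure_system[OF subshift_X \<mu>0'(1)])
  have \<pi>m: "block_code \<Phi> \<in> measurable \<mu>0 \<nu>"
    using block_code_measurable[OF Y(2)] \<mu>0'(1) \<nu>
      measurable_cong_sets[of \<mu>0 "restrict_space borel X" \<nu> "restrict_space borel Y"]
    by (simp add: invariant_measures_def)
  have "ks_entropy \<nu> shift \<le> ks_entropy \<mu>0 shift"
    by (rule ks_entropy_factor_le[OF M0.finite_measure_system_axioms N.finite_measure_system_axioms \<pi>m \<mu>0'(2)])
       (simp add: block_code_def shift_def)
  then have "N.entropy_rate (\<lambda>y. y 0) \<le> M0.entropy_rate (\<lambda>x. x 0)"
    by (simp add: ks_entropy_subshift[OF Y(1) \<nu>] ks_entropy_subshift[OF subshift_X \<mu>0'(1)])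
  moreover have "(\<integral>x. 2 * penalty L x \<partial>\<mu>0) = 0"
  proof (rule integral_eq_zero_AE)
    show "AE x in \<mu>0. 2 * penalty L x = 0"
      using \<mu>0(2) by (rule eventually_mono) (simp add: penalty_eq_0)
  qed
  ultimately have "0 \<le> ks_entropy \<mu>0 shift - ks_entropy \<nu> shift + ereal (\<integral>x. 2 * penalty L x \<partial>\<mu>0)"
    by (simp add: ks_entropy_subshift[OF Y(1) \<nu>] ks_entropy_subshift[OF subshift_X \<mu>0'(1)])
  also have "\<dots> \<le> (SUP \<mu>'\<in>measures_over X (block_code \<Phi>) \<nu>.
      ks_entropy \<mu>' shift - ks_entropy \<nu> shift + ereal (\<integral>x. 2 * penalty L x \<partial>\<mu>'))"
    by (rule SUP_upper[OF \<mu>0(1)])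
  also have "\<dots> = ks_entropy \<mu> shift - ks_entropy \<nu> shift + ereal (\<integral>x. 2 * penalty L x \<partial>\<mu>)"
    using eq by (simp add: relative_equilibrium_state_def)
  finally have "0 \<le> M.entropy_rate (\<lambda>x. x 0) - N.entropy_rate (\<lambda>y. y 0) + 2 * (\<integral>x. penalty L x \<partial>\<mu>)"
    by (simp add: ks_entropy_subshift[OF Y(1) \<nu>] ks_entropy_subshift[OF subshift_X \<mu>'])
  then have "0 \<le> (\<integral>x. penalty L x \<partial>\<mu>)"
    using relative_entropy_penalty_le[OF Y \<nu> \<mu> L C] by linarith
  moreover have "0 \<le> (\<integral>x. - penalty L x \<partial>\<mu>)"
    by (rule integral_nonneg_AE) (use L in \<open>simp add: penalty_nonpos\<close>)
  ultimately have "(\<integral>x. - penalty L x \<partial>\<mu>) = 0" by simp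
  then have "AE x in \<mu>. - penalty L x = 0"
    using integrable_penalty[OF L \<mu>'] L
    by (subst (asm) integral_nonneg_eq_0_iff_AE) (auto simp: penalty_nonpos)
  then have "AE x in \<mu>. x \<in> normal_points"
  proof (rule AE_mp, intro AE_I2 impI)
    fix x assume "x \<in> space \<mu>" "- penalty L x = 0"
    then show "x \<in> normal_points"
      using penalty_neg[of L x] L invariant_measure_space[OF \<mu>'] by force
  qed
  moreover have "normal_points \<in> sets \<mu>"
  proof -
    have "normal_points \<in> sets borel" using subshift_normal_points by (simp add: subshift_def borel_closed)
    moreover have "normal_points = normal_points \<inter> X" using normal_points_subset by blast
    ultimately show ?thesis using invariant_measure_sets[OF \<mu>'] by blast
  qed
  ultimately show ?thesis by (simp add: M.prob_eq_1)
qed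

end

theorem theorem4p1:
  fixes X :: "(int \<Rightarrow> 'a::{finite,discrete_topology}) set"
    and Y :: "(int \<Rightarrow> 'b::{finite,discrete_topology}) set"
    and \<Phi> :: "'a \<Rightarrow> 'b"
  assumes "finite_type X" and "irreducible_shift X"
    and "subshift Y" and "factor_map X Y (block_code \<Phi>)"
  shows "\<exists>f. compensation_function X Y (block_code \<Phi>) f
           \<and> Walters_type X Y (block_code \<Phi>) f
           \<and> (\<forall>p>1. p_Dini X p f)"
proof -
  obtain m where splice: "\<And>x z a. x \<in> X \<Longrightarrow> z \<in> X \<Longrightarrow> agree_on {a..<a + int m} x z
      \<Longrightarrow> (\<lambda>i. if i < a then x i else z i) \<in> X"
    using finite_type_splice[OF assms(1)] by blast
  obtain rank :: "'a \<Rightarrow> nat" where rank: "inj rank"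
    using finite_imp_inj_to_nat_seg[of "UNIV :: 'a set"] by auto
  interpret lex_reduction X \<Phi> m rank
    by unfold_locales (use assms(1) splice rank in \<open>auto simp: finite_type_def\<close>)
  have Y: "block_code \<Phi> ` X = Y" using assms(4) by (simp add: factor_map_def)
  \<comment> \<open>\<open>C\<close> bounds the number of irreducible and of minimally reducible words over a given word;
    the lower bound \<open>2\<close> for \<open>L\<close> makes the penalty rate decreasing.\<close>
  define C where "C = real (CARD('a) * CARD('a) ^ (2 * m))"
  define L where "L = max 2 (ln (4 * C))"
  have L: "2 \<le> L" by (simp add: L_def)
  have "0 < 4 * C" by (simp add: C_def)
  then have C: "4 * C \<le> exp L" by (simp add: L_def flip: ln_le_cancel_iff)
  show ?thesis
  proof (intro exI[of _ "\<lambda>x. 2 * penalty L x"] conjI allI impI)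
    show "compensation_function X Y (block_code \<Phi>) (\<lambda>x. 2 * penalty L x)"
    proof (rule compensation_functionI[OF assms(3) Y _ _ _ L C_def C])
      show "continuous_on X (\<lambda>x. 2 * penalty L x)"
        by (intro continuous_on_mult_left continuous_on_penalty[OF L])
      show "2 * penalty L x \<le> penalty L x" for x using penalty_nonpos[of L x] L by simp
      show "2 * penalty L x = 0" if "x \<in> normal_points" for x by (simp add: penalty_eq_0[OF that])
    qed
    show "Walters_type X Y (block_code \<Phi>) (\<lambda>x. 2 * penalty L x)"
      unfolding Walters_type_def
    proof (intro exI[of _ normal_points] conjI ballI allI impI)
      show "subshift normal_points" by (rule subshift_normal_points)
      show "normal_points \<subseteq> X" by (rule normal_points_subset)
      show "block_code \<Phi> ` normal_points = Y"
        using normal_points_over normal_points_subset Y by (auto simp: image_iff) metis+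
      show "finite {x \<in> normal_points. block_code \<Phi> x = y}" for y by (rule finite_normal_fibre)
      show "measure \<mu> normal_points = 1" if "\<nu> \<in> invariant_measures Y"
        "relative_equilibrium_state X (block_code \<Phi>) (\<lambda>x. 2 * penalty L x) \<nu> \<mu>" for \<nu> \<mu>
        by (rule relative_equilibrium_state_normal[OF assms(3) Y that L C_def C])
    qed
    show "p_Dini X p (\<lambda>x. 2 * penalty L x)" if "1 < p" for p
      by (rule p_Dini_penalty[OF L that])
  qed
qed


end
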